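(* Let $\mathcal C$ be a $BTC^*$ with braiding $\varepsilon$ and $\mathcal S\subset\mathcal C$ an even symmetric subcategory. The braiding $\varepsilon$ of $\mathcal C$ lifts to a braiding for $\mathcal C\rtimes_0\mathcal S$ (that is, the family $\tilde\varepsilon(\rho,\sigma)=\varepsilon(\rho,\sigma)\otimes\Omega\in\mathrm{Hom}_{\mathcal C\rtimes_0\mathcal S}(\rho\sigma,\sigma\rho)$ is a braiding of $\mathcal C\rtimes_0\mathcal S$) if and only if $\mathcal S\subset\mathcal D(\mathcal C)$.
   Context: Tensor categories. All are small and strict; $\rho\sigma$ is the tensor product of objects, $\times$ that of arrows, $\circ$ is composition, $\iota$ the unit. A tensor $*$-category has complex vector spaces as Hom-sets, bilinear $\circ,\times$, and a positive $*$-operation (antilinear, involutive, contravariant, monoidal, and $X^*\circ X=0\Rightarrow X=0$). $\rho$ is irreducible if $\mathrm{Hom}(\rho,\rho)=\mathbb C\,\mathrm{id}_\rho$. Subobjects (for every projection $E=E^*=E^2\in\mathrm{Hom}(\rho,\rho)$ an isometry $V$ with $VV^*=E$), direct sums (isometries $V_i\in\mathrm{Hom}(\rho_i,\tau)$ with $V_1V_1^*+V_2V_2^*=\mathrm{id}_\tau$) and conjugates ($R\in\mathrm{Hom}(\iota,\bar\rho\rho)$, $\bar R\in\mathrm{Hom}(\iota,\rho\bar\rho)$ with $(\bar R^*\times\mathrm{id}_\rho)\circ(\mathrm{id}_\rho\times R)=\mathrm{id}_\rho$, $(R^*\times\mathrm{id}_{\bar\rho})\circ(\mathrm{id}_{\bar\rho}\times\bar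 R)=\mathrm{id}_{\bar\rho}$, normalized by $R^*R=\bar R^*\bar R=d(\rho)\mathrm{id}_\iota$ for $\rho$ irreducible) are meant in the $*$-sense. For reducible $\rho$ only standard solutions $R_\rho=\sum_i(\bar W_i\times W_i)\circ R_i$, built from a decomposition into irreducibles, are used. A $TC^*$ is a tensor $*$-category with conjugates, direct sums, subobjects, finite dimensional Hom-spaces and irreducible unit; a $BTC^*$ is a $TC^*$ with unitary braiding $\varepsilon$; an $STC^*$ is a symmetric $BTC^*$. Degenerate objects: $\rho\in\mathcal C$ is degenerate if $\varepsilon(\eta,\rho)\circ\varepsilon(\rho,\eta)=\mathrm{id}_{\rho\eta}$ for all $\eta\in\mathcal C$; $\mathcal D(\mathcal C)$ is the full subcategory of degenerate objects. The twist is $\kappa(\rho)=(R_\rho^*\times\mathrm{id}_\rho)\circ(\mathrm{id}_{\bar\rho}\times\varepsilon(\rho,\rho))\circ(R_\rho\times\mathrm{id}_\rho)$. Even symmetric subcategory $\mathcal S\subset\mathcal C$: a replete full tensor subcategory on which $\varepsilon$ is symmetric, closed under conjugates, direct sums and subobjects, with all twists $\kappa(\rho)=\mathrm{id}_\rho$, $\rho\in\mathcal S$. By Doplicher–Roberts there are a compact group $G=\mathrm{Gal}(\mathcal S)$, unique up to isomorphism, and an isomorphism $F:\mathcal S\to U(G)$ of symmetric tensor $*$-categories onto a category $U(G)$ of finite dimensional continuous unitary representations of $G$ closed under direct sums and subrepresentations and containing members of all classes of irreducibles. Tensor product in $U(G)$ is $\boxtimes$; $F(\iota)=\mathbb C$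 contains a unit vector $\Omega$ with $\Omega\boxtimes\psi=\psi\boxtimes\Omega=\psi$. Crossed product $\mathcal C\rtimes_0\mathcal S$: let $\hat G$ be the set of isomorphism classes of irreducible objects of $\mathcal S$, $\gamma_k$ ($k\in\hat G$) representatives with $\gamma_0=\iota$, $\mathcal H_k=F(\gamma_k)$; choose orthonormal bases $\{V_{k,l}^{m,\alpha}\}_{\alpha=1}^{N_{k,l}^m}$ of $\mathrm{Hom}(\gamma_m,\gamma_k\gamma_l)$ ($V^*\circ W=\langle V,W\rangle\mathrm{id}$), and normalized solutions $R_k\in\mathrm{Hom}(\iota,\gamma_{\bar k}\gamma_k)$, $\bar R_k\in\mathrm{Hom}(\iota,\gamma_k\gamma_{\bar k})$ of the conjugate equations with $R_{\bar k}=\bar R_k$, $\bar R_{\bar k}=R_k$ if $\bar k\neq k$ and $\bar R_k=\pm R_k$ if $\bar k=k$. $\mathcal C\rtimes_0\mathcal S$ has the objects and tensor product of objects of $\mathcal C$, and $\mathrm{Hom}_{\mathcal C\rtimes_0\mathcal S}(\rho,\sigma)=\bigoplus_{k\in\hat G}\mathrm{Hom}_{\mathcal C}(\gamma_k\rho,\sigma)\otimes\mathcal H_k$. For $S\in\mathrm{Hom}(\gamma_k\sigma,\delta)$, $T\in\mathrm{Hom}(\gamma_l\rho,\sigma)$, $\psi_k\in\mathcal H_k,\psi_l\in\mathcal H_l$, $$(S\otimes\psi_k)\circ(T\otimes\psi_l)=\bigoplus_{m}\sum_\alpha\big[S\circ(\mathrm{id}_{\gamma_k}\times T)\circ(V_{k,l}^{m,\alpha}\times\mathrm{id}_\rho)\big]\otimes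 F(V_{k,l}^{m,\alpha})^*(\psi_k\boxtimes\psi_l);$$ for $S\in\mathrm{Hom}(\gamma_k\rho_1,\sigma_1)$, $T\in\mathrm{Hom}(\gamma_l\rho_2,\sigma_2)$, $$(S\otimes\psi_k)\times(T\otimes\psi_l)=\bigoplus_{m}\sum_\alpha\big[(S\times T)\circ(\mathrm{id}_{\gamma_k}\times\varepsilon(\gamma_l,\rho_1)\times\mathrm{id}_{\rho_2})\circ(V_{k,l}^{m,\alpha}\times\mathrm{id}_{\rho_1\rho_2})\big]\otimes F(V_{k,l}^{m,\alpha})^*(\psi_k\boxtimes\psi_l);$$ for $S\in\mathrm{Hom}(\gamma_k\rho,\sigma)$, $(S\otimes\psi_k)^*=\big[(R_k^*\times\mathrm{id}_\rho)\circ(\mathrm{id}_{\gamma_{\bar k}}\times S^* )\big]\otimes\bar\psi$, where $\bar\psi\in\mathcal H_{\bar k}$ is defined by $\langle a,\bar\psi\rangle=\langle\psi_k\boxtimes a,F(\bar R_k)\Omega\rangle$ for all $a\in\mathcal H_{\bar k}$ (inner products antilinear in the first variable). $\mathcal C$ is a subcategory of $\mathcal C\rtimes_0\mathcal S$ via $S\mapsto S\otimes\Omega$. *)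

theory Defs
  imports
    "HOL-Analysis.Analysis"
    "HOL-Algebra.Group"
    "HOL-Library.Multiset"
    "HOL-Library.Function_Algebras"
begin

section \<open>Strict tensor \<open>*\<close>-categories\<close>

text \<open>
  \<open>Hom C \<rho> \<sigma>\<close> is a subset of an arrow type \<open>'a\<close>. Sets of arrows for different pairs of objects are
  not required to be disjoint, and every axiom below only speaks about operations applied to arrows
  of the appropriate sets. Composition is written \<open>\<cdot>\<close>, the tensor product of objects \<open>\<odot>\<close>, the tensor
  product of arrows \<open>\<parallel>\<close>.
\<close>

record ('o, 'a) star_tensor =
  Obj :: "'o set"
  Hom :: "'o \<Rightarrow> 'o \<Rightarrow> 'a set"
  idn :: "'o \<Rightarrow> 'a"
  cmp :: "'a \<Rightarrow> 'a \<Rightarrow> 'a" (infixl "\<cdot>\<index>" 70)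
  unt :: "'o"
  tns :: "'o \<Rightarrow> 'o \<Rightarrow> 'o" (infixl "\<odot>\<index>" 75)
  par :: "'a \<Rightarrow> 'a \<Rightarrow> 'a" (infixl "\<parallel>\<index>" 75)
  adj :: "'a \<Rightarrow> 'a"

text \<open>
  For categories whose Hom-sets are complex vector spaces, these are subspaces of an ambient space
  \<open>'a\<close> (for instance the direct sum of all Hom-spaces), with scalar multiplication \<open>scl\<close>.
\<close>

record ('o, 'a) lin_star_tensor = "('o, 'a) star_tensor" +
  scl :: "complex \<Rightarrow> 'a \<Rightarrow> 'a"

locale strict_tensor_category =
  fixes C :: "('o, 'a, 'z) star_tensor_scheme" (structure)
  assumes unt_Obj: "unt C \<in> Obj C"
    and tns_Obj: "\<lbrakk>\<rho> \<in> Obj C; \<sigma> \<in> Obj C\<rbrakk> \<Longrightarrow> \<rho> \<odot> \<sigma> \<in> Obj C"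
    and idn_Hom: "\<rho> \<in> Obj C \<Longrightarrow> idn C \<rho> \<in> Hom C \<rho> \<rho>"
    and cmp_Hom: "\<lbrakk>\<rho> \<in> Obj C; \<sigma> \<in> Obj C; \<tau> \<in> Obj C; f \<in> Hom C \<sigma> \<tau>; g \<in> Hom C \<rho> \<sigma>\<rbrakk>
      \<Longrightarrow> f \<cdot> g \<in> Hom C \<rho> \<tau>"
    and idn_left: "\<lbrakk>\<rho> \<in> Obj C; \<sigma> \<in> Obj C; f \<in> Hom C \<rho> \<sigma>\<rbrakk> \<Longrightarrow> idn C \<sigma> \<cdot> f = f"
    and idn_right: "\<lbrakk>\<rho> \<in> Obj C; \<sigma> \<in> Obj C; f \<in> Hom C \<rho> \<sigma>\<rbrakk> \<Longrightarrow> f \<cdot> idn C \<rho> = f"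
    and cmp_assoc: "\<lbrakk>\<rho> \<in> Obj C; \<sigma> \<in> Obj C; \<tau> \<in> Obj C; \<upsilon> \<in> Obj C;
        f \<in> Hom C \<tau> \<upsilon>; g \<in> Hom C \<sigma> \<tau>; h \<in> Hom C \<rho> \<sigma>\<rbrakk> \<Longrightarrow> (f \<cdot> g) \<cdot> h = f \<cdot> (g \<cdot> h)"
    and par_Hom: "\<lbrakk>\<rho> \<in> Obj C; \<sigma> \<in> Obj C; \<rho>' \<in> Obj C; \<sigma>' \<in> Obj C;
        f \<in> Hom C \<rho> \<sigma>; g \<in> Hom C \<rho>' \<sigma>'\<rbrakk> \<Longrightarrow> f \<parallel> g \<in> Hom C (\<rho> \<odot> \<rho>') (\<sigma> \<odot> \<sigma>')"
    and tns_assoc: "\<lbrakk>\<rho> \<in> Obj C; \<sigma> \<in> Obj C; \<tau> \<in> Obj C\<rbrakk> \<Longrightarrow> (\<rho> \<odot> \<sigma>) \<odot> \<tau> = \<rho> \<odot> (\<sigma> \<odot> \<tau>)"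
    and tns_unt: "\<rho> \<in> Obj C \<Longrightarrow> unt C \<odot> \<rho> = \<rho>" "\<rho> \<in> Obj C \<Longrightarrow> \<rho> \<odot> unt C = \<rho>"
    and par_assoc: "\<lbrakk>\<rho> \<in> Obj C; \<sigma> \<in> Obj C; \<rho>' \<in> Obj C; \<sigma>' \<in> Obj C; \<rho>'' \<in> Obj C; \<sigma>'' \<in> Obj C;
        f \<in> Hom C \<rho> \<sigma>; g \<in> Hom C \<rho>' \<sigma>'; h \<in> Hom C \<rho>'' \<sigma>''\<rbrakk>
      \<Longrightarrow> (f \<parallel> g) \<parallel> h = f \<parallel> (g \<parallel> h)"
    and par_unt: "\<lbrakk>\<rho> \<in> Obj C; \<sigma> \<in> Obj C; f \<in> Hom C \<rho> \<sigma>\<rbrakk> \<Longrightarrow> idn C (unt C) \<parallel> f = f"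
      "\<lbrakk>\<rho> \<in> Obj C; \<sigma> \<in> Obj C; f \<in> Hom C \<rho> \<sigma>\<rbrakk> \<Longrightarrow> f \<parallel> idn C (unt C) = f"
    and par_idn: "\<lbrakk>\<rho> \<in> Obj C; \<sigma> \<in> Obj C\<rbrakk> \<Longrightarrow> idn C \<rho> \<parallel> idn C \<sigma> = idn C (\<rho> \<odot> \<sigma>)"
    and interchange: "\<lbrakk>\<rho> \<in> Obj C; \<sigma> \<in> Obj C; \<tau> \<in> Obj C; \<rho>' \<in> Obj C; \<sigma>' \<in> Obj C; \<tau>' \<in> Obj C;
        f \<in> Hom C \<sigma> \<tau>; g \<in> Hom C \<rho> \<sigma>; f' \<in> Hom C \<sigma>' \<tau>'; g' \<in> Hom C \<rho>' \<sigma>'\<rbrakk>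
      \<Longrightarrow> (f \<parallel> f') \<cdot> (g \<parallel> g') = (f \<cdot> g) \<parallel> (f' \<cdot> g')"

locale tensor_star_category = strict_tensor_category C
  for C :: "('o, 'a::ab_group_add, 'z) lin_star_tensor_scheme" (structure) +
  assumes vector_space: "vector_space (scl C)"
    and Hom_subspace: "\<lbrakk>\<rho> \<in> Obj C; \<sigma> \<in> Obj C\<rbrakk> \<Longrightarrow> module.subspace (scl C) (Hom C \<rho> \<sigma>)"
    and cmp_add: "\<lbrakk>\<rho> \<in> Obj C; \<sigma> \<in> Obj C; \<tau> \<in> Obj C; f \<in> Hom C \<sigma> \<tau>; f' \<in> Hom C \<sigma> \<tau>;
        g \<in> Hom C \<rho> \<sigma>\<rbrakk> \<Longrightarrow> (f + f') \<cdot> g = f \<cdot> g + f' \<cdot> g"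
      "\<lbrakk>\<rho> \<in> Obj C; \<sigma> \<in> Obj C; \<tau> \<in> Obj C; f \<in> Hom C \<sigma> \<tau>; g \<in> Hom C \<rho> \<sigma>;
        g' \<in> Hom C \<rho> \<sigma>\<rbrakk> \<Longrightarrow> f \<cdot> (g + g') = f \<cdot> g + f \<cdot> g'"
    and cmp_scl: "\<lbrakk>\<rho> \<in> Obj C; \<sigma> \<in> Obj C; \<tau> \<in> Obj C; f \<in> Hom C \<sigma> \<tau>; g \<in> Hom C \<rho> \<sigma>\<rbrakk>
      \<Longrightarrow> scl C c f \<cdot> g = scl C c (f \<cdot> g)"
      "\<lbrakk>\<rho> \<in> Obj C; \<sigma> \<in> Obj C; \<tau> \<in> Obj C; f \<in> Hom C \<sigma> \<tau>; g \<in> Hom C \<rho> \<sigma>\<rbrakk>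
      \<Longrightarrow> f \<cdot> scl C c g = scl C c (f \<cdot> g)"
    and par_add: "\<lbrakk>\<rho> \<in> Obj C; \<sigma> \<in> Obj C; \<rho>' \<in> Obj C; \<sigma>' \<in> Obj C; f \<in> Hom C \<rho> \<sigma>; f' \<in> Hom C \<rho> \<sigma>;
        g \<in> Hom C \<rho>' \<sigma>'\<rbrakk> \<Longrightarrow> (f + f') \<parallel> g = f \<parallel> g + f' \<parallel> g"
      "\<lbrakk>\<rho> \<in> Obj C; \<sigma> \<in> Obj C; \<rho>' \<in> Obj C; \<sigma>' \<in> Obj C; f \<in> Hom C \<rho> \<sigma>;
        g \<in> Hom C \<rho>' \<sigma>'; g' \<in> Hom C \<rho>' \<sigma>'\<rbrakk> \<Longrightarrow> f \<parallel> (g + g') = f \<parallel> g + f \<parallel> g'"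
    and par_scl: "\<lbrakk>\<rho> \<in> Obj C; \<sigma> \<in> Obj C; \<rho>' \<in> Obj C; \<sigma>' \<in> Obj C; f \<in> Hom C \<rho> \<sigma>;
        g \<in> Hom C \<rho>' \<sigma>'\<rbrakk> \<Longrightarrow> scl C c f \<parallel> g = scl C c (f \<parallel> g)"
      "\<lbrakk>\<rho> \<in> Obj C; \<sigma> \<in> Obj C; \<rho>' \<in> Obj C; \<sigma>' \<in> Obj C; f \<in> Hom C \<rho> \<sigma>;
        g \<in> Hom C \<rho>' \<sigma>'\<rbrakk> \<Longrightarrow> f \<parallel> scl C c g = scl C c (f \<parallel> g)"
    and adj_Hom: "\<lbrakk>\<rho> \<in> Obj C; \<sigma> \<in> Obj C; f \<in> Hom C \<rho> \<sigma>\<rbrakk> \<Longrightarrow> adj C f \<in> Hom C \<sigma> \<rho>"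
    and adj_adj: "\<lbrakk>\<rho> \<in> Obj C; \<sigma> \<in> Obj C; f \<in> Hom C \<rho> \<sigma>\<rbrakk> \<Longrightarrow> adj C (adj C f) = f"
    and adj_add: "\<lbrakk>\<rho> \<in> Obj C; \<sigma> \<in> Obj C; f \<in> Hom C \<rho> \<sigma>; g \<in> Hom C \<rho> \<sigma>\<rbrakk>
      \<Longrightarrow> adj C (f + g) = adj C f + adj C g"
    and adj_scl: "\<lbrakk>\<rho> \<in> Obj C; \<sigma> \<in> Obj C; f \<in> Hom C \<rho> \<sigma>\<rbrakk>
      \<Longrightarrow> adj C (scl C c f) = scl C (cnj c) (adj C f)"
    and adj_cmp: "\<lbrakk>\<rho> \<in> Obj C; \<sigma> \<in> Obj C; \<tau> \<in> Obj C; f \<in> Hom C \<sigma> \<tau>; g \<in> Hom C \<rho> \<sigma>\<rbrakk>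
      \<Longrightarrow> adj C (f \<cdot> g) = adj C g \<cdot> adj C f"
    and adj_par: "\<lbrakk>\<rho> \<in> Obj C; \<sigma> \<in> Obj C; \<rho>' \<in> Obj C; \<sigma>' \<in> Obj C; f \<in> Hom C \<rho> \<sigma>;
        g \<in> Hom C \<rho>' \<sigma>'\<rbrakk> \<Longrightarrow> adj C (f \<parallel> g) = adj C f \<parallel> adj C g"
    and adj_pos: "\<lbrakk>\<rho> \<in> Obj C; \<sigma> \<in> Obj C; f \<in> Hom C \<rho> \<sigma>; adj C f \<cdot> f = 0\<rbrakk> \<Longrightarrow> f = 0"

context
  fixes C :: "('o, 'a, 'z) star_tensor_scheme" (structure)
begin

definition iso_obj :: "'o \<Rightarrow> 'o \<Rightarrow> bool" where
  "iso_obj \<rho> \<sigma> \<longleftrightarrow> (\<exists>f\<in>Hom C \<rho> \<sigma>. \<exists>g\<in>Hom C \<sigma> \<rho>. g \<cdot> f = idn C \<rho> \<and> f \<cdot> g = idn C \<sigma>)"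

definition isometry_in :: "'o \<Rightarrow> 'o \<Rightarrow> 'a \<Rightarrow> bool" where
  "isometry_in \<rho> \<sigma> V \<longleftrightarrow> V \<in> Hom C \<rho> \<sigma> \<and> adj C V \<cdot> V = idn C \<rho>"

definition conj_solution :: "'o \<Rightarrow> 'o \<Rightarrow> 'a \<Rightarrow> 'a \<Rightarrow> bool" where
  "conj_solution \<rho> \<rho>b R Rb \<longleftrightarrow>
     R \<in> Hom C (unt C) (\<rho>b \<odot> \<rho>) \<and> Rb \<in> Hom C (unt C) (\<rho> \<odot> \<rho>b) \<and>
     (adj C Rb \<parallel> idn C \<rho>) \<cdot> (idn C \<rho> \<parallel> R) = idn C \<rho> \<and>
     (adj C R \<parallel> idn C \<rho>b) \<cdot> (idn C \<rho>b \<parallel> Rb) = idn C \<rho>b"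

definition braiding :: "('o \<Rightarrow> 'o \<Rightarrow> 'a) \<Rightarrow> bool" where
  "braiding \<epsilon> \<longleftrightarrow>
     (\<forall>\<rho>\<in>Obj C. \<forall>\<sigma>\<in>Obj C. \<epsilon> \<rho> \<sigma> \<in> Hom C (\<rho> \<odot> \<sigma>) (\<sigma> \<odot> \<rho>)) \<and>
     (\<forall>\<rho>\<in>Obj C. \<forall>\<sigma>\<in>Obj C. \<exists>g\<in>Hom C (\<sigma> \<odot> \<rho>) (\<rho> \<odot> \<sigma>).
        g \<cdot> \<epsilon> \<rho> \<sigma> = idn C (\<rho> \<odot> \<sigma>) \<and> \<epsilon> \<rho> \<sigma> \<cdot> g = idn C (\<sigma> \<odot> \<rho>)) \<and>
     (\<forall>\<rho>\<in>Obj C. \<forall>\<sigma>\<in>Obj C. \<forall>\<rho>'\<in>Obj C. \<forall>\<sigma>'\<in>Obj C. \<forall>S\<in>Hom C \<rho> \<rho>'. \<forall>T\<in>Hom C \<sigma> \<sigma>'.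
        \<epsilon> \<rho>' \<sigma>' \<cdot> (S \<parallel> T) = (T \<parallel> S) \<cdot> \<epsilon> \<rho> \<sigma>) \<and>
     (\<forall>\<rho>\<in>Obj C. \<forall>\<sigma>\<in>Obj C. \<forall>\<tau>\<in>Obj C.
        \<epsilon> \<rho> (\<sigma> \<odot> \<tau>) = (idn C \<sigma> \<parallel> \<epsilon> \<rho> \<tau>) \<cdot> (\<epsilon> \<rho> \<sigma> \<parallel> idn C \<tau>) \<and>
        \<epsilon> (\<rho> \<odot> \<sigma>) \<tau> = (\<epsilon> \<rho> \<tau> \<parallel> idn C \<sigma>) \<cdot> (idn C \<rho> \<parallel> \<epsilon> \<sigma> \<tau>))"

definition unitary_family :: "('o \<Rightarrow> 'o \<Rightarrow> 'a) \<Rightarrow> bool" where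
  "unitary_family \<epsilon> \<longleftrightarrow> (\<forall>\<rho>\<in>Obj C. \<forall>\<sigma>\<in>Obj C.
     adj C (\<epsilon> \<rho> \<sigma>) \<cdot> \<epsilon> \<rho> \<sigma> = idn C (\<rho> \<odot> \<sigma>) \<and> \<epsilon> \<rho> \<sigma> \<cdot> adj C (\<epsilon> \<rho> \<sigma>) = idn C (\<sigma> \<odot> \<rho>))"

definition degenerate_objects :: "('o \<Rightarrow> 'o \<Rightarrow> 'a) \<Rightarrow> 'o set" where
  "degenerate_objects \<epsilon> = {\<rho> \<in> Obj C. \<forall>\<eta>\<in>Obj C. \<epsilon> \<eta> \<rho> \<cdot> \<epsilon> \<rho> \<eta> = idn C (\<rho> \<odot> \<eta>)}"

end

context
  fixes C :: "('o, 'a::ab_group_add, 'z) lin_star_tensor_scheme" (structure)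
begin

text \<open>\<open>Hom C \<rho> \<rho> \<cong> \<complex>\<close>; as usual a zero object is not regarded as irreducible.\<close>

definition irreducible_obj :: "'o \<Rightarrow> bool" where
  "irreducible_obj \<rho> \<longleftrightarrow> idn C \<rho> \<noteq> 0 \<and> Hom C \<rho> \<rho> = range (\<lambda>c. scl C c (idn C \<rho>))"

definition direct_sum_obj :: "'o \<Rightarrow> 'o \<Rightarrow> 'o \<Rightarrow> bool" where
  "direct_sum_obj \<rho>1 \<rho>2 \<tau> \<longleftrightarrow> (\<exists>V1 V2. isometry_in C \<rho>1 \<tau> V1 \<and> isometry_in C \<rho>2 \<tau> V2 \<and>
     V1 \<cdot> adj C V1 + V2 \<cdot> adj C V2 = idn C \<tau>)"

definition normalized_solution :: "'o \<Rightarrow> 'o \<Rightarrow> 'a \<Rightarrow> 'a \<Rightarrow> bool" where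
  "normalized_solution \<rho> \<rho>b R Rb \<longleftrightarrow> conj_solution C \<rho> \<rho>b R Rb \<and>
     (\<exists>d::real. adj C R \<cdot> R = scl C (of_real d) (idn C (unt C)) \<and>
                adj C Rb \<cdot> Rb = scl C (of_real d) (idn C (unt C)))"

definition irred_decomposition :: "'o \<Rightarrow> nat \<Rightarrow> (nat \<Rightarrow> 'o) \<Rightarrow> (nat \<Rightarrow> 'a) \<Rightarrow> bool" where
  "irred_decomposition \<rho> n \<rho>i W \<longleftrightarrow>
     (\<forall>i<n. \<rho>i i \<in> Obj C \<and> irreducible_obj (\<rho>i i) \<and> isometry_in C (\<rho>i i) \<rho> (W i)) \<and>
     (\<Sum>i<n. W i \<cdot> adj C (W i)) = idn C \<rho>"

definition standard_solution :: "'o \<Rightarrow> 'o \<Rightarrow> 'a \<Rightarrow> 'a \<Rightarrow> bool" where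
  "standard_solution \<rho> \<rho>b R Rb \<longleftrightarrow> (\<exists>n \<rho>i \<rho>bi W Wb r rb.
     irred_decomposition \<rho> n \<rho>i W \<and> irred_decomposition \<rho>b n \<rho>bi Wb \<and>
     (\<forall>i<n. normalized_solution (\<rho>i i) (\<rho>bi i) (r i) (rb i)) \<and>
     R = (\<Sum>i<n. (Wb i \<parallel> W i) \<cdot> r i) \<and> Rb = (\<Sum>i<n. (W i \<parallel> Wb i) \<cdot> rb i))"

definition twist :: "('o \<Rightarrow> 'o \<Rightarrow> 'a) \<Rightarrow> 'o \<Rightarrow> 'o \<Rightarrow> 'a \<Rightarrow> 'a" where
  "twist \<epsilon> \<rho> \<rho>b R = (adj C R \<parallel> idn C \<rho>) \<cdot> (idn C \<rho>b \<parallel> \<epsilon> \<rho> \<rho>) \<cdot> (R \<parallel> idn C \<rho>)"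

end

locale TC_star = tensor_star_category C
  for C :: "('o, 'a::ab_group_add, 'z) lin_star_tensor_scheme" (structure) +
  assumes conjugates: "\<rho> \<in> Obj C \<Longrightarrow> \<exists>\<rho>b\<in>Obj C. \<exists>R Rb. conj_solution C \<rho> \<rho>b R Rb \<and>
      (irreducible_obj C \<rho> \<longrightarrow> normalized_solution C \<rho> \<rho>b R Rb)"
    and direct_sums: "\<lbrakk>\<rho>1 \<in> Obj C; \<rho>2 \<in> Obj C\<rbrakk> \<Longrightarrow> \<exists>\<tau>\<in>Obj C. direct_sum_obj C \<rho>1 \<rho>2 \<tau>"
    and subobjects: "\<lbrakk>\<rho> \<in> Obj C; E \<in> Hom C \<rho> \<rho>; adj C E = E; E \<cdot> E = E\<rbrakk>
      \<Longrightarrow> \<exists>\<sigma>\<in>Obj C. \<exists>V. isometry_in C \<sigma> \<rho> V \<and> V \<cdot> adj C V = E"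
    and finite_dim: "\<lbrakk>\<rho> \<in> Obj C; \<sigma> \<in> Obj C\<rbrakk>
      \<Longrightarrow> \<exists>B. finite B \<and> Hom C \<rho> \<sigma> = module.span (scl C) B"
    and irreducible_unt: "irreducible_obj C (unt C)"

locale BTC_star = TC_star C
  for C :: "('o, 'a::ab_group_add, 'z) lin_star_tensor_scheme" (structure) +
  fixes \<epsilon> :: "'o \<Rightarrow> 'o \<Rightarrow> 'a"
  assumes braided: "braiding C \<epsilon>"
    and unitary: "unitary_family C \<epsilon>"

text \<open>
  A full subcategory is given by its set of objects. The twist does not depend on the choice of the
  standard solution defining it.
\<close>

locale even_symmetric_subcategory =
  fixes C :: "('o, 'a::ab_group_add, 'z) lin_star_tensor_scheme" (structure)
    and \<epsilon> :: "'o \<Rightarrow> 'o \<Rightarrow> 'a"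
    and S :: "'o set"
  assumes sub: "S \<subseteq> Obj C"
    and unt_in: "unt C \<in> S"
    and tns_in: "\<lbrakk>\<rho> \<in> S; \<sigma> \<in> S\<rbrakk> \<Longrightarrow> \<rho> \<odot> \<sigma> \<in> S"
    and replete: "\<lbrakk>\<rho> \<in> S; \<sigma> \<in> Obj C; iso_obj C \<rho> \<sigma>\<rbrakk> \<Longrightarrow> \<sigma> \<in> S"
    and symmetric: "\<lbrakk>\<rho> \<in> S; \<sigma> \<in> S\<rbrakk> \<Longrightarrow> \<epsilon> \<sigma> \<rho> \<cdot> \<epsilon> \<rho> \<sigma> = idn C (\<rho> \<odot> \<sigma>)"
    and conj_in: "\<lbrakk>\<rho> \<in> S; \<rho>b \<in> Obj C; conj_solution C \<rho> \<rho>b R Rb\<rbrakk> \<Longrightarrow> \<rho>b \<in> S"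
    and direct_sum_in: "\<lbrakk>\<rho>1 \<in> S; \<rho>2 \<in> S; \<tau> \<in> Obj C; direct_sum_obj C \<rho>1 \<rho>2 \<tau>\<rbrakk> \<Longrightarrow> \<tau> \<in> S"
    and subobject_in: "\<lbrakk>\<rho> \<in> S; \<sigma> \<in> Obj C; isometry_in C \<sigma> \<rho> V\<rbrakk> \<Longrightarrow> \<sigma> \<in> S"
    and twists: "\<lbrakk>\<rho> \<in> S; \<rho>b \<in> Obj C; standard_solution C \<rho> \<rho>b R Rb\<rbrakk>
      \<Longrightarrow> twist C \<epsilon> \<rho> \<rho>b R = idn C \<rho>"

section \<open>Categories of representations of a compact group\<close>

locale compact_group = group G for G :: "('g, 'y) monoid_scheme" (structure) +
  fixes TG :: "'g topology"
  assumes topspace: "topspace TG = carrier G"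
    and compact: "compact_space TG"
    and hausdorff: "Hausdorff_space TG"
    and continuous_mult: "continuous_map (prod_topology TG TG) TG (\<lambda>(g, h). g \<otimes> h)"
    and continuous_inv: "continuous_map TG TG (\<lambda>g. inv g)"

record ('g, 'v) rep =
  rscl :: "complex \<Rightarrow> 'v \<Rightarrow> 'v"
  rsp :: "'v set"
  rip :: "'v \<Rightarrow> 'v \<Rightarrow> complex"
  ract :: "'g \<Rightarrow> 'v \<Rightarrow> 'v"

text \<open>
  The Hilbert space of a representation is a subspace \<open>rsp\<close> of an ambient vector space. In finite
  dimension strong continuity is the same as continuity of the matrix coefficients.
\<close>

locale unitary_rep =
  fixes G :: "('g, 'y) monoid_scheme" (structure)
    and TG :: "'g topology"
    and r :: "('g, 'v::ab_group_add) rep"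
  assumes vector_space: "vector_space (rscl r)"
    and finite_dim: "\<exists>B. finite B \<and> rsp r = module.span (rscl r) B"
    and ip_add: "\<lbrakk>x \<in> rsp r; y \<in> rsp r; z \<in> rsp r\<rbrakk> \<Longrightarrow> rip r x (y + z) = rip r x y + rip r x z"
    and ip_scl: "\<lbrakk>x \<in> rsp r; y \<in> rsp r\<rbrakk> \<Longrightarrow> rip r x (rscl r c y) = c * rip r x y"
    and ip_cnj: "\<lbrakk>x \<in> rsp r; y \<in> rsp r\<rbrakk> \<Longrightarrow> rip r y x = cnj (rip r x y)"
    and ip_pos: "\<lbrakk>x \<in> rsp r; x \<noteq> 0\<rbrakk> \<Longrightarrow> 0 < Re (rip r x x)"
    and act_in: "\<lbrakk>g \<in> carrier G; x \<in> rsp r\<rbrakk> \<Longrightarrow> ract r g x \<in> rsp r"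
    and act_add: "\<lbrakk>g \<in> carrier G; x \<in> rsp r; y \<in> rsp r\<rbrakk>
      \<Longrightarrow> ract r g (x + y) = ract r g x + ract r g y"
    and act_scl: "\<lbrakk>g \<in> carrier G; x \<in> rsp r\<rbrakk> \<Longrightarrow> ract r g (rscl r c x) = rscl r c (ract r g x)"
    and act_one: "x \<in> rsp r \<Longrightarrow> ract r \<one> x = x"
    and act_mult: "\<lbrakk>g \<in> carrier G; h \<in> carrier G; x \<in> rsp r\<rbrakk>
      \<Longrightarrow> ract r (g \<otimes> h) x = ract r g (ract r h x)"
    and act_ip: "\<lbrakk>g \<in> carrier G; x \<in> rsp r; y \<in> rsp r\<rbrakk>
      \<Longrightarrow> rip r (ract r g x) (ract r g y) = rip r x y"
    and act_continuous: "\<lbrakk>x \<in> rsp r; y \<in> rsp r\<rbrakk>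
      \<Longrightarrow> continuous_map TG euclidean (\<lambda>g. rip r x (ract r g y))"

definition intertwiner ::
  "('g, 'y) monoid_scheme \<Rightarrow> ('g, 'v::ab_group_add) rep \<Rightarrow> ('g, 'w::ab_group_add) rep \<Rightarrow> ('v \<Rightarrow> 'w) \<Rightarrow> bool"
where
  "intertwiner G r s f \<longleftrightarrow>
     (\<forall>x\<in>rsp r. f x \<in> rsp s) \<and>
     (\<forall>x\<in>rsp r. \<forall>y\<in>rsp r. f (x + y) = f x + f y) \<and>
     (\<forall>c. \<forall>x\<in>rsp r. f (rscl r c x) = rscl s c (f x)) \<and>
     (\<forall>g\<in>carrier G. \<forall>x\<in>rsp r. f (ract r g x) = ract s g (f x))"

definition isometric_intertwiner ::
  "('g, 'y) monoid_scheme \<Rightarrow> ('g, 'v::ab_group_add) rep \<Rightarrow> ('g, 'w::ab_group_add) rep \<Rightarrow> ('v \<Rightarrow> 'w) \<Rightarrow> bool"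
where
  "isometric_intertwiner G r s f \<longleftrightarrow> intertwiner G r s f \<and>
     (\<forall>x\<in>rsp r. \<forall>y\<in>rsp r. rip s (f x) (f y) = rip r x y)"

definition invariant_subspace ::
  "('g, 'y) monoid_scheme \<Rightarrow> ('g, 'v::ab_group_add) rep \<Rightarrow> 'v set \<Rightarrow> bool" where
  "invariant_subspace G r K \<longleftrightarrow> module.subspace (rscl r) K \<and> K \<subseteq> rsp r \<and>
     (\<forall>g\<in>carrier G. \<forall>x\<in>K. ract r g x \<in> K)"

definition irreducible_rep ::
  "('g, 'y) monoid_scheme \<Rightarrow> ('g, 'v::ab_group_add) rep \<Rightarrow> bool" where
  "irreducible_rep G r \<longleftrightarrow> rsp r \<noteq> {0} \<and>
     (\<forall>K. invariant_subspace G r K \<longrightarrow> K = {0} \<or> K = rsp r)"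

text \<open>
  Data for a strict tensor category of representations: \<open>vtns U u w \<psi> \<phi>\<close> is the vector
  \<open>\<psi> \<boxtimes> \<phi>\<close> in the space of \<open>utns U u w\<close>, for \<open>\<psi>\<close>, \<open>\<phi>\<close> in the spaces of \<open>u\<close>, \<open>w\<close>.
\<close>

record ('g, 'u, 'v) rep_cat =
  UObj :: "'u set"
  urep :: "'u \<Rightarrow> ('g, 'v) rep"
  uunt :: "'u"
  utns :: "'u \<Rightarrow> 'u \<Rightarrow> 'u"
  vtns :: "'u \<Rightarrow> 'u \<Rightarrow> 'v \<Rightarrow> 'v \<Rightarrow> 'v"
  vac :: "'v" ("\<Omega>\<index>")

abbreviation Hsp :: "('g, 'u, 'v) rep_cat \<Rightarrow> 'u \<Rightarrow> 'v set" where
  "Hsp U u \<equiv> rsp (urep U u)"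

locale rep_category =
  fixes G :: "('g, 'y) monoid_scheme"
    and TG :: "'g topology"
    and U :: "('g, 'u, 'v::ab_group_add) rep_cat"
  assumes reps: "u \<in> UObj U \<Longrightarrow> unitary_rep G TG (urep U u)"
    and uunt_in: "uunt U \<in> UObj U"
    and utns_in: "\<lbrakk>u \<in> UObj U; w \<in> UObj U\<rbrakk> \<Longrightarrow> utns U u w \<in> UObj U"
    and utns_assoc: "\<lbrakk>u \<in> UObj U; v \<in> UObj U; w \<in> UObj U\<rbrakk>
      \<Longrightarrow> utns U (utns U u v) w = utns U u (utns U v w)"
    and utns_uunt: "u \<in> UObj U \<Longrightarrow> utns U (uunt U) u = u" "u \<in> UObj U \<Longrightarrow> utns U u (uunt U) = u"
    and vtns_in: "\<lbrakk>u \<in> UObj U; w \<in> UObj U; x \<in> Hsp U u; y \<in> Hsp U w\<rbrakk>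
      \<Longrightarrow> vtns U u w x y \<in> Hsp U (utns U u w)"
    and vtns_add:
      "\<lbrakk>u \<in> UObj U; w \<in> UObj U; x \<in> Hsp U u; x' \<in> Hsp U u; y \<in> Hsp U w\<rbrakk>
        \<Longrightarrow> vtns U u w (x + x') y = vtns U u w x y + vtns U u w x' y"
      "\<lbrakk>u \<in> UObj U; w \<in> UObj U; x \<in> Hsp U u; y \<in> Hsp U w; y' \<in> Hsp U w\<rbrakk>
        \<Longrightarrow> vtns U u w x (y + y') = vtns U u w x y + vtns U u w x y'"
    and vtns_scl:
      "\<lbrakk>u \<in> UObj U; w \<in> UObj U; x \<in> Hsp U u; y \<in> Hsp U w\<rbrakk>
        \<Longrightarrow> vtns U u w (rscl (urep U u) c x) y = rscl (urep U (utns U u w)) c (vtns U u w x y)"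
      "\<lbrakk>u \<in> UObj U; w \<in> UObj U; x \<in> Hsp U u; y \<in> Hsp U w\<rbrakk>
        \<Longrightarrow> vtns U u w x (rscl (urep U w) c y) = rscl (urep U (utns U u w)) c (vtns U u w x y)"
    and vtns_ip:
      "\<lbrakk>u \<in> UObj U; w \<in> UObj U; x \<in> Hsp U u; x' \<in> Hsp U u; y \<in> Hsp U w; y' \<in> Hsp U w\<rbrakk>
        \<Longrightarrow> rip (urep U (utns U u w)) (vtns U u w x y) (vtns U u w x' y')
            = rip (urep U u) x x' * rip (urep U w) y y'"
    and vtns_span: "\<lbrakk>u \<in> UObj U; w \<in> UObj U\<rbrakk> \<Longrightarrow> Hsp U (utns U u w) =
        module.span (rscl (urep U (utns U u w))) {vtns U u w x y |x y. x \<in> Hsp U u \<and> y \<in> Hsp U w}"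
    and vtns_act: "\<lbrakk>u \<in> UObj U; w \<in> UObj U; g \<in> carrier G; x \<in> Hsp U u; y \<in> Hsp U w\<rbrakk>
      \<Longrightarrow> ract (urep U (utns U u w)) g (vtns U u w x y)
          = vtns U u w (ract (urep U u) g x) (ract (urep U w) g y)"
    and vtns_assoc: "\<lbrakk>u \<in> UObj U; v \<in> UObj U; w \<in> UObj U; x \<in> Hsp U u; y \<in> Hsp U v; z \<in> Hsp U w\<rbrakk>
      \<Longrightarrow> vtns U (utns U u v) w (vtns U u v x y) z = vtns U u (utns U v w) x (vtns U v w y z)"
    and vac_span: "Hsp U (uunt U) = range (\<lambda>c. rscl (urep U (uunt U)) c \<Omega>\<^bsub>U\<^esub>)"
    and vac_unit: "rip (urep U (uunt U)) \<Omega>\<^bsub>U\<^esub> \<Omega>\<^bsub>U\<^esub> = 1"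
    and vac_act: "g \<in> carrier G \<Longrightarrow> ract (urep U (uunt U)) g \<Omega>\<^bsub>U\<^esub> = \<Omega>\<^bsub>U\<^esub>"
    and vac_vtns:
      "\<lbrakk>u \<in> UObj U; x \<in> Hsp U u\<rbrakk> \<Longrightarrow> vtns U (uunt U) u \<Omega>\<^bsub>U\<^esub> x = x"
      "\<lbrakk>u \<in> UObj U; x \<in> Hsp U u\<rbrakk> \<Longrightarrow> vtns U u (uunt U) x \<Omega>\<^bsub>U\<^esub> = x"
    and direct_sums: "\<lbrakk>u \<in> UObj U; w \<in> UObj U\<rbrakk> \<Longrightarrow> \<exists>t\<in>UObj U. \<exists>J1 J2.
        isometric_intertwiner G (urep U u) (urep U t) J1 \<and>
        isometric_intertwiner G (urep U w) (urep U t) J2 \<and>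
        (\<forall>x\<in>Hsp U u. \<forall>y\<in>Hsp U w. rip (urep U t) (J1 x) (J2 y) = 0) \<and>
        (\<forall>z\<in>Hsp U t. \<exists>x\<in>Hsp U u. \<exists>y\<in>Hsp U w. z = J1 x + J2 y)"
    and subreps: "\<lbrakk>u \<in> UObj U; invariant_subspace G (urep U u) K\<rbrakk>
      \<Longrightarrow> \<exists>w\<in>UObj U. \<exists>J. isometric_intertwiner G (urep U w) (urep U u) J \<and> J ` Hsp U w = K"
    \<comment> \<open>Every finite dimensional representation is equivalent to one on a subspace of
      \<open>nat \<Rightarrow> complex\<close>, so all classes of irreducibles are covered.\<close>
    and irreducibles: "\<And>r :: ('g, nat \<Rightarrow> complex) rep. \<lbrakk>unitary_rep G TG r; irreducible_rep G r\<rbrakk>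
      \<Longrightarrow> \<exists>u\<in>UObj U. \<exists>J. isometric_intertwiner G r (urep U u) J \<and> J ` rsp r = Hsp U u"

record ('o, 'a, 'u, 'v) rep_functor =
  fobj :: "'o \<Rightarrow> 'u"
  farr :: "'o \<Rightarrow> 'o \<Rightarrow> 'a \<Rightarrow> 'v \<Rightarrow> 'v"

text \<open>
  An isomorphism of symmetric tensor \<open>*\<close>-categories from the full subcategory \<open>S\<close> onto \<open>U\<close>, whose
  arrows are the intertwiners and whose symmetry is the flip. \<open>farr F \<rho> \<sigma> T\<close> is \<open>F(T)\<close> for
  \<open>T \<in> Hom C \<rho> \<sigma>\<close>; only its values on the space of \<open>F(\<rho>)\<close> matter.
\<close>

locale rep_isomorphism =
  fixes C :: "('o, 'a::ab_group_add, 'z) lin_star_tensor_scheme" (structure)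
    and \<epsilon> :: "'o \<Rightarrow> 'o \<Rightarrow> 'a"
    and S :: "'o set"
    and G :: "('g, 'y) monoid_scheme"
    and U :: "('g, 'u, 'v::ab_group_add) rep_cat"
    and F :: "('o, 'a, 'u, 'v) rep_functor"
  assumes fobj_bij: "bij_betw (fobj F) S (UObj U)"
    and fobj_unt: "fobj F (unt C) = uunt U"
    and fobj_tns: "\<lbrakk>\<rho> \<in> S; \<sigma> \<in> S\<rbrakk> \<Longrightarrow> fobj F (\<rho> \<odot> \<sigma>) = utns U (fobj F \<rho>) (fobj F \<sigma>)"
    and farr_intertwiner: "\<lbrakk>\<rho> \<in> S; \<sigma> \<in> S; T \<in> Hom C \<rho> \<sigma>\<rbrakk>
      \<Longrightarrow> intertwiner G (urep U (fobj F \<rho>)) (urep U (fobj F \<sigma>)) (farr F \<rho> \<sigma> T)"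
    and farr_bij: "\<lbrakk>\<rho> \<in> S; \<sigma> \<in> S; intertwiner G (urep U (fobj F \<rho>)) (urep U (fobj F \<sigma>)) f\<rbrakk>
      \<Longrightarrow> \<exists>!T. T \<in> Hom C \<rho> \<sigma> \<and> (\<forall>x\<in>Hsp U (fobj F \<rho>). farr F \<rho> \<sigma> T x = f x)"
    and farr_add: "\<lbrakk>\<rho> \<in> S; \<sigma> \<in> S; T \<in> Hom C \<rho> \<sigma>; T' \<in> Hom C \<rho> \<sigma>; x \<in> Hsp U (fobj F \<rho>)\<rbrakk>
      \<Longrightarrow> farr F \<rho> \<sigma> (T + T') x = farr F \<rho> \<sigma> T x + farr F \<rho> \<sigma> T' x"
    and farr_scl: "\<lbrakk>\<rho> \<in> S; \<sigma> \<in> S; T \<in> Hom C \<rho> \<sigma>; x \<in> Hsp U (fobj F \<rho>)\<rbrakk>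
      \<Longrightarrow> farr F \<rho> \<sigma> (scl C c T) x = rscl (urep U (fobj F \<sigma>)) c (farr F \<rho> \<sigma> T x)"
    and farr_idn: "\<lbrakk>\<rho> \<in> S; x \<in> Hsp U (fobj F \<rho>)\<rbrakk> \<Longrightarrow> farr F \<rho> \<rho> (idn C \<rho>) x = x"
    and farr_cmp: "\<lbrakk>\<rho> \<in> S; \<sigma> \<in> S; \<tau> \<in> S; T \<in> Hom C \<sigma> \<tau>; T' \<in> Hom C \<rho> \<sigma>; x \<in> Hsp U (fobj F \<rho>)\<rbrakk>
      \<Longrightarrow> farr F \<rho> \<tau> (T \<cdot> T') x = farr F \<sigma> \<tau> T (farr F \<rho> \<sigma> T' x)"
    and farr_par: "\<lbrakk>\<rho> \<in> S; \<sigma> \<in> S; \<rho>' \<in> S; \<sigma>' \<in> S; T \<in> Hom C \<rho> \<sigma>; T' \<in> Hom C \<rho>' \<sigma>';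
        x \<in> Hsp U (fobj F \<rho>); y \<in> Hsp U (fobj F \<rho>')\<rbrakk>
      \<Longrightarrow> farr F (\<rho> \<odot> \<rho>') (\<sigma> \<odot> \<sigma>') (T \<parallel> T') (vtns U (fobj F \<rho>) (fobj F \<rho>') x y)
          = vtns U (fobj F \<sigma>) (fobj F \<sigma>') (farr F \<rho> \<sigma> T x) (farr F \<rho>' \<sigma>' T' y)"
    and farr_adj: "\<lbrakk>\<rho> \<in> S; \<sigma> \<in> S; T \<in> Hom C \<rho> \<sigma>; x \<in> Hsp U (fobj F \<rho>); y \<in> Hsp U (fobj F \<sigma>)\<rbrakk>
      \<Longrightarrow> rip (urep U (fobj F \<sigma>)) (farr F \<rho> \<sigma> T x) y
          = rip (urep U (fobj F \<rho>)) x (farr F \<sigma> \<rho> (adj C T) y)"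
    and farr_flip: "\<lbrakk>\<rho> \<in> S; \<sigma> \<in> S; x \<in> Hsp U (fobj F \<rho>); y \<in> Hsp U (fobj F \<sigma>)\<rbrakk>
      \<Longrightarrow> farr F (\<rho> \<odot> \<sigma>) (\<sigma> \<odot> \<rho>) (\<epsilon> \<rho> \<sigma>) (vtns U (fobj F \<rho>) (fobj F \<sigma>) x y)
          = vtns U (fobj F \<sigma>) (fobj F \<rho>) y x"

section \<open>The crossed product\<close>

definition iso_class :: "('o, 'a, 'z) star_tensor_scheme \<Rightarrow> 'o \<Rightarrow> 'o set" where
  "iso_class C \<rho> = {\<sigma> \<in> Obj C. iso_obj C \<rho> \<sigma>}"

definition Ghat :: "('o, 'a::ab_group_add, 'z) lin_star_tensor_scheme \<Rightarrow> 'o set \<Rightarrow> 'o set set" where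
  "Ghat C S = iso_class C ` {\<rho> \<in> S. irreducible_obj C \<rho>}"

definition conj_class :: "('o, 'a, 'z) star_tensor_scheme \<Rightarrow> 'o set \<Rightarrow> 'o set" where
  "conj_class C k = {\<sigma> \<in> Obj C. \<exists>\<rho>\<in>k. \<exists>R Rb. conj_solution C \<rho> \<sigma> R Rb}"

text \<open>
  \<open>vb k l m \<alpha>\<close> for \<open>1 \<le> \<alpha> \<le> mlt k l m\<close> is the basis vector \<open>V\<^bsub>k,l\<^esub>\<^bsup>m,\<alpha>\<^esup>\<close>, and \<open>rr k\<close>, \<open>rrb k\<close> are
  \<open>R\<^sub>k\<close> and its partner.
\<close>

record ('o, 'a) cp_choice =
  gam :: "'o set \<Rightarrow> 'o"
  mlt :: "'o set \<Rightarrow> 'o set \<Rightarrow> 'o set \<Rightarrow> nat"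
  vb :: "'o set \<Rightarrow> 'o set \<Rightarrow> 'o set \<Rightarrow> nat \<Rightarrow> 'a"
  rr :: "'o set \<Rightarrow> 'a"
  rrb :: "'o set \<Rightarrow> 'a"

locale crossed_product_choice =
  fixes C :: "('o, 'a::ab_group_add, 'z) lin_star_tensor_scheme" (structure)
    and S :: "'o set"
    and K :: "('o, 'a) cp_choice"
  assumes gam_in: "k \<in> Ghat C S \<Longrightarrow> gam K k \<in> k"
    and gam_unt: "gam K (iso_class C (unt C)) = unt C"
    and vb_Hom: "\<lbrakk>k \<in> Ghat C S; l \<in> Ghat C S; m \<in> Ghat C S; \<alpha> \<in> {1..mlt K k l m}\<rbrakk>
      \<Longrightarrow> vb K k l m \<alpha> \<in> Hom C (gam K m) (gam K k \<odot> gam K l)"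
    and vb_orthonormal: "\<lbrakk>k \<in> Ghat C S; l \<in> Ghat C S; m \<in> Ghat C S;
        \<alpha> \<in> {1..mlt K k l m}; \<beta> \<in> {1..mlt K k l m}\<rbrakk>
      \<Longrightarrow> adj C (vb K k l m \<alpha>) \<cdot> vb K k l m \<beta> = (if \<alpha> = \<beta> then idn C (gam K m) else 0)"
    and vb_span: "\<lbrakk>k \<in> Ghat C S; l \<in> Ghat C S; m \<in> Ghat C S\<rbrakk>
      \<Longrightarrow> Hom C (gam K m) (gam K k \<odot> gam K l) = module.span (scl C) (vb K k l m ` {1..mlt K k l m})"
    and rr_normalized: "k \<in> Ghat C S
      \<Longrightarrow> normalized_solution C (gam K k) (gam K (conj_class C k)) (rr K k) (rrb K k)"
    and rr_conj: "\<lbrakk>k \<in> Ghat C S; conj_class C k \<noteq> k\<rbrakk>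
      \<Longrightarrow> rr K (conj_class C k) = rrb K k \<and> rrb K (conj_class C k) = rr K k"
    and rr_self_conj: "\<lbrakk>k \<in> Ghat C S; conj_class C k = k\<rbrakk> \<Longrightarrow> rrb K k = rr K k \<or> rrb K k = - rr K k"

text \<open>
  \<open>\<Oplus>\<^sub>k Hom C (\<gamma>\<^sub>k \<odot> \<rho>) \<sigma> \<otimes> H\<^sub>k\<close> by generators and relations: formal finite sums of generators
  \<open>(k, T, \<psi>)\<close>, standing for \<open>T \<otimes> \<psi>\<close> in the \<open>k\<close>-th summand, modulo the congruence \<open>cp_rel\<close>
  generated by bilinearity in \<open>T\<close> and \<open>\<psi>\<close>. An arrow of the crossed product is such a class together
  with its domain and codomain. The linear structure of these spaces is not recorded in the
  \<open>star_tensor\<close> record \<open>crossed_product\<close>.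
\<close>

type_synonym ('o, 'a, 'v) cp_sum = "('o set \<times> 'a \<times> 'v) multiset"
type_synonym ('o, 'a, 'v) cp_arrow = "'o \<times> 'o \<times> ('o, 'a, 'v) cp_sum set"

context
  fixes C :: "('o, 'a::ab_group_add, 'z) lin_star_tensor_scheme" (structure)
    and \<epsilon> :: "'o \<Rightarrow> 'o \<Rightarrow> 'a"
    and S :: "'o set"
    and U :: "('g, 'u, 'v::ab_group_add) rep_cat"
    and F :: "('o, 'a, 'u, 'v) rep_functor"
    and K :: "('o, 'a) cp_choice"
begin

abbreviation "\<gamma> \<equiv> gam K"
abbreviation "Hk k \<equiv> Hsp U (fobj F (\<gamma> k))"

definition cp_gen :: "'o \<Rightarrow> 'o \<Rightarrow> ('o set \<times> 'a \<times> 'v) set" where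
  "cp_gen \<rho> \<sigma> = {(k, T, \<psi>). k \<in> Ghat C S \<and> T \<in> Hom C (\<gamma> k \<odot> \<rho>) \<sigma> \<and> \<psi> \<in> Hk k}"

inductive cp_rel :: "'o \<Rightarrow> 'o \<Rightarrow> ('o, 'a, 'v) cp_sum \<Rightarrow> ('o, 'a, 'v) cp_sum \<Rightarrow> bool"
  for \<rho> \<sigma> :: 'o where
  refl: "set_mset M \<subseteq> cp_gen \<rho> \<sigma> \<Longrightarrow> cp_rel \<rho> \<sigma> M M"
| sym: "cp_rel \<rho> \<sigma> M N \<Longrightarrow> cp_rel \<rho> \<sigma> N M"
| trans: "\<lbrakk>cp_rel \<rho> \<sigma> M N; cp_rel \<rho> \<sigma> N P\<rbrakk> \<Longrightarrow> cp_rel \<rho> \<sigma> M P"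
| plus: "\<lbrakk>cp_rel \<rho> \<sigma> M N; set_mset P \<subseteq> cp_gen \<rho> \<sigma>\<rbrakk> \<Longrightarrow> cp_rel \<rho> \<sigma> (M + P) (N + P)"
| zero: "(k, 0, \<psi>) \<in> cp_gen \<rho> \<sigma> \<Longrightarrow> cp_rel \<rho> \<sigma> {#(k, 0, \<psi>)#} {#}"
| add_left: "\<lbrakk>(k, T, \<psi>) \<in> cp_gen \<rho> \<sigma>; (k, T', \<psi>) \<in> cp_gen \<rho> \<sigma>\<rbrakk>
    \<Longrightarrow> cp_rel \<rho> \<sigma> {#(k, T + T', \<psi>)#} {#(k, T, \<psi>), (k, T', \<psi>)#}"
| add_right: "\<lbrakk>(k, T, \<psi>) \<in> cp_gen \<rho> \<sigma>; (k, T, \<psi>') \<in> cp_gen \<rho> \<sigma>\<rbrakk>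
    \<Longrightarrow> cp_rel \<rho> \<sigma> {#(k, T, \<psi> + \<psi>')#} {#(k, T, \<psi>), (k, T, \<psi>')#}"
| scale: "(k, T, \<psi>) \<in> cp_gen \<rho> \<sigma>
    \<Longrightarrow> cp_rel \<rho> \<sigma> {#(k, scl C c T, \<psi>)#} {#(k, T, rscl (urep U (fobj F (\<gamma> k))) c \<psi>)#}"

definition cp_class :: "'o \<Rightarrow> 'o \<Rightarrow> ('o, 'a, 'v) cp_sum \<Rightarrow> ('o, 'a, 'v) cp_arrow" where
  "cp_class \<rho> \<sigma> M = (\<rho>, \<sigma>, {N. cp_rel \<rho> \<sigma> M N})"

definition cp_Hom :: "'o \<Rightarrow> 'o \<Rightarrow> ('o, 'a, 'v) cp_arrow set" where
  "cp_Hom \<rho> \<sigma> = {cp_class \<rho> \<sigma> M |M. set_mset M \<subseteq> cp_gen \<rho> \<sigma>}"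

text \<open>
  The product of two generators is a sum over \<open>m\<close> and \<open>\<alpha>\<close>; all but finitely many
  \<open>m\<close> have multiplicity 0 and must be left out explicitly, since \<open>sum\<close> over an infinite index set
  is 0. \<open>fusion k l \<psi> \<phi> X\<close> is \<open>\<Oplus>\<^sub>m \<Sum>\<^sub>\<alpha> X(V) \<otimes> F(V)\<^sup>*(\<psi> \<boxtimes> \<phi>)\<close> with \<open>V\<close> the basis vector for
  \<open>m\<close>, \<open>\<alpha>\<close>; here \<open>F(V)\<^sup>*\<close> is written as \<open>F(V\<^sup>*)\<close>.
\<close>

definition fusion ::
  "'o set \<Rightarrow> 'o set \<Rightarrow> 'v \<Rightarrow> 'v \<Rightarrow> ('a \<Rightarrow> 'a) \<Rightarrow> ('o, 'a, 'v) cp_sum" where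
  "fusion k l \<psi> \<phi> X = (\<Sum>m \<in> {m \<in> Ghat C S. 0 < mlt K k l m}. \<Sum>\<alpha>\<in>{1..mlt K k l m}.
     {#(m, X (vb K k l m \<alpha>),
        farr F (\<gamma> k \<odot> \<gamma> l) (\<gamma> m) (adj C (vb K k l m \<alpha>))
          (vtns U (fobj F (\<gamma> k)) (fobj F (\<gamma> l)) \<psi> \<phi>))#})"

definition cp_cmp_gen ::
  "'o \<Rightarrow> ('o set \<times> 'a \<times> 'v) \<Rightarrow> ('o set \<times> 'a \<times> 'v) \<Rightarrow> ('o, 'a, 'v) cp_sum" where
  "cp_cmp_gen \<rho> = (\<lambda>(k, T, \<psi>) (l, T', \<phi>).
     fusion k l \<psi> \<phi> (\<lambda>V. T \<cdot> (idn C (\<gamma> k) \<parallel> T') \<cdot> (V \<parallel> idn C \<rho>)))"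

definition cp_par_gen ::
  "'o \<Rightarrow> 'o \<Rightarrow> ('o set \<times> 'a \<times> 'v) \<Rightarrow> ('o set \<times> 'a \<times> 'v) \<Rightarrow> ('o, 'a, 'v) cp_sum" where
  "cp_par_gen \<rho>1 \<rho>2 = (\<lambda>(k, T, \<psi>) (l, T', \<phi>).
     fusion k l \<psi> \<phi> (\<lambda>V. (T \<parallel> T') \<cdot> (idn C (\<gamma> k) \<parallel> \<epsilon> (\<gamma> l) \<rho>1 \<parallel> idn C \<rho>2) \<cdot> (V \<parallel> idn C (\<rho>1 \<odot> \<rho>2))))"

definition bar_vec :: "'o set \<Rightarrow> 'v \<Rightarrow> 'v" where
  "bar_vec k \<psi> = (let kb = conj_class C k in THE \<phi>. \<phi> \<in> Hk kb \<and>
     (\<forall>a\<in>Hk kb. rip (urep U (fobj F (\<gamma> kb))) a \<phi> =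
        rip (urep U (fobj F (\<gamma> k \<odot> \<gamma> kb))) (vtns U (fobj F (\<gamma> k)) (fobj F (\<gamma> kb)) \<psi> a)
          (farr F (unt C) (\<gamma> k \<odot> \<gamma> kb) (rrb K k) \<Omega>\<^bsub>U\<^esub>)))"

definition cp_adj_gen :: "'o \<Rightarrow> ('o set \<times> 'a \<times> 'v) \<Rightarrow> ('o set \<times> 'a \<times> 'v)" where
  "cp_adj_gen \<rho> = (\<lambda>(k, T, \<psi>).
     (conj_class C k,
      (adj C (rr K k) \<parallel> idn C \<rho>) \<cdot> (idn C (\<gamma> (conj_class C k)) \<parallel> adj C T),
      bar_vec k \<psi>))"

text \<open>The operations on classes are the (anti-)linear extensions from generators.\<close>

definition cp_cmp :: "('o, 'a, 'v) cp_arrow \<Rightarrow> ('o, 'a, 'v) cp_arrow \<Rightarrow> ('o, 'a, 'v) cp_arrow" where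
  "cp_cmp = (\<lambda>(_, \<tau>, X) (\<rho>, _, Y). (\<rho>, \<tau>, \<Union>M\<in>X. \<Union>N\<in>Y.
     {P. cp_rel \<rho> \<tau> (\<Sum>x\<in>#M. \<Sum>y\<in>#N. cp_cmp_gen \<rho> x y) P}))"

definition cp_par :: "('o, 'a, 'v) cp_arrow \<Rightarrow> ('o, 'a, 'v) cp_arrow \<Rightarrow> ('o, 'a, 'v) cp_arrow" where
  "cp_par = (\<lambda>(\<rho>1, \<sigma>1, X) (\<rho>2, \<sigma>2, Y). (\<rho>1 \<odot> \<rho>2, \<sigma>1 \<odot> \<sigma>2, \<Union>M\<in>X. \<Union>N\<in>Y.
     {P. cp_rel (\<rho>1 \<odot> \<rho>2) (\<sigma>1 \<odot> \<sigma>2) (\<Sum>x\<in>#M. \<Sum>y\<in>#N. cp_par_gen \<rho>1 \<rho>2 x y) P}))"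

definition cp_adj :: "('o, 'a, 'v) cp_arrow \<Rightarrow> ('o, 'a, 'v) cp_arrow" where
  "cp_adj = (\<lambda>(\<rho>, \<sigma>, X). (\<sigma>, \<rho>, \<Union>M\<in>X. {P. cp_rel \<sigma> \<rho> (image_mset (cp_adj_gen \<rho>) M) P}))"

definition cp_emb :: "'o \<Rightarrow> 'o \<Rightarrow> 'a \<Rightarrow> ('o, 'a, 'v) cp_arrow" where
  "cp_emb \<rho> \<sigma> T = cp_class \<rho> \<sigma> {#(iso_class C (unt C), T, \<Omega>\<^bsub>U\<^esub>)#}"

definition crossed_product :: "('o, ('o, 'a, 'v) cp_arrow) star_tensor" where
  "crossed_product = \<lparr>
     Obj = Obj C,
     Hom = cp_Hom,
     idn = (\<lambda>\<rho>. cp_emb \<rho> \<rho> (idn C \<rho>)),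
     cmp = cp_cmp,
     unt = unt C,
     tns = tns C,
     par = cp_par,
     adj = cp_adj\<rparr>"

definition lifted_braiding :: "'o \<Rightarrow> 'o \<Rightarrow> ('o, 'a, 'v) cp_arrow" where
  "lifted_braiding \<rho> \<sigma> = cp_emb (\<rho> \<odot> \<sigma>) (\<sigma> \<odot> \<rho>) (\<epsilon> \<rho> \<sigma>)"

end

end

theory Submission
  imports Defs "HOL-Computational_Algebra.Fundamental_Theorem_Algebra"
begin

text \<open>
  An arrow \<open>T \<otimes> \<psi>\<close> of the crossed product, with \<open>T \<in> Hom (\<gamma>\<^sub>k \<odot> \<rho>) \<sigma>\<close>, is an arrow of the original category
  with an additional strand \<open>\<gamma>\<^sub>k\<close> coming in from the left. In a tensor product of two such arrows the
  strand of the second factor has to pass the domain of the first one, which it does by the braiding.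
  Naturality of the lifted braiding asks whether this crossing can be undone, and this is the triviality
  of the monodromy between the \<open>\<gamma>\<^sub>k\<close> and all objects.

  Suppose that the lifted family is a braiding. Naturality for \<open>id\<^sub>\<eta>\<close> and \<open>id \<otimes> \<psi>\<close>, an arrow from the unit
  object to \<open>\<gamma>\<^sub>k\<close>, reads \<open>\<epsilon>(\<eta>, \<gamma>\<^sub>k) \<epsilon>(\<gamma>\<^sub>k, \<eta>) \<otimes> \<psi> = id \<otimes> \<psi>\<close>. As \<open>F\<close> is faithful, there is some \<open>\<psi> \<noteq> 0\<close>, and
  \<open>rel_separates\<close> allows to cancel it, so \<open>\<gamma>\<^sub>k\<close> is degenerate. An arbitrary object of \<open>S\<close> is a sum of
  irreducibles, and monodromy is natural (\<open>degenerate_if_irreducibles_degenerate\<close>). The decomposition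
  rests on \<open>nontrivial_projection\<close>: a non-zero finite dimensional algebra with a positive involution that
  is not \<open>\<complex>\<close> contains a non-trivial projection.

  Suppose that \<open>S\<close> consists of degenerate objects. It suffices to check naturality on generators \<open>T \<otimes> \<psi>\<close>
  and \<open>T' \<otimes> \<phi>\<close>. The two sides are fusion sums over bases of \<open>Hom (\<gamma>\<^sub>m) (\<gamma>\<^sub>k \<odot> \<gamma>\<^sub>l)\<close> and \<open>Hom (\<gamma>\<^sub>m) (\<gamma>\<^sub>l \<odot> \<gamma>\<^sub>k)\<close>.
  Such sums do not depend on the bases (\<open>basis_change\<close>), and \<open>F\<close> sends \<open>\<epsilon>(\<gamma>\<^sub>k, \<gamma>\<^sub>l)\<close> to the flip, so one sum
  can be rewritten over the other basis (\<open>fusion_flip\<close>). What remains is an identity of braids in which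
  the two crossings of \<open>\<gamma>\<^sub>l\<close> with \<open>\<rho>\<close> cancel (\<open>braid_through_degenerate\<close>). Checking on generators is
  legitimate because the operations respect the relations that define the arrows (\<open>fprod_rel\<close>).
\<close>

section \<open>Annihilating polynomials and eigenvectors\<close>

text \<open>An endomorphism \<open>f\<close> of a finite dimensional subspace \<open>W\<close> of the ambient space, with a vector \<open>v\<close> to
  which the polynomials in \<open>f\<close> are applied. For an arrow \<open>a\<close> of \<open>Hom \<rho> \<rho>\<close>, acting by composition, and
  \<open>v = id\<close> this is evaluation of polynomials at \<open>a\<close>.\<close>

locale subspace_endomorphism = vector_space scale
  for scale :: "complex \<Rightarrow> 'b::ab_group_add \<Rightarrow> 'b" (infixr "*\<^sub>c" 75) +
  fixes W :: "'b set" and f :: "'b \<Rightarrow> 'b" and v :: 'b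
  assumes finite_dim: "\<exists>B. finite B \<and> W = span B"
    and maps: "x \<in> W \<Longrightarrow> f x \<in> W"
    and add: "x \<in> W \<Longrightarrow> y \<in> W \<Longrightarrow> f (x + y) = f x + f y"
    and scl: "x \<in> W \<Longrightarrow> f (c *\<^sub>c x) = c *\<^sub>c f x"
    and vec: "v \<in> W"
begin

text \<open>The vector \<open>p(f) v\<close>, by the Horner scheme.\<close>

definition ev :: "complex poly \<Rightarrow> 'b" where
  "ev p = fold_coeffs (\<lambda>c y. c *\<^sub>c v + f y) p 0"

lemma W_subspace: "subspace W"
  using finite_dim by auto

lemmas W_closed = subspace_0[OF W_subspace] subspace_add[OF W_subspace]
  subspace_scale[OF W_subspace] subspace_diff[OF W_subspace]

lemma f_zero: "f 0 = 0"
  using scl[of 0 0] W_closed(1) by simp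

lemma ev_0: "ev 0 = 0"
  by (simp add: ev_def)

lemma ev_pCons: "ev (pCons c p) = c *\<^sub>c v + f (ev p)"
  by (cases "p = 0 \<and> c = 0") (auto simp: ev_def f_zero)

lemma ev_in: "ev p \<in> W"
  by (induction p) (auto simp: ev_0 ev_pCons W_closed maps vec)

lemma ev_add: "ev (p + q) = ev p + ev q"
proof (induction p q rule: poly_induct2)
  case (pCons a p b q)
  then show ?case
    by (simp add: ev_pCons add ev_in scale_left_distrib algebra_simps)
qed (simp add: ev_0)

lemma ev_smult: "ev (smult c p) = c *\<^sub>c ev p"
  by (induction p) (simp_all add: ev_0 ev_pCons scl ev_in scale_right_distrib)

lemma ev_diff: "ev (p - q) = ev p - ev q"
proof -
  have "p - q = p + smult (-1) q" by simp
  then show ?thesis unfolding ev_add[symmetric] by (simp only: ev_add ev_smult scale_minus_left scale_one) simp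
qed

lemma ev_linear_factor: "ev ([:- c, 1:] * q) = f (ev q) - c *\<^sub>c ev q"
proof -
  have "[:- c, 1:] * q = pCons 0 q - smult c q" by simp
  then show ?thesis by (simp only: ev_diff ev_smult ev_pCons) simp
qed

text \<open>Otherwise the vectors \<open>f\<^sup>n v\<close> would be infinitely many independent elements of \<open>W\<close>.\<close>

lemma annihilating_polynomial: "\<exists>p. p \<noteq> 0 \<and> ev p = 0"
proof (rule ccontr)
  assume "\<not> ?thesis"
  then have inj: "p = 0" if "ev p = 0" for p
    using that by blast
  define e where "e = (\<lambda>i. ev (monom 1 i))"
  have span_low: "\<exists>q. x = ev q \<and> (\<forall>i\<ge>n. coeff q i = 0)" if "x \<in> span (e ` {..<n})" for x n
    using that
  proof (induction rule: span_induct_alt)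
    case base
    show ?case by (rule exI[of _ 0]) (simp add: ev_0)
  next
    case (step c x y)
    then obtain i q where "i < n" "x = e i" "y = ev q" "\<forall>i\<ge>n. coeff q i = 0" by auto
    then show ?case
      by (intro exI[of _ "smult c (monom 1 i) + q"]) (auto simp: e_def ev_add ev_smult)
  qed
  have new: "e n \<notin> span (e ` {..<n})" for n
  proof
    assume "e n \<in> span (e ` {..<n})"
    then obtain q where q: "ev (monom 1 n) = ev q" "\<forall>i\<ge>n. coeff q i = 0"
      using span_low unfolding e_def by blast
    then have "monom 1 n - q = 0"
      by (intro inj) (simp add: ev_diff)
    with q(2) show False
      by (metis coeff_monom diff_eq_eq add_0 order_refl zero_neq_one)
  qed
  have indep: "independent (e ` {..<n}) \<and> card (e ` {..<n}) = n" for n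
  proof (induction n)
    case (Suc n)
    have "e n \<notin> e ` {..<n}" using new[of n] by (metis span_base)
    moreover have "independent (insert (e n) (e ` {..<n}))"
      using independent_insertI[OF new[of n]] Suc by blast
    ultimately show ?case
      using Suc by (simp only: lessThan_Suc image_insert) simp
  qed (simp add: independent_empty)
  obtain B where B: "finite B" "W = span B" using finite_dim by blast
  have "card (e ` {..<Suc (card B)}) \<le> card B"
    using independent_span_bound[OF B(1), of "e ` {..<Suc (card B)}"] indep ev_in B(2)
    by (auto simp: e_def)
  with indep[of "Suc (card B)"] show False by linarith
qed

text \<open>Split linear factors off an annihilating polynomial until the remaining factor \<open>q\<close> no longer
  annihilates \<open>v\<close>; then \<open>q(f) v\<close> is an eigenvector.\<close>

lemma eigenvector:
  assumes "v \<noteq> 0"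
  shows "\<exists>c. \<exists>x\<in>W. x \<noteq> 0 \<and> f x = c *\<^sub>c x"
proof -
  have "\<exists>c. \<exists>x\<in>W. x \<noteq> 0 \<and> f x = c *\<^sub>c x" if "p \<noteq> 0" "ev p = 0" for p
    using that
  proof (induction "degree p" arbitrary: p rule: less_induct)
    case less
    have "degree p \<noteq> 0"
    proof
      assume "degree p = 0"
      then obtain a where "p = [:a:]" using degree_eq_zeroE by blast
      with less.prems assms show False by (simp add: ev_pCons ev_0 f_zero)
    qed
    then obtain c where "poly p c = 0"
      using fundamental_theorem_of_algebra by (metis constant_degree)
    then obtain q where p: "p = [:- c, 1:] * q"
      by (metis dvdE poly_eq_0_iff_dvd)
    then have q: "q \<noteq> 0" using less.prems(1) by auto
    have eq: "f (ev q) = c *\<^sub>c ev q"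
      using less.prems(2) unfolding p ev_linear_factor by simp
    show ?case
    proof (cases "ev q = 0")
      case True
      have "degree q < degree p" using q unfolding p by (subst degree_mult_eq) auto
      then show ?thesis using less.hyps q True by blast
    qed (use eq ev_in in blast)
  qed
  then show ?thesis using annihilating_polynomial by blast
qed

end

section \<open>Projections in tensor *-categories\<close>

context strict_tensor_category
begin

declare unt_Obj [simp, intro] tns_Obj [simp, intro] idn_Hom [simp, intro]

text \<open>Typing rules with the arrows first: they determine the intermediate objects.\<close>

lemma cmp_in:
  "\<lbrakk>f \<in> Hom C \<sigma> \<tau>; g \<in> Hom C \<rho> \<sigma>; \<rho> \<in> Obj C; \<sigma> \<in> Obj C; \<tau> \<in> Obj C\<rbrakk> \<Longrightarrow> f \<cdot> g \<in> Hom C \<rho> \<tau>"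
  by (rule cmp_Hom)

lemma par_in:
  "\<lbrakk>f \<in> Hom C \<rho> \<sigma>; g \<in> Hom C \<rho>' \<sigma>'; \<rho> \<in> Obj C; \<sigma> \<in> Obj C; \<rho>' \<in> Obj C; \<sigma>' \<in> Obj C\<rbrakk>
    \<Longrightarrow> f \<parallel> g \<in> Hom C (\<rho> \<odot> \<rho>') (\<sigma> \<odot> \<sigma>')"
  by (rule par_Hom)

end

context tensor_star_category
begin

sublocale vs: vector_space "scl C"
  by (rule vector_space)

lemma Hom_zero [simp, intro]: "\<lbrakk>\<rho> \<in> Obj C; \<sigma> \<in> Obj C\<rbrakk> \<Longrightarrow> 0 \<in> Hom C \<rho> \<sigma>"
  using Hom_subspace vs.subspace_0 by blast

lemma Hom_add: "\<lbrakk>f \<in> Hom C \<rho> \<sigma>; g \<in> Hom C \<rho> \<sigma>; \<rho> \<in> Obj C; \<sigma> \<in> Obj C\<rbrakk> \<Longrightarrow> f + g \<in> Hom C \<rho> \<sigma>"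
  using Hom_subspace vs.subspace_add by blast

lemma Hom_scl: "\<lbrakk>f \<in> Hom C \<rho> \<sigma>; \<rho> \<in> Obj C; \<sigma> \<in> Obj C\<rbrakk> \<Longrightarrow> scl C c f \<in> Hom C \<rho> \<sigma>"
  using Hom_subspace vs.subspace_scale by blast

lemma Hom_diff: "\<lbrakk>f \<in> Hom C \<rho> \<sigma>; g \<in> Hom C \<rho> \<sigma>; \<rho> \<in> Obj C; \<sigma> \<in> Obj C\<rbrakk> \<Longrightarrow> f - g \<in> Hom C \<rho> \<sigma>"
  using Hom_subspace vs.subspace_diff by blast

lemma cmp_zero:
  "\<lbrakk>\<rho> \<in> Obj C; \<sigma> \<in> Obj C; \<tau> \<in> Obj C; g \<in> Hom C \<rho> \<sigma>\<rbrakk> \<Longrightarrow> 0 \<cdot> g = 0"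
  "\<lbrakk>\<rho> \<in> Obj C; \<sigma> \<in> Obj C; \<tau> \<in> Obj C; f \<in> Hom C \<sigma> \<tau>\<rbrakk> \<Longrightarrow> f \<cdot> 0 = 0"
  using cmp_scl(1)[of \<rho> \<sigma> \<rho> 0 g 0] cmp_scl(2)[of \<sigma> \<sigma> \<tau> f 0 0] by simp_all

lemma cmp_diff:
  "\<lbrakk>\<rho> \<in> Obj C; \<sigma> \<in> Obj C; \<tau> \<in> Obj C; f \<in> Hom C \<sigma> \<tau>; f' \<in> Hom C \<sigma> \<tau>; g \<in> Hom C \<rho> \<sigma>\<rbrakk>
    \<Longrightarrow> (f - f') \<cdot> g = f \<cdot> g - f' \<cdot> g"
  "\<lbrakk>\<rho> \<in> Obj C; \<sigma> \<in> Obj C; \<tau> \<in> Obj C; f \<in> Hom C \<sigma> \<tau>; g \<in> Hom C \<rho> \<sigma>; g' \<in> Hom C \<rho> \<sigma>\<rbrakk>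
    \<Longrightarrow> f \<cdot> (g - g') = f \<cdot> g - f \<cdot> g'"
  using cmp_add(1)[of \<rho> \<sigma> \<tau> "f - f'" f' g] cmp_add(2)[of \<rho> \<sigma> \<tau> f "g - g'" g']
  by (simp_all add: Hom_diff algebra_simps)

lemma adj_diff:
  "\<lbrakk>\<rho> \<in> Obj C; \<sigma> \<in> Obj C; f \<in> Hom C \<rho> \<sigma>; g \<in> Hom C \<rho> \<sigma>\<rbrakk> \<Longrightarrow> adj C (f - g) = adj C f - adj C g"
  using adj_add[of \<rho> \<sigma> "f - g" g] by (simp add: Hom_diff algebra_simps)

lemma adj_idn: "\<rho> \<in> Obj C \<Longrightarrow> adj C (idn C \<rho>) = idn C \<rho>"
  using adj_cmp[of \<rho> \<rho> \<rho> "idn C \<rho>" "adj C (idn C \<rho>)"] adj_adj[of \<rho> \<rho> "idn C \<rho>"] adj_Hom[of \<rho> \<rho> "idn C \<rho>"]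
    idn_left[of \<rho> \<rho> "adj C (idn C \<rho>)"] idn_right[of \<rho> \<rho> "adj C (idn C \<rho>)"]
  by simp

text \<open>A self-adjoint element that is not a scalar has an eigenvalue \<open>c\<close>, real by positivity, and
  subtracting it gives a self-adjoint \<open>b \<noteq> 0\<close> that is not invertible. Positivity allows to cancel
  \<open>b\<close> in \<open>b b y = 0\<close>, so that an annihilating polynomial of \<open>b\<close> turns into an equation
  \<open>b = b b y\<close>; the support projection of \<open>b\<close> is then \<open>b y\<close>.\<close>

lemma nontrivial_projection:
  assumes \<rho>: "\<rho> \<in> Obj C"
    and fin: "\<exists>B. finite B \<and> Hom C \<rho> \<rho> = vs.span B"
    and nz: "idn C \<rho> \<noteq> 0" and red: "\<not> irreducible_obj C \<rho>"
  shows "\<exists>E\<in>Hom C \<rho> \<rho>. adj C E = E \<and> E \<cdot> E = E \<and> E \<noteq> 0 \<and> E \<noteq> idn C \<rho>"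
proof -
  let ?A = "Hom C \<rho> \<rho>" and ?I = "idn C \<rho>"
  note [simp] = \<rho>
  note in_A [simp] = cmp_Hom[OF \<rho> \<rho> \<rho>] adj_Hom[OF \<rho> \<rho>] Hom_add[OF _ _ \<rho> \<rho>] Hom_diff[OF _ _ \<rho> \<rho>]
    Hom_scl[OF _ \<rho> \<rho>]
  note alg = cmp_add[OF \<rho> \<rho> \<rho>] cmp_scl[OF \<rho> \<rho> \<rho>] cmp_diff[OF \<rho> \<rho> \<rho>] idn_left[OF \<rho> \<rho>] idn_right[OF \<rho> \<rho>]
    cmp_zero[OF \<rho> \<rho> \<rho>] adj_adj[OF \<rho> \<rho>] adj_scl[OF \<rho> \<rho>] adj_cmp[OF \<rho> \<rho> \<rho>] adj_add[OF \<rho> \<rho>]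
    adj_diff[OF \<rho> \<rho>] adj_idn[OF \<rho>]
  note assoc = cmp_assoc[OF \<rho> \<rho> \<rho> \<rho>]
  have endo: "subspace_endomorphism (scl C) ?A (\<lambda>x. a \<cdot> x) ?I" if "a \<in> ?A" for a
    using fin that by unfold_locales (auto simp: alg)
  obtain a where a: "a \<in> ?A" "adj C a = a" "a \<notin> range (\<lambda>c. scl C c ?I)"
  proof -
    obtain z where z: "z \<in> ?A" "z \<notin> range (\<lambda>c. scl C c ?I)"
      using nz red unfolding irreducible_obj_def by (auto simp: Hom_scl)
    let ?r = "z + adj C z" and ?i = "scl C \<i> (z - adj C z)"
    have "?r - scl C \<i> ?i = z + z"
      by simp
    moreover have "scl C (1/2) (z + z) = z"
      using vs.scale_left_distrib[of "1/2" "1/2" z] by (simp add: vs.scale_right_distrib)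
    ultimately have z_eq: "z = scl C (1/2) (?r - scl C \<i> ?i)"
      by simp
    \<comment> \<open>one of the real and imaginary parts of a non-scalar arrow is not a scalar\<close>
    have "?r \<notin> range (\<lambda>c. scl C c ?I) \<or> ?i \<notin> range (\<lambda>c. scl C c ?I)"
    proof (rule ccontr)
      assume "\<not> ?thesis"
      then obtain c d where "?r = scl C c ?I" "?i = scl C d ?I" by blast
      then have "z = scl C (1/2 * (c - \<i> * d)) ?I"
        using z_eq by (metis vs.scale_left_diff_distrib vs.scale_scale)
      with z(2) show False by blast
    qed
    moreover have "adj C ?r = ?r" "adj C ?i = ?i"
      using z(1) by (simp_all add: alg add.commute vs.scale_right_diff_distrib)
    ultimately show ?thesis
      using that[of ?r] that[of ?i] z(1) by auto
  qed
  obtain c x where x: "x \<in> ?A" "x \<noteq> 0" "a \<cdot> x = scl C c x"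
    using subspace_endomorphism.eigenvector[OF endo[OF a(1)] nz] by blast
  have "scl C c (adj C x \<cdot> x) = adj C x \<cdot> (a \<cdot> x)"
    using x by (simp add: alg)
  also have "\<dots> = adj C (adj C x \<cdot> (a \<cdot> x))"
    using x(1) a by (simp add: alg assoc del: x(3))
  also have "\<dots> = scl C (cnj c) (adj C x \<cdot> x)"
    using x by (simp add: alg)
  finally have c: "cnj c = c"
    using adj_pos[OF \<rho> \<rho> x(1)] x(2) by auto
  \<comment> \<open>the eigenvalue is real, so that \<open>b\<close> is again self-adjoint\<close>
  define b where "b = a - scl C c ?I"
  have b: "b \<in> ?A" "adj C b = b" "b \<cdot> x = 0"
    using a x c by (simp_all add: b_def alg)
  have bnz: "b \<noteq> 0"
    using a(3) by (auto simp: b_def)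
  have cancel: "b \<cdot> y = 0" if "y \<in> ?A" "b \<cdot> (b \<cdot> y) = 0" for y
    using adj_pos[OF \<rho> \<rho>, of "b \<cdot> y"] that b by (simp add: alg assoc)
  interpret B: subspace_endomorphism "scl C" ?A "\<lambda>x. b \<cdot> x" ?I
    by (rule endo[OF b(1)])
  \<comment> \<open>A polynomial with non-zero constant term can be solved for \<open>b\<close>; otherwise a factor \<open>b\<close> is cancelled.\<close>
  have quasi_inverse: "\<exists>y\<in>?A. b = b \<cdot> (b \<cdot> y)" if "p \<noteq> 0" "b \<cdot> B.ev p = 0" for p
    using that
  proof (induction p)
    case (pCons d p)
    have e: "B.ev p \<in> ?A" by (rule B.ev_in)
    have eq: "scl C d b + b \<cdot> (b \<cdot> B.ev p) = 0"
      using pCons.prems b e by (simp add: B.ev_pCons alg)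
    show ?case
    proof (cases "d = 0")
      case True
      with eq cancel[OF e] pCons show ?thesis by simp
    next
      case False
      have "b = scl C (- inverse d) (b \<cdot> (b \<cdot> B.ev p))"
      proof -
        have "scl C (inverse d) (scl C d b) = scl C (inverse d) (- (b \<cdot> (b \<cdot> B.ev p)))"
          using eq by (simp only: add_eq_0_iff2)
        with False show ?thesis by simp
      qed
      also have "\<dots> = b \<cdot> (b \<cdot> scl C (- inverse d) (B.ev p))"
        using b e by (simp add: alg del: vs.scale_minus_left)
      finally show ?thesis using e by (metis in_A(5))
    qed
  qed simp
  obtain p where "p \<noteq> 0" "B.ev p = 0"
    using B.annihilating_polynomial by blast
  then obtain y where y: "y \<in> ?A" "b = b \<cdot> (b \<cdot> y)"
    using quasi_inverse b by (metis cmp_zero(2) \<rho>)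
  define w where "w = b \<cdot> y"
  have w: "w \<in> ?A" "b \<cdot> w = b" using b y by (simp_all add: w_def)
  have "adj C w \<cdot> b = b"
    using adj_cmp[OF \<rho> \<rho> \<rho> b(1) w(1)] w(2) b(2) by metis
  then have ww: "adj C w \<cdot> w = w"
    using assoc[of "adj C w" b y] w b y by (simp add: w_def)
  have sa: "adj C w = w"
    using adj_cmp[OF \<rho> \<rho> \<rho>, of "adj C w" w] adj_adj[OF \<rho> \<rho> w(1)] w(1) ww in_A(2) by metis
  have "w \<noteq> ?I"
  proof
    assume "w = ?I"
    then have "adj C y \<cdot> b = ?I"
      using adj_cmp[OF \<rho> \<rho> \<rho> b(1) y(1)] b(2) adj_idn[OF \<rho>] by (metis w_def)
    then have "x = (adj C y \<cdot> b) \<cdot> x" using x by (simp add: alg)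
    also have "\<dots> = 0" using assoc[of "adj C y" b x] b x y by (simp add: alg)
    finally show False using x by simp
  qed
  moreover have "w \<noteq> 0" using w b bnz by (auto simp: alg)
  ultimately show ?thesis using w sa ww by auto
qed


lemma Hom_sum: "\<lbrakk>\<And>i. i \<in> I \<Longrightarrow> f i \<in> Hom C \<rho> \<sigma>; \<rho> \<in> Obj C; \<sigma> \<in> Obj C\<rbrakk> \<Longrightarrow> (\<Sum>i\<in>I. f i) \<in> Hom C \<rho> \<sigma>"
  using Hom_subspace vs.subspace_sum[of "Hom C \<rho> \<sigma>" I f] by blast

lemma cmp_sum_right:
  assumes "\<rho> \<in> Obj C" "\<sigma> \<in> Obj C" "\<tau> \<in> Obj C" "f \<in> Hom C \<sigma> \<tau>" "\<And>i. i \<in> I \<Longrightarrow> g i \<in> Hom C \<rho> \<sigma>"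
  shows "f \<cdot> (\<Sum>i\<in>I. g i) = (\<Sum>i\<in>I. f \<cdot> g i)"
  using assms(5)
proof (induction I rule: infinite_finite_induct)
  case (insert i I)
  with assms(1-4) show ?case
    using cmp_add(2)[of \<rho> \<sigma> \<tau> f "g i" "sum g I"] Hom_sum[of I g \<rho> \<sigma>] by simp
qed (use cmp_zero(2)[OF assms(1-4)] in simp_all)

text \<open>The size of such families of arrows of \<open>Hom \<rho> \<rho>\<close> serves as the induction measure in the reduction
  to irreducible objects.\<close>

definition orthogonal_idempotents :: "'o \<Rightarrow> 'a set \<Rightarrow> bool" where
  "orthogonal_idempotents \<rho> A \<longleftrightarrow> finite A \<and> A \<subseteq> Hom C \<rho> \<rho> \<and> 0 \<notin> A \<and>
     (\<forall>e\<in>A. \<forall>e'\<in>A. e \<cdot> e' = (if e = e' then e else 0))"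

lemma orthogonal_idempotents_independent:
  assumes \<rho>: "\<rho> \<in> Obj C" and A: "orthogonal_idempotents \<rho> A"
  shows "vs.independent A"
proof -
  have A': "finite A" "\<And>e. e \<in> A \<Longrightarrow> e \<in> Hom C \<rho> \<rho>" "0 \<notin> A"
    "\<And>e e'. e \<in> A \<Longrightarrow> e' \<in> A \<Longrightarrow> e \<cdot> e' = (if e = e' then e else 0)"
    using A unfolding orthogonal_idempotents_def by blast+
  have "u w = 0" if s: "(\<Sum>v\<in>A. scl C (u v) v) = 0" and w: "w \<in> A" for u w
  proof -
    have "0 = w \<cdot> (\<Sum>v\<in>A. scl C (u v) v)"
      using s cmp_zero(2)[OF \<rho> \<rho> \<rho>] A'(2) w by simp
    also have "\<dots> = (\<Sum>v\<in>A. w \<cdot> scl C (u v) v)"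
      using w \<rho> A'(2) by (intro cmp_sum_right) (auto intro: Hom_scl)
    also have "\<dots> = (\<Sum>v\<in>A. if v = w then scl C (u w) w else 0)"
      using w \<rho> A'(2,4) by (intro sum.cong) (auto simp: cmp_scl(2)[OF \<rho> \<rho> \<rho>])
    also have "\<dots> = scl C (u w) w"
      using w A'(1) by simp
    finally show ?thesis using w A'(3) by auto
  qed
  then show ?thesis
    using vs.dependent_finite[OF A'(1)] by blast
qed

text \<open>The idempotents of the subobject \<open>\<sigma>\<close> are transported to \<open>\<rho>\<close> and joined by the projection onto the
  complement of \<open>\<sigma>\<close>. Hence the maximal size of such a family drops on passing to a proper subobject.\<close>

lemma orthogonal_idempotents_extend:
  assumes obj: "\<rho> \<in> Obj C" "\<sigma> \<in> Obj C" and V: "isometry_in C \<sigma> \<rho> V" "V \<cdot> adj C V \<noteq> idn C \<rho>"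
    and A: "orthogonal_idempotents \<sigma> A"
  shows "\<exists>A'. orthogonal_idempotents \<rho> A' \<and> card A' = Suc (card A)"
proof -
  have A': "finite A" "\<And>e. e \<in> A \<Longrightarrow> e \<in> Hom C \<sigma> \<sigma>" "0 \<notin> A"
    "\<And>e e'. e \<in> A \<Longrightarrow> e' \<in> A \<Longrightarrow> e \<cdot> e' = (if e = e' then e else 0)"
    using A unfolding orthogonal_idempotents_def by blast+
  have V': "V \<in> Hom C \<sigma> \<rho>" "adj C V \<in> Hom C \<rho> \<sigma>" "adj C V \<cdot> V = idn C \<sigma>"
    using V obj adj_Hom unfolding isometry_in_def by auto
  note [simp] = obj V'
  define \<phi> where "\<phi> e = V \<cdot> (e \<cdot> adj C V)" for e
  have in1 [simp]: "e \<cdot> adj C V \<in> Hom C \<rho> \<sigma>" "\<phi> e \<in> Hom C \<rho> \<rho>" "V \<cdot> e \<in> Hom C \<sigma> \<rho>" if "e \<in> Hom C \<sigma> \<sigma>" for e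
    unfolding \<phi>_def using that by (auto intro!: cmp_in[where \<sigma>=\<sigma>])
  have VphI: "adj C V \<cdot> \<phi> e = e \<cdot> adj C V" if "e \<in> Hom C \<sigma> \<sigma>" for e
    using that cmp_assoc[of \<rho> \<sigma> \<rho> \<sigma> "adj C V" V "e \<cdot> adj C V"]
    by (simp add: \<phi>_def idn_left[of \<rho> \<sigma>])
  have \<phi>_mult: "\<phi> e \<cdot> \<phi> e' = \<phi> (e \<cdot> e')" if e: "e \<in> Hom C \<sigma> \<sigma>" "e' \<in> Hom C \<sigma> \<sigma>" for e e'
  proof -
    have "\<phi> e \<cdot> \<phi> e' = V \<cdot> ((e \<cdot> adj C V) \<cdot> \<phi> e')"
      unfolding \<phi>_def[of e] using e by (intro cmp_assoc[of \<rho> \<rho> \<sigma> \<rho>]) simp_all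
    also have "(e \<cdot> adj C V) \<cdot> \<phi> e' = e \<cdot> (adj C V \<cdot> \<phi> e')"
      using e by (intro cmp_assoc[of \<rho> \<rho> \<sigma> \<sigma>]) simp_all
    also have "\<dots> = (e \<cdot> e') \<cdot> adj C V"
      unfolding VphI[OF e(2)] using e by (intro cmp_assoc[of \<rho> \<sigma> \<sigma> \<sigma>, symmetric]) simp_all
    finally show ?thesis by (simp add: \<phi>_def)
  qed
  have \<phi>_inv: "adj C V \<cdot> (\<phi> e \<cdot> V) = e" if e: "e \<in> Hom C \<sigma> \<sigma>" for e
  proof -
    have "adj C V \<cdot> (\<phi> e \<cdot> V) = (adj C V \<cdot> \<phi> e) \<cdot> V"
      using e by (intro cmp_assoc[of \<sigma> \<rho> \<rho> \<sigma>, symmetric]) simp_all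
    also have "\<dots> = e \<cdot> (adj C V \<cdot> V)"
      unfolding VphI[OF e] using e by (intro cmp_assoc[of \<sigma> \<rho> \<sigma> \<sigma>]) simp_all
    finally show ?thesis using e idn_right[of \<sigma> \<sigma>] by simp
  qed
  have \<phi>_0: "\<phi> 0 = 0"
    using cmp_zero(1)[of \<rho> \<sigma> \<sigma> "adj C V"] cmp_zero(2)[of \<rho> \<sigma> \<rho> V] by (simp add: \<phi>_def)
  have inj: "e = e'" if "\<phi> e = \<phi> e'" "e \<in> Hom C \<sigma> \<sigma>" "e' \<in> Hom C \<sigma> \<sigma>" for e e'
    using that \<phi>_inv by metis
  define P where "P = idn C \<rho> - V \<cdot> adj C V"
  have E [simp]: "V \<cdot> adj C V \<in> Hom C \<rho> \<rho>"
    by (rule cmp_in[where \<sigma>=\<sigma>]) simp_all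
  have P [simp]: "P \<in> Hom C \<rho> \<rho>" by (simp add: P_def Hom_diff)
  have Pnz: "P \<noteq> 0" using V(2) by (simp add: P_def)
  have E_eq: "V \<cdot> adj C V = \<phi> (idn C \<sigma>)" by (simp add: \<phi>_def idn_left[of \<rho> \<sigma>])
  have E\<phi>: "(V \<cdot> adj C V) \<cdot> \<phi> e = \<phi> e" "\<phi> e \<cdot> (V \<cdot> adj C V) = \<phi> e" if e: "e \<in> Hom C \<sigma> \<sigma>" for e
    unfolding E_eq using \<phi>_mult[OF e, of "idn C \<sigma>"] \<phi>_mult[OF _ e, of "idn C \<sigma>"] e
      idn_right[of \<sigma> \<sigma> e] idn_left[of \<sigma> \<sigma> e] by simp_all
  have P\<phi>: "P \<cdot> \<phi> e = 0" "\<phi> e \<cdot> P = 0" if "e \<in> Hom C \<sigma> \<sigma>" for e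
    using that E\<phi> by (simp_all add: P_def cmp_diff[of \<rho> \<rho> \<rho>] idn_left[of \<rho> \<rho>] idn_right[of \<rho> \<rho>])
  have PP: "P \<cdot> P = P"
  proof -
    have "P \<cdot> (V \<cdot> adj C V) = 0" unfolding E_eq using P\<phi> by simp
    then have "P \<cdot> (idn C \<rho> - V \<cdot> adj C V) = P"
      by (simp only: cmp_diff(2)[OF obj(1,1,1) P idn_Hom[OF obj(1)] E] idn_right[OF obj(1,1) P] diff_0_right)
    then show ?thesis by (simp only: P_def[symmetric])
  qed
  have new: "P \<notin> \<phi> ` A"
    using P\<phi>(1) PP Pnz A'(2) by auto
  have nz: "\<phi> e \<noteq> 0" if "e \<in> A" for e
    using inj[of e 0] \<phi>_0 that A'(2,3) by auto
  have "(\<phi> e = \<phi> e') = (e = e')" if "e \<in> A" "e' \<in> A" for e e'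
    using inj that A'(2) by blast
  then have "orthogonal_idempotents \<rho> (insert P (\<phi> ` A))"
    unfolding orthogonal_idempotents_def
    using A' Pnz nz new by (auto simp: PP P\<phi> \<phi>_mult \<phi>_0)
  moreover have "card (insert P (\<phi> ` A)) = Suc (card A)"
    using new A'(1,2) inj by (simp add: card_image inj_on_def)
  ultimately show ?thesis by blast
qed

end

section \<open>Monodromy and degenerate objects\<close>

context BTC_star
begin

lemma eps_Hom: "\<lbrakk>\<rho> \<in> Obj C; \<sigma> \<in> Obj C\<rbrakk> \<Longrightarrow> \<epsilon> \<rho> \<sigma> \<in> Hom C (\<rho> \<odot> \<sigma>) (\<sigma> \<odot> \<rho>)"
  using braided unfolding braiding_def by blast

lemma eps_natural:
  "\<lbrakk>S \<in> Hom C \<rho> \<rho>'; T \<in> Hom C \<sigma> \<sigma>'; \<rho> \<in> Obj C; \<sigma> \<in> Obj C; \<rho>' \<in> Obj C; \<sigma>' \<in> Obj C\<rbrakk>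
    \<Longrightarrow> \<epsilon> \<rho>' \<sigma>' \<cdot> (S \<parallel> T) = (T \<parallel> S) \<cdot> \<epsilon> \<rho> \<sigma>"
  using braided unfolding braiding_def by blast

lemma eps_tns:
  assumes "\<rho> \<in> Obj C" "\<sigma> \<in> Obj C" "\<tau> \<in> Obj C"
  shows "\<epsilon> \<rho> (\<sigma> \<odot> \<tau>) = (idn C \<sigma> \<parallel> \<epsilon> \<rho> \<tau>) \<cdot> (\<epsilon> \<rho> \<sigma> \<parallel> idn C \<tau>)"
    and "\<epsilon> (\<rho> \<odot> \<sigma>) \<tau> = (\<epsilon> \<rho> \<tau> \<parallel> idn C \<sigma>) \<cdot> (idn C \<rho> \<parallel> \<epsilon> \<sigma> \<tau>)"
  using braided assms unfolding braiding_def by blast+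

lemma eps_unitary:
  assumes "\<rho> \<in> Obj C" "\<sigma> \<in> Obj C"
  shows "adj C (\<epsilon> \<rho> \<sigma>) \<cdot> \<epsilon> \<rho> \<sigma> = idn C (\<rho> \<odot> \<sigma>)"
    and "\<epsilon> \<rho> \<sigma> \<cdot> adj C (\<epsilon> \<rho> \<sigma>) = idn C (\<sigma> \<odot> \<rho>)"
  using unitary assms unfolding unitary_family_def by blast+

text \<open>The hexagon equation for \<open>\<iota> \<odot> \<iota>\<close> says that \<open>\<epsilon>(\<iota>, \<rho>)\<close> is idempotent, and a unitary idempotent is the
  identity.\<close>

lemma eps_unt:
  assumes \<rho>: "\<rho> \<in> Obj C"
  shows "\<epsilon> (unt C) \<rho> = idn C \<rho>" "\<epsilon> \<rho> (unt C) = idn C \<rho>"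
proof -
  have idem: "f = idn C \<rho>" if f: "f \<in> Hom C \<rho> \<rho>" "f \<cdot> f = f" "adj C f \<cdot> f = idn C \<rho>" for f
  proof -
    have "f = (adj C f \<cdot> f) \<cdot> f" using f \<rho> idn_left by simp
    also have "\<dots> = adj C f \<cdot> (f \<cdot> f)" using f \<rho> adj_Hom by (intro cmp_assoc) auto
    finally show ?thesis using f by simp
  qed
  have e: "\<epsilon> (unt C) \<rho> \<in> Hom C \<rho> \<rho>" "\<epsilon> \<rho> (unt C) \<in> Hom C \<rho> \<rho>"
    using eps_Hom[of "unt C" \<rho>] eps_Hom[of \<rho> "unt C"] \<rho> by (simp_all add: tns_unt)
  have 1: "\<epsilon> (unt C) \<rho> = \<epsilon> (unt C) \<rho> \<cdot> \<epsilon> (unt C) \<rho>"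
    using eps_tns(2)[OF unt_Obj unt_Obj \<rho>] unfolding tns_unt[OF unt_Obj] par_unt[OF \<rho> \<rho> e(1)] .
  show "\<epsilon> (unt C) \<rho> = idn C \<rho>"
    using idem[OF e(1) 1[symmetric]] eps_unitary(1)[OF unt_Obj \<rho>] unfolding tns_unt[OF \<rho>] by blast
  have 2: "\<epsilon> \<rho> (unt C) = \<epsilon> \<rho> (unt C) \<cdot> \<epsilon> \<rho> (unt C)"
    using eps_tns(1)[OF \<rho> unt_Obj unt_Obj] unfolding tns_unt[OF unt_Obj] par_unt[OF \<rho> \<rho> e(2)] .
  show "\<epsilon> \<rho> (unt C) = idn C \<rho>"
    using idem[OF e(2) 2[symmetric]] eps_unitary(1)[OF \<rho> unt_Obj] unfolding tns_unt[OF \<rho>] by blast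
qed

abbreviation monodromy :: "'o \<Rightarrow> 'o \<Rightarrow> 'a" where
  "monodromy \<rho> \<eta> \<equiv> \<epsilon> \<eta> \<rho> \<cdot> \<epsilon> \<rho> \<eta>"

lemma monodromy_Hom: "\<lbrakk>\<rho> \<in> Obj C; \<eta> \<in> Obj C\<rbrakk> \<Longrightarrow> monodromy \<rho> \<eta> \<in> Hom C (\<rho> \<odot> \<eta>) (\<rho> \<odot> \<eta>)"
  by (rule cmp_in[of _ "\<eta> \<odot> \<rho>"]) (simp_all add: eps_Hom)

lemma monodromy_natural:
  assumes f: "f \<in> Hom C \<rho> \<rho>'" and obj: "\<rho> \<in> Obj C" "\<rho>' \<in> Obj C" "\<eta> \<in> Obj C"
  shows "monodromy \<rho>' \<eta> \<cdot> (f \<parallel> idn C \<eta>) = (f \<parallel> idn C \<eta>) \<cdot> monodromy \<rho> \<eta>"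
proof -
  note [simp] = obj f eps_Hom
  note [simp] = par_in[OF f idn_Hom[OF obj(3)]] par_in[OF idn_Hom[OF obj(3)] f]
  have "monodromy \<rho>' \<eta> \<cdot> (f \<parallel> idn C \<eta>) = \<epsilon> \<eta> \<rho>' \<cdot> (\<epsilon> \<rho>' \<eta> \<cdot> (f \<parallel> idn C \<eta>))"
    by (rule cmp_assoc[of "\<rho> \<odot> \<eta>" "\<rho>' \<odot> \<eta>" "\<eta> \<odot> \<rho>'" "\<rho>' \<odot> \<eta>"]) simp_all
  also have "\<dots> = \<epsilon> \<eta> \<rho>' \<cdot> ((idn C \<eta> \<parallel> f) \<cdot> \<epsilon> \<rho> \<eta>)"
    by (subst eps_natural[of f \<rho> \<rho>' _ \<eta> \<eta>]) simp_all
  also have "\<dots> = (\<epsilon> \<eta> \<rho>' \<cdot> (idn C \<eta> \<parallel> f)) \<cdot> \<epsilon> \<rho> \<eta>"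
    by (rule cmp_assoc[of "\<rho> \<odot> \<eta>" "\<eta> \<odot> \<rho>" "\<eta> \<odot> \<rho>'" "\<rho>' \<odot> \<eta>", symmetric]) simp_all
  also have "\<dots> = ((f \<parallel> idn C \<eta>) \<cdot> \<epsilon> \<eta> \<rho>) \<cdot> \<epsilon> \<rho> \<eta>"
    by (subst eps_natural[of _ \<eta> \<eta> f \<rho> \<rho>']) simp_all
  also have "\<dots> = (f \<parallel> idn C \<eta>) \<cdot> monodromy \<rho> \<eta>"
    by (rule cmp_assoc[of "\<rho> \<odot> \<eta>" "\<eta> \<odot> \<rho>" "\<rho> \<odot> \<eta>" "\<rho>' \<odot> \<eta>"]) simp_all
  finally show ?thesis .
qed

text \<open>Naturality moves the monodromy past \<open>f\<close> to \<open>\<delta>\<close>, where it is trivial. The composites \<open>f \<cdot> g\<close> of interest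
  are the projections onto subobjects and the identity.\<close>

lemma monodromy_factor:
  assumes f: "f \<in> Hom C \<delta> \<rho>" and g: "g \<in> Hom C \<rho> \<delta>"
    and obj: "\<rho> \<in> Obj C" "\<delta> \<in> Obj C" "\<eta> \<in> Obj C"
    and deg: "monodromy \<delta> \<eta> = idn C (\<delta> \<odot> \<eta>)"
  shows "monodromy \<rho> \<eta> \<cdot> ((f \<cdot> g) \<parallel> idn C \<eta>) = (f \<cdot> g) \<parallel> idn C \<eta>"
proof -
  note [simp] = obj f g
  note [simp] = par_in[OF f idn_Hom[OF obj(3)]] par_in[OF g idn_Hom[OF obj(3)]] monodromy_Hom
  have split: "(f \<cdot> g) \<parallel> idn C \<eta> = (f \<parallel> idn C \<eta>) \<cdot> (g \<parallel> idn C \<eta>)"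
    using interchange[OF obj(1,2,1,3,3,3) f g, of "idn C \<eta>" "idn C \<eta>"]
    by (simp add: idn_left[of \<eta> \<eta>])
  have "monodromy \<rho> \<eta> \<cdot> ((f \<cdot> g) \<parallel> idn C \<eta>) = (monodromy \<rho> \<eta> \<cdot> (f \<parallel> idn C \<eta>)) \<cdot> (g \<parallel> idn C \<eta>)"
    unfolding split by (rule cmp_assoc[of "\<rho> \<odot> \<eta>" "\<delta> \<odot> \<eta>" "\<rho> \<odot> \<eta>" "\<rho> \<odot> \<eta>", symmetric]) simp_all
  also have "monodromy \<rho> \<eta> \<cdot> (f \<parallel> idn C \<eta>) = f \<parallel> idn C \<eta>"
    using monodromy_natural[OF f obj(2,1,3)] deg idn_right[of "\<delta> \<odot> \<eta>" "\<rho> \<odot> \<eta>"] by simp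
  finally show ?thesis unfolding split .
qed

end

text \<open>An object of \<open>S\<close> that is not irreducible is cut by a projection into two proper subobjects, which
  are degenerate by induction; as monodromy is natural, it is trivial on both parts of the sum.\<close>

lemma (in BTC_star) degenerate_if_irreducibles_degenerate:
  assumes S: "even_symmetric_subcategory C \<epsilon> S"
    and irr: "\<And>\<rho>. \<lbrakk>\<rho> \<in> S; irreducible_obj C \<rho>\<rbrakk> \<Longrightarrow> \<rho> \<in> degenerate_objects C \<epsilon>"
  shows "S \<subseteq> degenerate_objects C \<epsilon>"
proof -
  interpret S: even_symmetric_subcategory C \<epsilon> S by (rule S)
  have bounded: "\<rho> \<in> degenerate_objects C \<epsilon>"
    if "\<rho> \<in> S" "\<And>A. orthogonal_idempotents \<rho> A \<Longrightarrow> card A \<le> n" for n \<rho>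
    using that
  proof (induction n arbitrary: \<rho> rule: less_induct)
    case (less n)
    then have \<rho> [simp]: "\<rho> \<in> Obj C" using S.sub by blast
    consider "idn C \<rho> = 0" | "irreducible_obj C \<rho>" | "idn C \<rho> \<noteq> 0" "\<not> irreducible_obj C \<rho>" by blast
    then show ?case
    proof cases
      case 1
      have "monodromy \<rho> \<eta> = idn C (\<rho> \<odot> \<eta>)" if \<eta>: "\<eta> \<in> Obj C" for \<eta>
      proof -
        have "idn C (\<rho> \<odot> \<eta>) = 0"
          using par_idn[OF \<rho> \<eta>] par_scl(1)[OF \<rho> \<rho> \<eta> \<eta>, of "idn C \<rho>" "idn C \<eta>" 0] 1 \<eta> by simp
        moreover have "monodromy \<rho> \<eta> = monodromy \<rho> \<eta> \<cdot> idn C (\<rho> \<odot> \<eta>)"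
          using \<eta> idn_right[of "\<rho> \<odot> \<eta>" "\<rho> \<odot> \<eta>"] monodromy_Hom by simp
        ultimately show ?thesis
          using \<eta> cmp_zero(2)[of "\<rho> \<odot> \<eta>" "\<rho> \<odot> \<eta>" "\<rho> \<odot> \<eta>"] monodromy_Hom[of \<rho> \<eta>] by simp
      qed
      then show ?thesis by (simp add: degenerate_objects_def)
    next
      case 2
      then show ?thesis using irr less.prems by blast
    next
      case 3
      then obtain E where E: "E \<in> Hom C \<rho> \<rho>" "adj C E = E" "E \<cdot> E = E" "E \<noteq> 0" "E \<noteq> idn C \<rho>"
        using nontrivial_projection[OF \<rho> finite_dim] by auto
      have part: "monodromy \<rho> \<eta> \<cdot> (P \<parallel> idn C \<eta>) = P \<parallel> idn C \<eta>"
        if P: "P \<in> Hom C \<rho> \<rho>" "adj C P = P" "P \<cdot> P = P" "P \<noteq> idn C \<rho>" and \<eta>: "\<eta> \<in> Obj C" for P \<eta>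
      proof -
        obtain \<sigma> V where V: "\<sigma> \<in> Obj C" "isometry_in C \<sigma> \<rho> V" "V \<cdot> adj C V = P"
          using subobjects[OF \<rho> P(1-3)] by blast
        then have \<sigma>S: "\<sigma> \<in> S" using S.subobject_in less.prems(1) by blast
        have dec: "Suc (card A) \<le> n" if "orthogonal_idempotents \<sigma> A" for A
          using orthogonal_idempotents_extend[OF \<rho> V(1,2) _ that] V(3) P(4) less.prems(2) by metis
        have "orthogonal_idempotents \<sigma> {}" by (simp add: orthogonal_idempotents_def)
        from dec[OF this] have "n - 1 < n" by simp
        moreover have "card A \<le> n - 1" if "orthogonal_idempotents \<sigma> A" for A
          using dec[OF that] by simp
        ultimately have "\<sigma> \<in> degenerate_objects C \<epsilon>"
          using less.IH \<sigma>S by blast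
        then have "monodromy \<sigma> \<eta> = idn C (\<sigma> \<odot> \<eta>)"
          using \<eta> by (simp add: degenerate_objects_def)
        moreover have "V \<in> Hom C \<sigma> \<rho>" "adj C V \<in> Hom C \<rho> \<sigma>"
          using V adj_Hom unfolding isometry_in_def by auto
        ultimately show ?thesis
          using monodromy_factor[of V \<sigma> \<rho> "adj C V" \<eta>] V \<eta> by simp
      qed
      have "monodromy \<rho> \<eta> = idn C (\<rho> \<odot> \<eta>)" if \<eta>: "\<eta> \<in> Obj C" for \<eta>
      proof -
        let ?I = "idn C \<rho>" and ?J = "idn C \<eta>"
        have D: "?I - E \<in> Hom C \<rho> \<rho>" using E by (simp add: Hom_diff)
        have "adj C (?I - E) = ?I - E"
          using E by (simp add: adj_diff[OF \<rho> \<rho>] adj_idn)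
        moreover have "(?I - E) \<cdot> (?I - E) = ?I - E"
          using E D by (simp add: cmp_diff[OF \<rho> \<rho> \<rho>] idn_left[OF \<rho> \<rho>] idn_right[OF \<rho> \<rho>])
        moreover have "?I - E \<noteq> ?I" using E by simp
        ultimately have p: "monodromy \<rho> \<eta> \<cdot> ((?I - E) \<parallel> ?J) = (?I - E) \<parallel> ?J"
          by (intro part D \<eta>)
        have q: "monodromy \<rho> \<eta> \<cdot> (E \<parallel> ?J) = E \<parallel> ?J"
          using E \<eta> by (intro part)
        have sum: "(?I - E) \<parallel> ?J + E \<parallel> ?J = idn C (\<rho> \<odot> \<eta>)"
          using par_add(1)[OF \<rho> \<rho> \<eta> \<eta> D E(1), of ?J] \<eta> by (simp add: par_idn)
        have "monodromy \<rho> \<eta> = monodromy \<rho> \<eta> \<cdot> ((?I - E) \<parallel> ?J + E \<parallel> ?J)"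
          unfolding sum using \<eta> idn_right[of "\<rho> \<odot> \<eta>" "\<rho> \<odot> \<eta>"] monodromy_Hom by simp
        also have "\<dots> = (?I - E) \<parallel> ?J + E \<parallel> ?J"
          using cmp_add(2)[of "\<rho> \<odot> \<eta>" "\<rho> \<odot> \<eta>" "\<rho> \<odot> \<eta>" "monodromy \<rho> \<eta>" "(?I - E) \<parallel> ?J" "E \<parallel> ?J"]
            p q \<eta> D E(1) monodromy_Hom[of \<rho> \<eta>] par_in[of _ \<rho> \<rho> ?J \<eta> \<eta>] by simp
        finally show ?thesis unfolding sum .
      qed
      then show ?thesis by (simp add: degenerate_objects_def)
    qed
  qed
  show ?thesis
  proof
    fix \<rho> assume \<rho>: "\<rho> \<in> S"
    then have obj: "\<rho> \<in> Obj C" using S.sub by blast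
    obtain B where B: "finite B" "Hom C \<rho> \<rho> = vs.span B"
      using finite_dim[OF obj obj] by blast
    have "card A \<le> card B" if "orthogonal_idempotents \<rho> A" for A
      using vs.independent_span_bound[OF B(1) orthogonal_idempotents_independent[OF obj that]] that B(2)
      by (auto simp: orthogonal_idempotents_def)
    then show "\<rho> \<in> degenerate_objects C \<epsilon>" using bounded \<rho> by blast
  qed
qed

text \<open>On the left, the strand \<open>b\<close> crosses \<open>\<rho>\<close> twice: once in the tensor product of arrows and, after \<open>T\<close>
  and \<open>T'\<close> have been moved out by naturality, once in \<open>\<epsilon>(a \<odot> \<rho>, b \<odot> \<sigma>)\<close>. By the hexagon equations these
  crossings meet and cancel; the other crossings make up the right-hand side.\<close>

lemma (in BTC_star) braid_through_degenerate:
  assumes obj [simp]: "a \<in> Obj C" "b \<in> Obj C" "\<rho> \<in> Obj C" "\<sigma> \<in> Obj C" "\<rho>' \<in> Obj C" "\<sigma>' \<in> Obj C"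
    and T: "T \<in> Hom C (a \<odot> \<rho>) \<rho>'" and T': "T' \<in> Hom C (b \<odot> \<sigma>) \<sigma>'"
    and deg: "monodromy b \<rho> = idn C (b \<odot> \<rho>)"
  shows "\<epsilon> \<rho>' \<sigma>' \<cdot> ((T \<parallel> T') \<cdot> (idn C a \<parallel> \<epsilon> b \<rho> \<parallel> idn C \<sigma>)) =
    (((T' \<parallel> T) \<cdot> (idn C b \<parallel> \<epsilon> a \<sigma> \<parallel> idn C \<rho>)) \<cdot> (idn C (b \<odot> a) \<parallel> \<epsilon> \<rho> \<sigma>)) \<cdot> (\<epsilon> a b \<parallel> idn C (\<rho> \<odot> \<sigma>))"
proof -
  let ?W1 = "a \<odot> (b \<odot> (\<rho> \<odot> \<sigma>))" and ?W2 = "a \<odot> (\<rho> \<odot> (b \<odot> \<sigma>))" and ?W3 = "a \<odot> (b \<odot> (\<sigma> \<odot> \<rho>))"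
    and ?W4 = "b \<odot> (a \<odot> (\<sigma> \<odot> \<rho>))" and ?W5 = "b \<odot> (\<sigma> \<odot> (a \<odot> \<rho>))" and ?W6 = "b \<odot> (a \<odot> (\<rho> \<odot> \<sigma>))"
  note e = eps_Hom[OF obj(2,3)] eps_Hom[OF obj(3,2)] eps_Hom[OF obj(3,4)] eps_Hom[OF obj(1,2)] eps_Hom[OF obj(1,4)]
  define f1 where "f1 = idn C a \<parallel> (\<epsilon> b \<rho> \<parallel> idn C \<sigma>)"
  define f2 where "f2 = idn C a \<parallel> (\<epsilon> \<rho> b \<parallel> idn C \<sigma>)"
  define f3 where "f3 = idn C a \<parallel> (idn C b \<parallel> \<epsilon> \<rho> \<sigma>)"
  define f4 where "f4 = idn C (b \<odot> a) \<parallel> \<epsilon> \<rho> \<sigma>"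
  define g1 where "g1 = \<epsilon> a b \<parallel> idn C (\<sigma> \<odot> \<rho>)"
  define g2 where "g2 = (idn C b \<parallel> \<epsilon> a \<sigma>) \<parallel> idn C \<rho>"
  define g4 where "g4 = \<epsilon> a b \<parallel> idn C (\<rho> \<odot> \<sigma>)"
  have f1: "f1 \<in> Hom C ?W1 ?W2"
    using par_in[OF idn_Hom[OF obj(1)] par_in[OF e(1) idn_Hom[OF obj(4)]]] by (simp add: f1_def tns_assoc)
  have f2: "f2 \<in> Hom C ?W2 ?W1"
    using par_in[OF idn_Hom[OF obj(1)] par_in[OF e(2) idn_Hom[OF obj(4)]]] by (simp add: f2_def tns_assoc)
  have f3: "f3 \<in> Hom C ?W1 ?W3"
    using par_in[OF idn_Hom[OF obj(1)] par_in[OF idn_Hom[OF obj(2)] e(3)]] by (simp add: f3_def tns_assoc)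
  have f4: "f4 \<in> Hom C ?W6 ?W4"
    using par_in[OF idn_Hom[of "b \<odot> a"] e(3)] by (simp add: f4_def tns_assoc)
  have g1: "g1 \<in> Hom C ?W3 ?W4"
    using par_in[OF e(4) idn_Hom[of "\<sigma> \<odot> \<rho>"]] by (simp add: g1_def tns_assoc)
  have g2: "g2 \<in> Hom C ?W4 ?W5"
    using par_in[OF par_in[OF idn_Hom[OF obj(2)] e(5)] idn_Hom[OF obj(3)]] by (simp add: g2_def tns_assoc)
  have g4: "g4 \<in> Hom C ?W1 ?W6"
    using par_in[OF e(4) idn_Hom[of "\<rho> \<odot> \<sigma>"]] by (simp add: g4_def tns_assoc)
  have TT: "T \<parallel> T' \<in> Hom C ?W2 (\<rho>' \<odot> \<sigma>')" "T' \<parallel> T \<in> Hom C ?W5 (\<sigma>' \<odot> \<rho>')"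
    using par_in[OF T T'] par_in[OF T' T] by (simp_all add: tns_assoc)
  note i1 = idn_left[OF obj(1,1)] idn_left[OF obj(2,2)] idn_left[OF obj(3,3)] idn_left[OF obj(4,4)]
  have h: "\<epsilon> (a \<odot> \<rho>) (b \<odot> \<sigma>) = (g2 \<cdot> g1) \<cdot> (f3 \<cdot> f2)"
  proof -
    have "f3 \<cdot> f2 = idn C a \<parallel> \<epsilon> \<rho> (b \<odot> \<sigma>)"
      unfolding f3_def f2_def eps_tns(1)[OF obj(3,2,4)]
      using interchange[of a a a "\<rho> \<odot> (b \<odot> \<sigma>)" "b \<odot> (\<rho> \<odot> \<sigma>)" "b \<odot> (\<sigma> \<odot> \<rho>)" "idn C a" "idn C a"
          "idn C b \<parallel> \<epsilon> \<rho> \<sigma>" "\<epsilon> \<rho> b \<parallel> idn C \<sigma>"]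
        par_in[OF idn_Hom[OF obj(2)] e(3)] par_in[OF e(2) idn_Hom[OF obj(4)]] i1
      by (simp add: tns_assoc)
    moreover have "g2 \<cdot> g1 = \<epsilon> a (b \<odot> \<sigma>) \<parallel> idn C \<rho>"
    proof -
      have "g1 = (\<epsilon> a b \<parallel> idn C \<sigma>) \<parallel> idn C \<rho>"
        unfolding g1_def using par_assoc[OF _ _ obj(4,4,3,3) e(4), of "idn C \<sigma>" "idn C \<rho>"] by (simp add: par_idn)
      then show ?thesis
        unfolding g2_def eps_tns(1)[OF obj(1,2,4)]
        using interchange[of "a \<odot> (b \<odot> \<sigma>)" "b \<odot> (a \<odot> \<sigma>)" "b \<odot> (\<sigma> \<odot> a)" \<rho> \<rho> \<rho>
          "idn C b \<parallel> \<epsilon> a \<sigma>" "\<epsilon> a b \<parallel> idn C \<sigma>" "idn C \<rho>" "idn C \<rho>"]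
          par_in[OF idn_Hom[OF obj(2)] e(5)] par_in[OF e(4) idn_Hom[OF obj(4)]] i1
        by (simp add: tns_assoc)
    qed
    ultimately show ?thesis using eps_tns(2)[of a \<rho> "b \<odot> \<sigma>"] by simp
  qed
  have f21: "f2 \<cdot> f1 = idn C ?W1"
  proof -
    have "(\<epsilon> \<rho> b \<parallel> idn C \<sigma>) \<cdot> (\<epsilon> b \<rho> \<parallel> idn C \<sigma>) = idn C (b \<odot> \<rho>) \<parallel> idn C \<sigma>"
      using interchange[OF _ _ _ obj(4,4,4) e(2) e(1), of "idn C \<sigma>" "idn C \<sigma>"] deg i1 by simp
    then show ?thesis
      unfolding f2_def f1_def
      using interchange[of a a a "b \<odot> (\<rho> \<odot> \<sigma>)" "\<rho> \<odot> (b \<odot> \<sigma>)" "b \<odot> (\<rho> \<odot> \<sigma>)" "idn C a" "idn C a"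
          "\<epsilon> \<rho> b \<parallel> idn C \<sigma>" "\<epsilon> b \<rho> \<parallel> idn C \<sigma>"]
        par_in[OF e(2) idn_Hom[OF obj(4)]] par_in[OF e(1) idn_Hom[OF obj(4)]] i1
      by (simp add: tns_assoc par_idn)
  qed
  have g1f3: "g1 \<cdot> f3 = f4 \<cdot> g4"
  proof -
    have "f3 = idn C (a \<odot> b) \<parallel> \<epsilon> \<rho> \<sigma>"
      unfolding f3_def using par_assoc[OF obj(1,1,2,2) _ _ _ _ e(3), of "idn C a" "idn C b"] by (simp add: par_idn)
    then show ?thesis
      unfolding g1_def f4_def g4_def
      using interchange[of "a \<odot> b" "a \<odot> b" "b \<odot> a" "\<rho> \<odot> \<sigma>" "\<sigma> \<odot> \<rho>" "\<sigma> \<odot> \<rho>" "\<epsilon> a b" "idn C (a \<odot> b)" "idn C (\<sigma> \<odot> \<rho>)" "\<epsilon> \<rho> \<sigma>"]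
        interchange[of "a \<odot> b" "b \<odot> a" "b \<odot> a" "\<rho> \<odot> \<sigma>" "\<rho> \<odot> \<sigma>" "\<sigma> \<odot> \<rho>" "idn C (b \<odot> a)" "\<epsilon> a b" "\<epsilon> \<rho> \<sigma>" "idn C (\<rho> \<odot> \<sigma>)"]
        e idn_left[of "a \<odot> b" "b \<odot> a"] idn_right[of "a \<odot> b" "b \<odot> a"]
        idn_left[of "\<rho> \<odot> \<sigma>" "\<sigma> \<odot> \<rho>"] idn_right[of "\<rho> \<odot> \<sigma>" "\<sigma> \<odot> \<rho>"]
      by simp
  qed
  have m1: "(idn C a \<parallel> \<epsilon> b \<rho>) \<parallel> idn C \<sigma> = f1"
    unfolding f1_def by (rule par_assoc[OF obj(1,1) _ _ obj(4,4) _ e(1)]) simp_all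
  have f32: "f3 \<cdot> f2 \<in> Hom C ?W2 ?W3" by (rule cmp_in[OF f3 f2]) simp_all
  have g21: "g2 \<cdot> g1 \<in> Hom C ?W3 ?W5" by (rule cmp_in[OF g2 g1]) simp_all
  have g2f4: "g2 \<cdot> f4 \<in> Hom C ?W6 ?W5" by (rule cmp_in[OF g2 f4]) simp_all
  have hH: "\<epsilon> (a \<odot> \<rho>) (b \<odot> \<sigma>) \<in> Hom C ?W2 ?W5" unfolding h by (rule cmp_in[OF g21 f32]) simp_all
  have hf1: "\<epsilon> (a \<odot> \<rho>) (b \<odot> \<sigma>) \<cdot> f1 = (g2 \<cdot> f4) \<cdot> g4"
  proof -
    have "\<epsilon> (a \<odot> \<rho>) (b \<odot> \<sigma>) \<cdot> f1 = (g2 \<cdot> g1) \<cdot> ((f3 \<cdot> f2) \<cdot> f1)"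
      unfolding h by (rule cmp_assoc[OF _ _ _ _ g21 f32 f1]) simp_all
    also have "(f3 \<cdot> f2) \<cdot> f1 = f3 \<cdot> (f2 \<cdot> f1)" by (rule cmp_assoc[OF _ _ _ _ f3 f2 f1]) simp_all
    also have "\<dots> = f3" unfolding f21 by (rule idn_right[OF _ _ f3]) simp_all
    also have "(g2 \<cdot> g1) \<cdot> f3 = g2 \<cdot> (g1 \<cdot> f3)" by (rule cmp_assoc[OF _ _ _ _ g2 g1 f3]) simp_all
    also have "\<dots> = (g2 \<cdot> f4) \<cdot> g4"
      unfolding g1f3 by (rule cmp_assoc[OF _ _ _ _ g2 f4 g4, symmetric]) simp_all
    finally show ?thesis .
  qed
  have "\<epsilon> \<rho>' \<sigma>' \<cdot> ((T \<parallel> T') \<cdot> f1) = (\<epsilon> \<rho>' \<sigma>' \<cdot> (T \<parallel> T')) \<cdot> f1"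
    by (rule cmp_assoc[OF _ _ _ _ eps_Hom TT(1) f1, symmetric]) simp_all
  also have "\<epsilon> \<rho>' \<sigma>' \<cdot> (T \<parallel> T') = (T' \<parallel> T) \<cdot> \<epsilon> (a \<odot> \<rho>) (b \<odot> \<sigma>)"
    by (rule eps_natural[OF T T']) simp_all
  also have "\<dots> \<cdot> f1 = (T' \<parallel> T) \<cdot> (\<epsilon> (a \<odot> \<rho>) (b \<odot> \<sigma>) \<cdot> f1)"
    by (rule cmp_assoc[OF _ _ _ _ TT(2) hH f1]) simp_all
  also have "\<dots> = ((T' \<parallel> T) \<cdot> (g2 \<cdot> f4)) \<cdot> g4"
    unfolding hf1 by (rule cmp_assoc[OF _ _ _ _ TT(2) g2f4 g4, symmetric]) simp_all
  also have "(T' \<parallel> T) \<cdot> (g2 \<cdot> f4) = ((T' \<parallel> T) \<cdot> g2) \<cdot> f4"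
    by (rule cmp_assoc[OF _ _ _ _ TT(2) g2 f4, symmetric]) simp_all
  finally show ?thesis unfolding m1 f4_def[symmetric] g2_def[symmetric] g4_def[symmetric] .
qed

section \<open>Irreducible objects and their Hilbert spaces\<close>

lemma (in strict_tensor_category) iso_obj_sym: "iso_obj C \<rho> \<sigma> \<Longrightarrow> iso_obj C \<sigma> \<rho>"
  unfolding iso_obj_def by blast

lemma (in strict_tensor_category) iso_obj_trans:
  assumes "iso_obj C \<rho> \<sigma>" "iso_obj C \<sigma> \<tau>" and obj: "\<rho> \<in> Obj C" "\<sigma> \<in> Obj C" "\<tau> \<in> Obj C"
  shows "iso_obj C \<rho> \<tau>"
proof -
  obtain f g where fg: "f \<in> Hom C \<rho> \<sigma>" "g \<in> Hom C \<sigma> \<rho>" "g \<cdot> f = idn C \<rho>" "f \<cdot> g = idn C \<sigma>"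
    using assms(1) unfolding iso_obj_def by blast
  obtain f' g' where fg': "f' \<in> Hom C \<sigma> \<tau>" "g' \<in> Hom C \<tau> \<sigma>" "g' \<cdot> f' = idn C \<sigma>" "f' \<cdot> g' = idn C \<tau>"
    using assms(2) unfolding iso_obj_def by blast
  have cancel: "(a \<cdot> b) \<cdot> (b' \<cdot> a') = idn C \<alpha>"
    if "a \<in> Hom C \<beta> \<alpha>" "b \<in> Hom C \<delta> \<beta>" "b' \<in> Hom C \<beta> \<delta>" "a' \<in> Hom C \<alpha> \<beta>"
      "b \<cdot> b' = idn C \<beta>" "a \<cdot> a' = idn C \<alpha>" "\<alpha> \<in> Obj C" "\<beta> \<in> Obj C" "\<delta> \<in> Obj C" for a b a' b' \<alpha> \<beta> \<delta>
  proof -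
    have "(a \<cdot> b) \<cdot> (b' \<cdot> a') = a \<cdot> (b \<cdot> (b' \<cdot> a'))"
      using that by (intro cmp_assoc[of \<alpha> \<delta> \<beta> \<alpha>]) (auto intro: cmp_in[of _ \<beta>])
    also have "b \<cdot> (b' \<cdot> a') = (b \<cdot> b') \<cdot> a'"
      using that by (intro cmp_assoc[of \<alpha> \<beta> \<delta> \<beta>, symmetric]) auto
    finally show ?thesis using that idn_left[of \<alpha> \<beta> a'] by simp
  qed
  have "f' \<cdot> f \<in> Hom C \<rho> \<tau>" "g \<cdot> g' \<in> Hom C \<tau> \<rho>"
    using fg fg' obj by (auto intro: cmp_in[of _ \<sigma>])
  moreover have "(g \<cdot> g') \<cdot> (f' \<cdot> f) = idn C \<rho>" "(f' \<cdot> f) \<cdot> (g \<cdot> g') = idn C \<tau>"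
    using fg fg' obj by (auto intro!: cancel)
  ultimately show ?thesis unfolding iso_obj_def by blast
qed

lemma (in tensor_star_category) irreducible_iso:
  assumes irr: "irreducible_obj C \<rho>" and iso: "iso_obj C \<rho> \<sigma>" and obj [simp]: "\<rho> \<in> Obj C" "\<sigma> \<in> Obj C"
  shows "irreducible_obj C \<sigma>"
proof -
  obtain f g where fg [simp]: "f \<in> Hom C \<rho> \<sigma>" "g \<in> Hom C \<sigma> \<rho>" "g \<cdot> f = idn C \<rho>" "f \<cdot> g = idn C \<sigma>"
    using iso unfolding iso_obj_def by blast
  have "idn C \<sigma> \<noteq> 0"
  proof
    assume "idn C \<sigma> = 0"
    then have "f = 0" using idn_left[of \<rho> \<sigma> f] cmp_zero(1)[of \<rho> \<sigma> \<sigma> f] by simp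
    then have "idn C \<rho> = 0" using fg(3) cmp_zero(2)[of \<rho> \<sigma> \<rho> g] by simp
    with irr show False by (simp add: irreducible_obj_def)
  qed
  moreover have "x \<in> range (\<lambda>c. scl C c (idn C \<sigma>))" if x [simp]: "x \<in> Hom C \<sigma> \<sigma>" for x
  proof -
    have xf [simp]: "x \<cdot> f \<in> Hom C \<rho> \<sigma>" by (rule cmp_in[of _ \<sigma>]) simp_all
    have "g \<cdot> (x \<cdot> f) \<in> Hom C \<rho> \<rho>" by (rule cmp_in[of _ \<sigma>]) simp_all
    then obtain c where c: "g \<cdot> (x \<cdot> f) = scl C c (idn C \<rho>)"
      using irr unfolding irreducible_obj_def by auto
    have "x \<cdot> f = (f \<cdot> g) \<cdot> (x \<cdot> f)" using idn_left[of \<rho> \<sigma> "x \<cdot> f"] by simp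
    also have "\<dots> = f \<cdot> scl C c (idn C \<rho>)" unfolding c[symmetric] by (rule cmp_assoc[of \<rho> \<sigma> \<rho> \<sigma>]) simp_all
    also have "\<dots> = scl C c f" by (simp add: cmp_scl[of \<rho> \<rho> \<sigma>] idn_right[of \<rho> \<sigma>])
    finally have 1: "x \<cdot> f = scl C c f" .
    have "x = x \<cdot> (f \<cdot> g)" using idn_right[of \<sigma> \<sigma> x] by simp
    also have "\<dots> = (x \<cdot> f) \<cdot> g" by (rule cmp_assoc[of \<sigma> \<rho> \<sigma> \<sigma>, symmetric]) simp_all
    also have "\<dots> = scl C c (idn C \<sigma>)" by (simp add: 1 cmp_scl[of \<sigma> \<rho> \<sigma>])
    finally show ?thesis by blast
  qed
  ultimately show ?thesis
    unfolding irreducible_obj_def by (auto intro: Hom_scl)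
qed

lemma (in strict_tensor_category) iso_class_eq:
  assumes "iso_obj C \<rho> \<sigma>" "\<rho> \<in> Obj C" "\<sigma> \<in> Obj C"
  shows "iso_class C \<rho> = iso_class C \<sigma>"
  using assms iso_obj_trans iso_obj_sym unfolding iso_class_def by blast

text \<open>The data of the crossed product. Below, \<open>\<o>\<close> is the class of the unit object, and \<open>rel\<close> is
  the congruence on formal sums whose classes \<open>cls\<close> are the arrows of the crossed product.\<close>

locale crossed_product_setting =
  BTC_star C \<epsilon> + S: even_symmetric_subcategory C \<epsilon> S + U: rep_category G TG U +
  F: rep_isomorphism C \<epsilon> S G U F + K: crossed_product_choice C S K
  for C :: "('o, 'a::ab_group_add, 'z) lin_star_tensor_scheme" (structure)
    and \<epsilon> :: "'o \<Rightarrow> 'o \<Rightarrow> 'a"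
    and S :: "'o set"
    and G :: "('g, 'y) monoid_scheme"
    and TG :: "'g topology"
    and U :: "('g, 'u, 'v::ab_group_add) rep_cat"
    and F :: "('o, 'a, 'u, 'v) rep_functor"
    and K :: "('o, 'a) cp_choice"
begin

abbreviation "\<Gamma> \<equiv> gam K"
abbreviation "Irr \<equiv> Ghat C S"
abbreviation "\<o> \<equiv> iso_class C (unt C)"
abbreviation "\<H> \<rho> \<equiv> Hsp U (fobj F \<rho>)"
abbreviation "hscl \<rho> \<equiv> rscl (urep U (fobj F \<rho>))"
abbreviation "ip \<rho> \<equiv> rip (urep U (fobj F \<rho>))"
abbreviation "vten \<rho> \<sigma> \<equiv> vtns U (fobj F \<rho>) (fobj F \<sigma>)"
abbreviation "gen \<equiv> cp_gen C S U F K"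
abbreviation "rel \<equiv> cp_rel C S U F K"
abbreviation "cls \<equiv> cp_class C S U F K"
abbreviation "fus \<equiv> fusion C S U F K"
abbreviation "emb \<equiv> cp_emb C S U F K"

lemma S_Obj [simp]: "\<rho> \<in> S \<Longrightarrow> \<rho> \<in> Obj C"
  using S.sub by blast

lemma Irr_cases:
  assumes "k \<in> Irr"
  shows "\<Gamma> k \<in> S" "irreducible_obj C (\<Gamma> k)" "k = iso_class C (\<Gamma> k)"
proof -
  obtain \<rho> where \<rho>: "k = iso_class C \<rho>" "\<rho> \<in> S" "irreducible_obj C \<rho>"
    using assms unfolding Ghat_def by blast
  then have \<Gamma>: "\<Gamma> k \<in> Obj C" "iso_obj C \<rho> (\<Gamma> k)"
    using K.gam_in[OF assms] unfolding iso_class_def by auto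
  show "\<Gamma> k \<in> S" using \<rho> \<Gamma> S.replete by blast
  show "irreducible_obj C (\<Gamma> k)" using \<rho> \<Gamma> irreducible_iso by simp
  show "k = iso_class C (\<Gamma> k)" using \<rho> \<Gamma> iso_class_eq by simp
qed

declare Irr_cases(1) [simp]

lemma Irr_Obj [simp]: "k \<in> Irr \<Longrightarrow> \<Gamma> k \<in> Obj C"
  by simp

lemma Irr_idn_nz: "k \<in> Irr \<Longrightarrow> idn C (\<Gamma> k) \<noteq> 0"
  using Irr_cases(2) unfolding irreducible_obj_def by blast

lemma Irr_scalar: "\<lbrakk>k \<in> Irr; x \<in> Hom C (\<Gamma> k) (\<Gamma> k)\<rbrakk> \<Longrightarrow> \<exists>c. x = scl C c (idn C (\<Gamma> k))"
  using Irr_cases(2) unfolding irreducible_obj_def by blast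

lemma unt_Irr [simp]: "\<o> \<in> Irr"
  unfolding Ghat_def using S.unt_in irreducible_unt by blast

declare K.gam_unt [simp]

text \<open>By irreducibility \<open>V V\<^sup>*\<close> is a scalar, and \<open>V V\<^sup>* V = V\<close> shows that it is \<open>1\<close>. So \<open>V\<close> is
  unitary, and isomorphic objects have the same class.\<close>

lemma Irr_isometry_eq:
  assumes k: "k \<in> Irr" and l: "l \<in> Irr" and V: "V \<in> Hom C (\<Gamma> k) (\<Gamma> l)" "adj C V \<cdot> V = idn C (\<Gamma> k)"
  shows "k = l"
proof -
  note [simp] = k l V
  have V' [simp]: "adj C V \<in> Hom C (\<Gamma> l) (\<Gamma> k)" by (simp add: adj_Hom)
  have "V \<cdot> adj C V \<in> Hom C (\<Gamma> l) (\<Gamma> l)" by (rule cmp_in[of _ "\<Gamma> k"]) simp_all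
  then obtain c where c: "V \<cdot> adj C V = scl C c (idn C (\<Gamma> l))" using Irr_scalar l by blast
  have "V = V \<cdot> (adj C V \<cdot> V)" using idn_right[of "\<Gamma> k" "\<Gamma> l" V] by simp
  also have "\<dots> = (V \<cdot> adj C V) \<cdot> V" by (rule cmp_assoc[of "\<Gamma> k" "\<Gamma> l" "\<Gamma> k" "\<Gamma> l", symmetric]) simp_all
  also have "\<dots> = scl C c V" by (simp add: c cmp_scl[of "\<Gamma> k" "\<Gamma> l" "\<Gamma> l"] idn_left[of "\<Gamma> k" "\<Gamma> l"])
  finally have "scl C (1 - c) V = 0" by (simp add: vs.scale_left_diff_distrib)
  moreover have "V \<noteq> 0"
    using V(2) Irr_idn_nz[OF k] cmp_zero(2)[OF Irr_Obj[OF k] Irr_Obj[OF l] Irr_Obj[OF k] V'] by metis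
  ultimately have "c = 1" by simp
  then have "iso_obj C (\<Gamma> k) (\<Gamma> l)"
    using c unfolding iso_obj_def by (intro bexI[of _ V] bexI[of _ "adj C V"]) simp_all
  then have "iso_class C (\<Gamma> k) = iso_class C (\<Gamma> l)"
    by (rule iso_class_eq) (rule Irr_Obj, fact)+
  then show ?thesis
    by (rule HOL.trans[OF Irr_cases(3)[OF k] HOL.trans[OF _ Irr_cases(3)[OF l, symmetric]]])
qed

lemma fobj_in [simp]: "\<rho> \<in> S \<Longrightarrow> fobj F \<rho> \<in> UObj U"
  using F.fobj_bij by (rule bij_betwE[rule_format])

lemma unt_S [simp]: "unt C \<in> S" by (rule S.unt_in)

lemma tns_S [simp]: "\<rho> \<in> S \<Longrightarrow> \<sigma> \<in> S \<Longrightarrow> \<rho> \<odot> \<sigma> \<in> S" by (rule S.tns_in)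

lemma hscl_vs: "\<rho> \<in> S \<Longrightarrow> vector_space (hscl \<rho>)"
  using U.reps unitary_rep.vector_space fobj_in by blast

lemma \<H>_closed:
  assumes \<rho>: "\<rho> \<in> S"
  shows \<H>_zero [simp]: "0 \<in> \<H> \<rho>"
    and \<H>_add: "\<lbrakk>x \<in> \<H> \<rho>; y \<in> \<H> \<rho>\<rbrakk> \<Longrightarrow> x + y \<in> \<H> \<rho>"
    and \<H>_scl: "x \<in> \<H> \<rho> \<Longrightarrow> hscl \<rho> c x \<in> \<H> \<rho>"
proof -
  interpret V: vector_space "hscl \<rho>" by (rule hscl_vs[OF \<rho>])
  obtain B where B: "\<H> \<rho> = V.span B"
    using unitary_rep.finite_dim[OF U.reps[OF fobj_in[OF \<rho>]]] by blast
  show "0 \<in> \<H> \<rho>" unfolding B by (rule V.span_zero)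
  show "\<lbrakk>x \<in> \<H> \<rho>; y \<in> \<H> \<rho>\<rbrakk> \<Longrightarrow> x + y \<in> \<H> \<rho>" unfolding B by (rule V.span_add)
  show "x \<in> \<H> \<rho> \<Longrightarrow> hscl \<rho> c x \<in> \<H> \<rho>" unfolding B by (rule V.span_scale)
qed

lemma \<H>_sum: "\<lbrakk>\<And>i. i \<in> I \<Longrightarrow> f i \<in> \<H> \<rho>; \<rho> \<in> S\<rbrakk> \<Longrightarrow> sum f I \<in> \<H> \<rho>"
  by (induction I rule: infinite_finite_induct) (auto intro: \<H>_add)

lemma vac_in [simp]: "\<Omega>\<^bsub>U\<^esub> \<in> \<H> (unt C)"
proof -
  interpret V: vector_space "hscl (unt C)" by (rule hscl_vs) simp
  have "\<Omega>\<^bsub>U\<^esub> = hscl (unt C) 1 \<Omega>\<^bsub>U\<^esub>" by (rule V.scale_one[symmetric])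
  then show ?thesis unfolding F.fobj_unt U.vac_span by (rule range_eqI)
qed

lemma vten_in [simp]: "\<lbrakk>\<rho> \<in> S; \<sigma> \<in> S; x \<in> \<H> \<rho>; y \<in> \<H> \<sigma>\<rbrakk> \<Longrightarrow> vten \<rho> \<sigma> x y \<in> \<H> (\<rho> \<odot> \<sigma>)"
  by (simp add: F.fobj_tns U.vtns_in)

lemma farr_in: "\<lbrakk>\<rho> \<in> S; \<sigma> \<in> S; T \<in> Hom C \<rho> \<sigma>; x \<in> \<H> \<rho>\<rbrakk> \<Longrightarrow> farr F \<rho> \<sigma> T x \<in> \<H> \<sigma>"
  using F.farr_intertwiner unfolding intertwiner_def by blast

lemma farr_add_vec: "\<lbrakk>\<rho> \<in> S; \<sigma> \<in> S; T \<in> Hom C \<rho> \<sigma>; x \<in> \<H> \<rho>; y \<in> \<H> \<rho>\<rbrakk>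
  \<Longrightarrow> farr F \<rho> \<sigma> T (x + y) = farr F \<rho> \<sigma> T x + farr F \<rho> \<sigma> T y"
  using F.farr_intertwiner unfolding intertwiner_def by blast

lemma farr_scl_vec: "\<lbrakk>\<rho> \<in> S; \<sigma> \<in> S; T \<in> Hom C \<rho> \<sigma>; x \<in> \<H> \<rho>\<rbrakk>
  \<Longrightarrow> farr F \<rho> \<sigma> T (hscl \<rho> c x) = hscl \<sigma> c (farr F \<rho> \<sigma> T x)"
  using F.farr_intertwiner unfolding intertwiner_def by blast

lemma farr_zero: "\<lbrakk>\<rho> \<in> S; \<sigma> \<in> S; x \<in> \<H> \<rho>\<rbrakk> \<Longrightarrow> farr F \<rho> \<sigma> 0 x = 0"
  using F.farr_add[of \<rho> \<sigma> 0 0 x] by simp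

lemma farr_sum:
  assumes "\<rho> \<in> S" "\<sigma> \<in> S" "x \<in> \<H> \<rho>" "\<And>i. i \<in> I \<Longrightarrow> T i \<in> Hom C \<rho> \<sigma>"
  shows "farr F \<rho> \<sigma> (\<Sum>i\<in>I. scl C (c i) (T i)) x = (\<Sum>i\<in>I. hscl \<sigma> (c i) (farr F \<rho> \<sigma> (T i) x))"
  using assms(4)
proof (induction I rule: infinite_finite_induct)
  case (insert i I)
  have "(\<Sum>i\<in>I. scl C (c i) (T i)) \<in> Hom C \<rho> \<sigma>"
    using insert assms by (intro Hom_sum Hom_scl) auto
  with insert assms show ?case
    by (simp add: F.farr_add F.farr_scl Hom_scl)
qed (use assms farr_zero in simp_all)

text \<open>\<open>F\<close> is faithful: on a zero space it could not tell \<open>id\<close> from \<open>0\<close>.\<close>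

lemma \<H>_nontrivial:
  assumes k: "\<rho> \<in> S" "idn C \<rho> \<noteq> 0"
  shows "\<exists>\<psi>\<in>\<H> \<rho>. \<psi> \<noteq> 0"
proof (rule ccontr)
  assume "\<not> ?thesis"
  then have triv: "\<psi> = 0" if "\<psi> \<in> \<H> \<rho>" for \<psi> using that by blast
  have "intertwiner G (urep U (fobj F \<rho>)) (urep U (fobj F \<rho>)) (farr F \<rho> \<rho> (idn C \<rho>))"
    using k F.farr_intertwiner by simp
  then have "\<exists>!T. T \<in> Hom C \<rho> \<rho> \<and> (\<forall>x\<in>\<H> \<rho>. farr F \<rho> \<rho> T x = farr F \<rho> \<rho> (idn C \<rho>) x)"
    using k F.farr_bij by blast
  moreover have "\<forall>x\<in>\<H> \<rho>. farr F \<rho> \<rho> 0 x = farr F \<rho> \<rho> (idn C \<rho>) x"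
    using k triv farr_in[of \<rho> \<rho>] by (metis Hom_zero S_Obj idn_Hom)
  ultimately have "0 = idn C \<rho>" using k by (metis Hom_zero S_Obj idn_Hom)
  with k show False by simp
qed

end

section \<open>The relations defining the arrows\<close>

lemma set_mset_sum_subset: "(\<And>i. i \<in> I \<Longrightarrow> set_mset (f i) \<subseteq> A) \<Longrightarrow> set_mset (sum f I) \<subseteq> A"
  by (induction I rule: infinite_finite_induct) auto

lemma set_mset_sum_mset_subset: "(\<And>x. x \<in># M \<Longrightarrow> set_mset (f x) \<subseteq> A) \<Longrightarrow> set_mset (\<Sum>x\<in>#M. f x) \<subseteq> A"
  by (induction M) auto

lemma image_mset_sum: "image_mset h (sum f I) = (\<Sum>i\<in>I. image_mset h (f i))"
  by (induction I rule: infinite_finite_induct) auto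

lemma image_mset_sum_mset: "image_mset h (\<Sum>x\<in>#M. f x) = (\<Sum>x\<in>#M. image_mset h (f x))"
  by (induction M) auto

context crossed_product_setting
begin

lemma gen_iff: "(k, T, \<psi>) \<in> gen \<rho> \<sigma> \<longleftrightarrow> k \<in> Irr \<and> T \<in> Hom C (\<Gamma> k \<odot> \<rho>) \<sigma> \<and> \<psi> \<in> \<H> (\<Gamma> k)"
  by (simp add: cp_gen_def)

lemmas rel_refl = cp_rel.refl[of _ C S U F K]
lemmas rel_sym = cp_rel.sym[of C S U F K]
lemmas rel_trans [trans] = cp_rel.trans[of C S U F K]

lemma rel_gen:
  assumes "rel \<rho> \<sigma> M N" and obj [simp]: "\<rho> \<in> Obj C" "\<sigma> \<in> Obj C"
  shows "set_mset M \<subseteq> gen \<rho> \<sigma>" "set_mset N \<subseteq> gen \<rho> \<sigma>"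
proof -
  have "set_mset M \<subseteq> gen \<rho> \<sigma> \<and> set_mset N \<subseteq> gen \<rho> \<sigma>"
    using assms(1) by induction (auto simp: gen_iff Hom_add Hom_scl \<H>_add \<H>_scl)
  then show "set_mset M \<subseteq> gen \<rho> \<sigma>" "set_mset N \<subseteq> gen \<rho> \<sigma>" by auto
qed

lemma rel_add:
  assumes "rel \<rho> \<sigma> M N" "rel \<rho> \<sigma> M' N'" and obj: "\<rho> \<in> Obj C" "\<sigma> \<in> Obj C"
  shows "rel \<rho> \<sigma> (M + M') (N + N')"
proof -
  have "rel \<rho> \<sigma> (M + M') (N + M')"
    using assms rel_gen[OF assms(2) obj] by (intro cp_rel.plus)
  also have "rel \<rho> \<sigma> (M' + N) (N' + N)"
    using assms rel_gen[OF assms(1) obj] by (intro cp_rel.plus)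
  then have "rel \<rho> \<sigma> (N + M') (N + N')" by (simp add: add.commute)
  finally show ?thesis .
qed

text \<open>For infinite \<open>I\<close> both sums are \<open>0\<close>. Fusion sums can therefore be compared termwise whatever the set
  of occurring classes \<open>m\<close> is.\<close>

lemma rel_sum:
  assumes "\<And>i. i \<in> I \<Longrightarrow> rel \<rho> \<sigma> (f i) (g i)" and obj: "\<rho> \<in> Obj C" "\<sigma> \<in> Obj C"
  shows "rel \<rho> \<sigma> (sum f I) (sum g I)"
  using assms(1)
  by (induction I rule: infinite_finite_induct) (auto intro: rel_refl rel_add obj)

lemma rel_sum_mset:
  assumes "\<And>x. x \<in># M \<Longrightarrow> rel \<rho> \<sigma> (f x) (g x)" and obj: "\<rho> \<in> Obj C" "\<sigma> \<in> Obj C"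
  shows "rel \<rho> \<sigma> (\<Sum>x\<in>#M. f x) (\<Sum>x\<in>#M. g x)"
  using assms(1) by (induction M) (auto intro: rel_refl rel_add obj)

text \<open>The zero relation is given for the first tensor factor; a zero in the second one is the scalar \<open>0\<close>,
  which is moved across the tensor sign.\<close>

lemma rel_zero_right:
  assumes "(k, T, 0) \<in> gen \<rho> \<sigma>" and obj: "\<rho> \<in> Obj C" "\<sigma> \<in> Obj C"
  shows "rel \<rho> \<sigma> {#(k, T, 0)#} {#}"
proof -
  have k: "k \<in> Irr" and "0 \<in> \<H> (\<Gamma> k)" using assms by (simp_all add: gen_iff)
  interpret V: vector_space "hscl (\<Gamma> k)" using hscl_vs k by simp
  have "rel \<rho> \<sigma> {#(k, scl C 0 T, 0)#} {#(k, T, 0)#}"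
    using cp_rel.scale[where C=C and S=S and U=U and F=F and K=K, OF assms(1), of 0] by simp
  from rel_sym[OF this] have "rel \<rho> \<sigma> {#(k, T, 0)#} {#(k, 0, 0)#}" by simp
  also have "rel \<rho> \<sigma> {#(k, 0, 0)#} {#}"
    using assms by (intro cp_rel.zero) (simp add: gen_iff)
  finally show ?thesis .
qed

lemma rel_sum_left:
  assumes k: "k \<in> Irr" "\<psi> \<in> \<H> (\<Gamma> k)" and obj: "\<rho> \<in> Obj C" "\<sigma> \<in> Obj C"
    and I: "finite I" "\<And>i. i \<in> I \<Longrightarrow> T i \<in> Hom C (\<Gamma> k \<odot> \<rho>) \<sigma>"
  shows "rel \<rho> \<sigma> {#(k, \<Sum>i\<in>I. T i, \<psi>)#} (\<Sum>i\<in>I. {#(k, T i, \<psi>)#})"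
  using I
proof (induction I)
  case empty
  show ?case using k obj by (auto intro!: cp_rel.zero simp: gen_iff)
next
  case (insert i I)
  have "rel \<rho> \<sigma> {#(k, T i + (\<Sum>i\<in>I. T i), \<psi>)#} {#(k, T i, \<psi>), (k, \<Sum>i\<in>I. T i, \<psi>)#}"
    using insert.prems k obj by (intro cp_rel.add_left) (auto simp: gen_iff intro: Hom_sum)
  also have "{#(k, T i, \<psi>), (k, \<Sum>i\<in>I. T i, \<psi>)#} = {#(k, T i, \<psi>)#} + {#(k, \<Sum>i\<in>I. T i, \<psi>)#}"
    by simp
  also have "rel \<rho> \<sigma> \<dots> ({#(k, T i, \<psi>)#} + (\<Sum>i\<in>I. {#(k, T i, \<psi>)#}))"
    using insert k obj by (intro rel_add rel_refl insert.IH) (auto simp: gen_iff)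
  finally show ?case using insert by simp
qed

lemma rel_sum_right:
  assumes k: "k \<in> Irr" "T \<in> Hom C (\<Gamma> k \<odot> \<rho>) \<sigma>" and obj: "\<rho> \<in> Obj C" "\<sigma> \<in> Obj C"
    and I: "finite I" "\<And>i. i \<in> I \<Longrightarrow> \<psi> i \<in> \<H> (\<Gamma> k)"
  shows "rel \<rho> \<sigma> {#(k, T, \<Sum>i\<in>I. \<psi> i)#} (\<Sum>i\<in>I. {#(k, T, \<psi> i)#})"
  using I
proof (induction I)
  case empty
  show ?case using k obj by (auto intro!: rel_zero_right simp: gen_iff)
next
  case (insert i I)
  have "rel \<rho> \<sigma> {#(k, T, \<psi> i + (\<Sum>i\<in>I. \<psi> i))#} {#(k, T, \<psi> i), (k, T, \<Sum>i\<in>I. \<psi> i)#}"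
    using insert.prems k obj by (intro cp_rel.add_right) (auto simp: gen_iff intro: \<H>_sum)
  also have "{#(k, T, \<psi> i), (k, T, \<Sum>i\<in>I. \<psi> i)#} = {#(k, T, \<psi> i)#} + {#(k, T, \<Sum>i\<in>I. \<psi> i)#}"
    by simp
  also have "rel \<rho> \<sigma> \<dots> ({#(k, T, \<psi> i)#} + (\<Sum>i\<in>I. {#(k, T, \<psi> i)#}))"
    using insert k obj by (intro rel_add rel_refl insert.IH) (auto simp: gen_iff)
  finally show ?case using insert by simp
qed

text \<open>The relations do not identify too much: the functional \<open>T \<otimes> \<phi> \<mapsto> \<langle>\<psi>, \<phi>\<rangle> T\<close> on the \<open>k\<close>-th summand
  respects them.\<close>

lemma rel_separates:
  assumes r: "rel \<rho> \<sigma> {#(k, T, \<psi>)#} {#(k, T', \<psi>)#}" and nz: "\<psi> \<noteq> 0"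
    and g: "(k, T, \<psi>) \<in> gen \<rho> \<sigma>"
  shows "T = T'"
proof -
  have k: "k \<in> Irr" "\<psi> \<in> \<H> (\<Gamma> k)" using g by (simp_all add: gen_iff)
  interpret R: unitary_rep G TG "urep U (fobj F (\<Gamma> k))" using k U.reps by simp
  define L where "L = (\<lambda>(j, X, \<phi>). if j = k then scl C (ip (\<Gamma> k) \<psi> \<phi>) X else 0)"
  have "(\<Sum>x\<in>#M. L x) = (\<Sum>x\<in>#N. L x)" if "rel \<rho> \<sigma> M N" for M N
    using that
  proof induction
    case (add_left j X \<phi> X')
    then show ?case by (auto simp: L_def gen_iff vs.scale_right_distrib)
  next
    case (add_right j X \<phi> \<phi>')
    then show ?case using k by (auto simp: L_def gen_iff R.ip_add vs.scale_left_distrib)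
  next
    case (scale j X \<phi> c)
    then show ?case using k by (auto simp: L_def gen_iff R.ip_scl mult.commute)
  qed (auto simp: L_def)
  from this[OF r] have "scl C (ip (\<Gamma> k) \<psi> \<psi>) T = scl C (ip (\<Gamma> k) \<psi> \<psi>) T'"
    by (simp add: L_def)
  moreover have "ip (\<Gamma> k) \<psi> \<psi> \<noteq> 0" using R.ip_pos[OF k(2) nz] by auto
  ultimately show ?thesis by simp
qed

lemma cls_cong:
  assumes "rel \<rho> \<sigma> M N"
  shows "cls \<rho> \<sigma> M = cls \<rho> \<sigma> N"
proof -
  have "rel \<rho> \<sigma> M P \<longleftrightarrow> rel \<rho> \<sigma> N P" for P
    using rel_trans[OF assms] rel_trans[OF rel_sym[OF assms]] by blast
  then show ?thesis by (simp add: cp_class_def)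
qed

lemma cls_eqD:
  assumes "cls \<rho> \<sigma> M = cls \<rho> \<sigma> N" "set_mset N \<subseteq> gen \<rho> \<sigma>"
  shows "rel \<rho> \<sigma> M N"
proof -
  have "{P. rel \<rho> \<sigma> M P} = {P. rel \<rho> \<sigma> N P}" using assms(1) by (simp add: cp_class_def)
  moreover have "N \<in> {P. rel \<rho> \<sigma> N P}" using rel_refl[OF assms(2)] by simp
  ultimately show ?thesis by blast
qed

section \<open>Orthonormal bases of arrows from an irreducible object\<close>

text \<open>As an expansion formula, completeness passes directly to the image of a basis under a unitary. It
  implies that different basis vectors are orthogonal, by positivity, when \<open>(b \<beta>)\<^sup>*\<close> is applied to the
  expansion of \<open>b \<beta>\<close>.\<close>

definition onb :: "'o set \<Rightarrow> 'o \<Rightarrow> nat \<Rightarrow> (nat \<Rightarrow> 'a) \<Rightarrow> bool" where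
  "onb m \<theta> n b \<longleftrightarrow> (\<forall>\<alpha>\<in>{1..n}. b \<alpha> \<in> Hom C (\<Gamma> m) \<theta>) \<and>
     (\<forall>\<alpha>\<in>{1..n}. adj C (b \<alpha>) \<cdot> b \<alpha> = idn C (\<Gamma> m)) \<and>
     (\<forall>v\<in>Hom C (\<Gamma> m) \<theta>. v = (\<Sum>\<alpha>\<in>{1..n}. b \<alpha> \<cdot> (adj C (b \<alpha>) \<cdot> v)))"

lemma onbD:
  assumes "onb m \<theta> n b"
  shows "\<alpha> \<in> {1..n} \<Longrightarrow> b \<alpha> \<in> Hom C (\<Gamma> m) \<theta>"
    and "\<alpha> \<in> {1..n} \<Longrightarrow> adj C (b \<alpha>) \<cdot> b \<alpha> = idn C (\<Gamma> m)"
    and "v \<in> Hom C (\<Gamma> m) \<theta> \<Longrightarrow> v = (\<Sum>\<alpha>\<in>{1..n}. b \<alpha> \<cdot> (adj C (b \<alpha>) \<cdot> v))"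
  using assms unfolding onb_def by blast+

lemma vb_onb:
  assumes [simp]: "k \<in> Irr" "l \<in> Irr" "m \<in> Irr"
  shows "onb m (\<Gamma> k \<odot> \<Gamma> l) (mlt K k l m) (vb K k l m)"
proof -
  let ?n = "mlt K k l m" and ?b = "vb K k l m" and ?\<theta> = "\<Gamma> k \<odot> \<Gamma> l"
  have b [simp]: "?b \<alpha> \<in> Hom C (\<Gamma> m) ?\<theta>" if "\<alpha> \<in> {1..?n}" for \<alpha>
    using that K.vb_Hom by simp
  have adjb [simp]: "adj C (?b \<alpha>) \<in> Hom C ?\<theta> (\<Gamma> m)" if "\<alpha> \<in> {1..?n}" for \<alpha>
    using that adj_Hom b by simp
  have "v \<in> Hom C (\<Gamma> m) ?\<theta> \<and> v = (\<Sum>\<alpha>\<in>{1..?n}. ?b \<alpha> \<cdot> (adj C (?b \<alpha>) \<cdot> v))"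
    if "v \<in> vs.span (?b ` {1..?n})" for v
    using that
  proof (induction rule: vs.span_induct_alt)
    case base
    show ?case using cmp_zero(2)[of ?\<theta> ?\<theta> "\<Gamma> m"] cmp_zero(2)[of ?\<theta> "\<Gamma> m" ?\<theta>] by simp
  next
    case (step c x v)
    then obtain \<beta> where \<beta>: "\<beta> \<in> {1..?n}" "x = ?b \<beta>" by blast
    have v: "v \<in> Hom C (\<Gamma> m) ?\<theta>" and v_eq: "v = (\<Sum>\<alpha>\<in>{1..?n}. ?b \<alpha> \<cdot> (adj C (?b \<alpha>) \<cdot> v))"
      using step by blast+
    have "?b \<alpha> \<cdot> (adj C (?b \<alpha>) \<cdot> (scl C c x + v)) =
        (if \<alpha> = \<beta> then scl C c x else 0) + ?b \<alpha> \<cdot> (adj C (?b \<alpha>) \<cdot> v)" if \<alpha>: "\<alpha> \<in> {1..?n}" for \<alpha>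
    proof -
      have "adj C (?b \<alpha>) \<cdot> (scl C c x + v) = scl C c (if \<alpha> = \<beta> then idn C (\<Gamma> m) else 0) + adj C (?b \<alpha>) \<cdot> v"
        using \<alpha> \<beta> v K.vb_orthonormal[of k l m \<alpha> \<beta>]
        by (simp add: cmp_add[of "\<Gamma> m" ?\<theta> "\<Gamma> m"] cmp_scl[of "\<Gamma> m" ?\<theta> "\<Gamma> m"] Hom_scl)
      moreover have "adj C (?b \<alpha>) \<cdot> v \<in> Hom C (\<Gamma> m) (\<Gamma> m)"
        using \<alpha> v by (intro cmp_in[of _ ?\<theta>]) simp_all
      ultimately show ?thesis
        using \<alpha> \<beta>(2) by (simp add: cmp_add[of "\<Gamma> m" "\<Gamma> m" ?\<theta>] cmp_scl[of "\<Gamma> m" "\<Gamma> m" ?\<theta>] Hom_scl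
            idn_right[of "\<Gamma> m" ?\<theta>] cmp_zero[of "\<Gamma> m" "\<Gamma> m" ?\<theta>])
    qed
    then have "(\<Sum>\<alpha>\<in>{1..?n}. ?b \<alpha> \<cdot> (adj C (?b \<alpha>) \<cdot> (scl C c x + v))) =
        (\<Sum>\<alpha>\<in>{1..?n}. (if \<alpha> = \<beta> then scl C c x else 0) + ?b \<alpha> \<cdot> (adj C (?b \<alpha>) \<cdot> v))"
      by (intro sum.cong) auto
    also have "\<dots> = scl C c x + v"
      using \<beta>(1) v_eq[symmetric] by (simp add: sum.distrib del: atLeastAtMost_iff)
    finally show ?case using \<beta> v by (simp add: Hom_add Hom_scl)
  qed
  then show ?thesis
    unfolding onb_def using K.vb_span[of k l m] K.vb_orthonormal by auto
qed

lemma onb_pos_iff: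
  assumes b: "onb m \<theta> n b" and [simp]: "m \<in> Irr" "\<theta> \<in> Obj C"
  shows "0 < n \<longleftrightarrow> (\<exists>v\<in>Hom C (\<Gamma> m) \<theta>. v \<noteq> 0)"
proof
  assume "0 < n"
  then have 1: "1 \<in> {1..n}" by simp
  have "b 1 \<noteq> 0"
    using onbD(2)[OF b 1] cmp_zero(2)[of \<theta> \<theta> "\<Gamma> m" "adj C (b 1)"] onbD(1)[OF b 1] adj_Hom[of "\<Gamma> m" \<theta> "b 1"]
      Irr_idn_nz[of m] cmp_zero(2)[of "\<Gamma> m" \<theta> "\<Gamma> m" "adj C (b 1)"] by auto
  then show "\<exists>v\<in>Hom C (\<Gamma> m) \<theta>. v \<noteq> 0" using onbD(1)[OF b 1] by blast
next
  assume "\<exists>v\<in>Hom C (\<Gamma> m) \<theta>. v \<noteq> 0"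
  then obtain v where v: "v \<in> Hom C (\<Gamma> m) \<theta>" "v \<noteq> 0" by blast
  show "0 < n"
  proof (rule ccontr)
    assume "\<not> 0 < n"
    with onbD(3)[OF b v(1)] v(2) show False by simp
  qed
qed

text \<open>Independence of \<open>\<Sum>\<^sub>\<alpha> X(V\<^sub>\<alpha>) \<otimes> F(V\<^sub>\<alpha>\<^sup>*)\<xi>\<close> of the orthonormal basis: \<open>X\<close> is linear in \<open>V\<close>, while
  \<open>F(V\<^sup>*)\<close> is antilinear, so the two changes of basis cancel.\<close>

lemma basis_change:
  assumes b: "onb m \<theta> n b" and c: "onb m \<theta> n' c"
    and [simp]: "m \<in> Irr" "\<theta> \<in> S" "\<xi> \<in> \<H> \<theta>" "\<rho> \<in> Obj C" "\<sigma> \<in> Obj C"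
    and X: "\<And>v. v \<in> Hom C (\<Gamma> m) \<theta> \<Longrightarrow> X v \<in> Hom C (\<Gamma> m \<odot> \<rho>) \<sigma>"
      "\<And>v w. \<lbrakk>v \<in> Hom C (\<Gamma> m) \<theta>; w \<in> Hom C (\<Gamma> m) \<theta>\<rbrakk> \<Longrightarrow> X (v + w) = X v + X w"
      "\<And>v c. v \<in> Hom C (\<Gamma> m) \<theta> \<Longrightarrow> X (scl C c v) = scl C c (X v)"
  shows "rel \<rho> \<sigma> (\<Sum>\<beta>\<in>{1..n'}. {#(m, X (c \<beta>), farr F \<theta> (\<Gamma> m) (adj C (c \<beta>)) \<xi>)#})
    (\<Sum>\<alpha>\<in>{1..n}. {#(m, X (b \<alpha>), farr F \<theta> (\<Gamma> m) (adj C (b \<alpha>)) \<xi>)#})"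
proof -
  note bH = onbD(1)[OF b] and cH = onbD(1)[OF c]
  have adj_in: "adj C v \<in> Hom C \<theta> (\<Gamma> m)" if "v \<in> Hom C (\<Gamma> m) \<theta>" for v
    using that adj_Hom by simp
  have X0: "X 0 = 0" using X(3)[of 0 0] by simp
  have X_sum: "X (\<Sum>i\<in>I. scl C (u i) (f i)) = (\<Sum>i\<in>I. scl C (u i) (X (f i)))"
    if "\<And>i. i \<in> I \<Longrightarrow> f i \<in> Hom C (\<Gamma> m) \<theta>" for u f and I :: "nat set"
    using that
  proof (induction I rule: infinite_finite_induct)
    case (insert i I)
    then have "(\<Sum>i\<in>I. scl C (u i) (f i)) \<in> Hom C (\<Gamma> m) \<theta>"
      by (intro Hom_sum Hom_scl) auto
    with insert show ?case by (simp add: X(2,3) Hom_scl)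
  qed (simp_all add: X0)
  have "\<exists>z. adj C (b \<alpha>) \<cdot> c \<beta> = scl C z (idn C (\<Gamma> m))" if "\<alpha> \<in> {1..n}" "\<beta> \<in> {1..n'}" for \<alpha> \<beta>
  proof -
    have "adj C (b \<alpha>) \<cdot> c \<beta> \<in> Hom C (\<Gamma> m) (\<Gamma> m)"
      using that bH cH adj_in by (intro cmp_in[of _ \<theta>]) simp_all
    then show ?thesis using Irr_scalar by simp
  qed
  then obtain w where w: "\<And>\<alpha> \<beta>. \<alpha> \<in> {1..n} \<Longrightarrow> \<beta> \<in> {1..n'} \<Longrightarrow> adj C (b \<alpha>) \<cdot> c \<beta> = scl C (w \<alpha> \<beta>) (idn C (\<Gamma> m))"
    by metis
  \<comment> \<open>matrix of the change of basis: \<open>w \<alpha> \<beta>\<close> for \<open>c \<beta>\<close> in terms of \<open>b\<close>, its conjugate for the converse\<close>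
  have c_eq: "c \<beta> = (\<Sum>\<alpha>\<in>{1..n}. scl C (w \<alpha> \<beta>) (b \<alpha>))" if \<beta>: "\<beta> \<in> {1..n'}" for \<beta>
  proof -
    have "b \<alpha> \<cdot> (adj C (b \<alpha>) \<cdot> c \<beta>) = scl C (w \<alpha> \<beta>) (b \<alpha>)" if "\<alpha> \<in> {1..n}" for \<alpha>
      using that w[OF that \<beta>] bH[OF that] by (simp add: cmp_scl[of "\<Gamma> m" "\<Gamma> m" \<theta>] idn_right[of "\<Gamma> m" \<theta>])
    with onbD(3)[OF b cH[OF \<beta>]] show ?thesis by simp
  qed
  have b_eq: "adj C (b \<alpha>) = (\<Sum>\<beta>\<in>{1..n'}. scl C (w \<alpha> \<beta>) (adj C (c \<beta>)))" if \<alpha>: "\<alpha> \<in> {1..n}" for \<alpha>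
  proof -
    have adj_sum: "adj C (\<Sum>i\<in>I. f i) = (\<Sum>i\<in>I. adj C (f i))"
      if "\<And>i. i \<in> I \<Longrightarrow> f i \<in> Hom C (\<Gamma> m) \<theta>" for f and I :: "nat set"
      using that
    proof (induction I rule: infinite_finite_induct)
      case (insert i I)
      then show ?case by (simp add: adj_add[of "\<Gamma> m" \<theta>] Hom_sum)
    qed (use adj_scl[of "\<Gamma> m" \<theta> 0 0] in simp_all)
    have e: "c \<beta> \<cdot> (adj C (c \<beta>) \<cdot> b \<alpha>) = scl C (cnj (w \<alpha> \<beta>)) (c \<beta>)" if \<beta>: "\<beta> \<in> {1..n'}" for \<beta>
    proof -
      have "adj C (c \<beta>) \<cdot> b \<alpha> = adj C (adj C (b \<alpha>) \<cdot> c \<beta>)"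
        using adj_cmp[of "\<Gamma> m" \<theta> "\<Gamma> m" "adj C (b \<alpha>)" "c \<beta>"] adj_adj[of "\<Gamma> m" \<theta> "b \<alpha>"] bH[OF \<alpha>] cH[OF \<beta>] adj_in
        by simp
      also have "\<dots> = scl C (cnj (w \<alpha> \<beta>)) (idn C (\<Gamma> m))"
        by (simp add: w[OF \<alpha> \<beta>] adj_scl[of "\<Gamma> m" "\<Gamma> m"] adj_idn)
      finally show ?thesis
        using cH[OF \<beta>] by (simp add: cmp_scl[of "\<Gamma> m" "\<Gamma> m" \<theta>] idn_right[of "\<Gamma> m" \<theta>])
    qed
    then have "b \<alpha> = (\<Sum>\<beta>\<in>{1..n'}. scl C (cnj (w \<alpha> \<beta>)) (c \<beta>))"
      using onbD(3)[OF c bH[OF \<alpha>]] by simp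
    then have "adj C (b \<alpha>) = (\<Sum>\<beta>\<in>{1..n'}. adj C (scl C (cnj (w \<alpha> \<beta>)) (c \<beta>)))"
      using adj_sum[of "{1..n'}" "\<lambda>\<beta>. scl C (cnj (w \<alpha> \<beta>)) (c \<beta>)"] cH by (simp add: Hom_scl)
    then show ?thesis using cH by (simp add: adj_scl[of "\<Gamma> m" \<theta>])
  qed
  let ?\<eta> = "\<lambda>\<beta>. farr F \<theta> (\<Gamma> m) (adj C (c \<beta>)) \<xi>"
  have \<eta>: "?\<eta> \<beta> \<in> \<H> (\<Gamma> m)" if "\<beta> \<in> {1..n'}" for \<beta>
    using that cH adj_in farr_in by simp
  have Xb: "X (b \<alpha>) \<in> Hom C (\<Gamma> m \<odot> \<rho>) \<sigma>" if "\<alpha> \<in> {1..n}" for \<alpha>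
    using that X(1) bH by simp
  let ?t = "\<lambda>\<alpha> \<beta>. {#(m, X (b \<alpha>), hscl (\<Gamma> m) (w \<alpha> \<beta>) (?\<eta> \<beta>))#}"
  have "rel \<rho> \<sigma> {#(m, X (c \<beta>), ?\<eta> \<beta>)#} (\<Sum>\<alpha>\<in>{1..n}. ?t \<alpha> \<beta>)" if \<beta>: "\<beta> \<in> {1..n'}" for \<beta>
  proof -
    have "X (c \<beta>) = (\<Sum>\<alpha>\<in>{1..n}. scl C (w \<alpha> \<beta>) (X (b \<alpha>)))"
      unfolding c_eq[OF \<beta>] using bH by (intro X_sum)
    then have "rel \<rho> \<sigma> {#(m, X (c \<beta>), ?\<eta> \<beta>)#} (\<Sum>\<alpha>\<in>{1..n}. {#(m, scl C (w \<alpha> \<beta>) (X (b \<alpha>)), ?\<eta> \<beta>)#})"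
      using rel_sum_left[of m "?\<eta> \<beta>" \<rho> \<sigma> "{1..n}" "\<lambda>\<alpha>. scl C (w \<alpha> \<beta>) (X (b \<alpha>))"] \<eta>[OF \<beta>] Xb
      by (simp add: Hom_scl)
    also have "rel \<rho> \<sigma> \<dots> (\<Sum>\<alpha>\<in>{1..n}. ?t \<alpha> \<beta>)"
      using \<eta>[OF \<beta>] Xb by (intro rel_sum cp_rel.scale) (simp_all add: gen_iff)
    finally show ?thesis .
  qed
  then have "rel \<rho> \<sigma> (\<Sum>\<beta>\<in>{1..n'}. {#(m, X (c \<beta>), ?\<eta> \<beta>)#}) (\<Sum>\<beta>\<in>{1..n'}. \<Sum>\<alpha>\<in>{1..n}. ?t \<alpha> \<beta>)"
    by (intro rel_sum) simp_all
  also have "\<dots> = (\<Sum>\<alpha>\<in>{1..n}. \<Sum>\<beta>\<in>{1..n'}. ?t \<alpha> \<beta>)" by (rule sum.swap)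
  also have "rel \<rho> \<sigma> \<dots> (\<Sum>\<alpha>\<in>{1..n}. {#(m, X (b \<alpha>), farr F \<theta> (\<Gamma> m) (adj C (b \<alpha>)) \<xi>)#})"
  proof (rule rel_sum)
    fix \<alpha> assume \<alpha>: "\<alpha> \<in> {1..n}"
    have "farr F \<theta> (\<Gamma> m) (adj C (b \<alpha>)) \<xi> = (\<Sum>\<beta>\<in>{1..n'}. hscl (\<Gamma> m) (w \<alpha> \<beta>) (?\<eta> \<beta>))"
      unfolding b_eq[OF \<alpha>] using cH adj_in by (intro farr_sum) simp_all
    then have "rel \<rho> \<sigma> {#(m, X (b \<alpha>), farr F \<theta> (\<Gamma> m) (adj C (b \<alpha>)) \<xi>)#} (\<Sum>\<beta>\<in>{1..n'}. ?t \<alpha> \<beta>)"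
      using \<eta> Xb[OF \<alpha>] rel_sum_right[of m "X (b \<alpha>)" \<rho> \<sigma> "{1..n'}" "\<lambda>\<beta>. hscl (\<Gamma> m) (w \<alpha> \<beta>) (?\<eta> \<beta>)"]
      by (simp add: \<H>_scl)
    then show "rel \<rho> \<sigma> (\<Sum>\<beta>\<in>{1..n'}. ?t \<alpha> \<beta>) {#(m, X (b \<alpha>), farr F \<theta> (\<Gamma> m) (adj C (b \<alpha>)) \<xi>)#}"
      by (rule rel_sym)
  qed simp_all
  finally show ?thesis .
qed

end

section \<open>Fusion sums\<close>

context crossed_product_setting
begin

lemma vb_in [simp]:
  "\<lbrakk>k \<in> Irr; l \<in> Irr; m \<in> Irr; \<alpha> \<in> {1..mlt K k l m}\<rbrakk> \<Longrightarrow> vb K k l m \<alpha> \<in> Hom C (\<Gamma> m) (\<Gamma> k \<odot> \<Gamma> l)"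
  by (rule K.vb_Hom)

lemma fusion_vec_in:
  assumes "k \<in> Irr" "l \<in> Irr" "m \<in> Irr" "\<psi> \<in> \<H> (\<Gamma> k)" "\<phi> \<in> \<H> (\<Gamma> l)" "V \<in> Hom C (\<Gamma> m) (\<Gamma> k \<odot> \<Gamma> l)"
  shows "farr F (\<Gamma> k \<odot> \<Gamma> l) (\<Gamma> m) (adj C V) (vten (\<Gamma> k) (\<Gamma> l) \<psi> \<phi>) \<in> \<H> (\<Gamma> m)"
  using assms by (intro farr_in adj_Hom) simp_all

lemma fusion_rel_termwise:
  assumes obj: "\<rho> \<in> Obj C" "\<sigma> \<in> Obj C" "k \<in> Irr" "l \<in> Irr"
    and "\<And>m V. \<lbrakk>m \<in> Irr; V \<in> Hom C (\<Gamma> m) (\<Gamma> k \<odot> \<Gamma> l)\<rbrakk> \<Longrightarrow>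
      rel \<rho> \<sigma> {#(m, X V, farr F (\<Gamma> k \<odot> \<Gamma> l) (\<Gamma> m) (adj C V) (vten (\<Gamma> k) (\<Gamma> l) \<psi> \<phi>))#} (h m V)"
  shows "rel \<rho> \<sigma> (fus k l \<psi> \<phi> X)
    (\<Sum>m\<in>{m \<in> Irr. 0 < mlt K k l m}. \<Sum>\<alpha>\<in>{1..mlt K k l m}. h m (vb K k l m \<alpha>))"
  unfolding fusion_def using assms by (intro rel_sum) auto

lemma fusion_gen:
  assumes "k \<in> Irr" "l \<in> Irr" "\<psi> \<in> \<H> (\<Gamma> k)" "\<phi> \<in> \<H> (\<Gamma> l)"
    and "\<And>m V. \<lbrakk>m \<in> Irr; V \<in> Hom C (\<Gamma> m) (\<Gamma> k \<odot> \<Gamma> l)\<rbrakk> \<Longrightarrow> X V \<in> Hom C (\<Gamma> m \<odot> \<rho>) \<sigma>"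
  shows "set_mset (fus k l \<psi> \<phi> X) \<subseteq> gen \<rho> \<sigma>"
  unfolding fusion_def using assms
  by (intro set_mset_sum_subset) (auto simp: gen_iff fusion_vec_in)

lemma fusion_cong:
  assumes "k \<in> Irr" "l \<in> Irr"
    and "\<And>m V. \<lbrakk>m \<in> Irr; V \<in> Hom C (\<Gamma> m) (\<Gamma> k \<odot> \<Gamma> l)\<rbrakk> \<Longrightarrow> X V = X' V"
  shows "fus k l \<psi> \<phi> X = fus k l \<psi> \<phi> X'"
  unfolding fusion_def using assms by (intro sum.cong HOL.refl) auto

lemma fusion_image:
  assumes "k \<in> Irr" "l \<in> Irr"
    and "\<And>m V. \<lbrakk>m \<in> Irr; V \<in> Hom C (\<Gamma> m) (\<Gamma> k \<odot> \<Gamma> l)\<rbrakk> \<Longrightarrow> h m (X V) = X' V"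
  shows "image_mset (\<lambda>(m, T, \<psi>). (m, h m T, \<psi>)) (fus k l \<psi> \<phi> X) = fus k l \<psi> \<phi> X'"
  unfolding fusion_def image_mset_sum using assms by (intro sum.cong HOL.refl) auto

lemma fusion_zero:
  assumes "k \<in> Irr" "l \<in> Irr" "\<psi> \<in> \<H> (\<Gamma> k)" "\<phi> \<in> \<H> (\<Gamma> l)" "\<rho> \<in> Obj C" "\<sigma> \<in> Obj C"
    and X: "\<And>m V. \<lbrakk>m \<in> Irr; V \<in> Hom C (\<Gamma> m) (\<Gamma> k \<odot> \<Gamma> l)\<rbrakk> \<Longrightarrow> X V = 0"
  shows "rel \<rho> \<sigma> (fus k l \<psi> \<phi> X) {#}"
proof -
  have "rel \<rho> \<sigma> (fus k l \<psi> \<phi> X)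
    (\<Sum>m\<in>{m \<in> Irr. 0 < mlt K k l m}. \<Sum>\<alpha>\<in>{1..mlt K k l m}. {#})"
    using assms by (intro fusion_rel_termwise[where h = "\<lambda>_ _. {#}"])
      (auto simp: X gen_iff fusion_vec_in intro!: cp_rel.zero)
  then show ?thesis by simp
qed

lemma fusion_add:
  assumes "k \<in> Irr" "l \<in> Irr" "\<psi> \<in> \<H> (\<Gamma> k)" "\<phi> \<in> \<H> (\<Gamma> l)" "\<rho> \<in> Obj C" "\<sigma> \<in> Obj C"
    and "\<And>m V. \<lbrakk>m \<in> Irr; V \<in> Hom C (\<Gamma> m) (\<Gamma> k \<odot> \<Gamma> l)\<rbrakk> \<Longrightarrow> X V \<in> Hom C (\<Gamma> m \<odot> \<rho>) \<sigma>"
    and "\<And>m V. \<lbrakk>m \<in> Irr; V \<in> Hom C (\<Gamma> m) (\<Gamma> k \<odot> \<Gamma> l)\<rbrakk> \<Longrightarrow> X' V \<in> Hom C (\<Gamma> m \<odot> \<rho>) \<sigma>"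
  shows "rel \<rho> \<sigma> (fus k l \<psi> \<phi> (\<lambda>V. X V + X' V)) (fus k l \<psi> \<phi> X + fus k l \<psi> \<phi> X')"
proof -
  let ?\<xi> = "\<lambda>m V. farr F (\<Gamma> k \<odot> \<Gamma> l) (\<Gamma> m) (adj C V) (vten (\<Gamma> k) (\<Gamma> l) \<psi> \<phi>)"
  have "rel \<rho> \<sigma> (fus k l \<psi> \<phi> (\<lambda>V. X V + X' V))
    (\<Sum>m\<in>{m \<in> Irr. 0 < mlt K k l m}. \<Sum>\<alpha>\<in>{1..mlt K k l m}.
      (\<lambda>m V. {#(m, X V, ?\<xi> m V), (m, X' V, ?\<xi> m V)#}) m (vb K k l m \<alpha>))"
    using assms by (intro fusion_rel_termwise) (auto simp: gen_iff fusion_vec_in intro!: cp_rel.add_left)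
  also have "\<dots> = fus k l \<psi> \<phi> X + fus k l \<psi> \<phi> X'"
    unfolding fusion_def sum.distrib[symmetric] by (simp add: add_mset_commute)
  finally show ?thesis .
qed

lemma fusion_vec:
  assumes "k \<in> Irr" "l \<in> Irr" "\<psi> \<in> \<H> (\<Gamma> k)" "\<phi> \<in> \<H> (\<Gamma> l)" "\<rho> \<in> Obj C" "\<sigma> \<in> Obj C"
    and X: "\<And>m V. \<lbrakk>m \<in> Irr; V \<in> Hom C (\<Gamma> m) (\<Gamma> k \<odot> \<Gamma> l)\<rbrakk> \<Longrightarrow> X V \<in> Hom C (\<Gamma> m \<odot> \<rho>) \<sigma>"
  shows fusion_vec_add_left: "\<psi>' \<in> \<H> (\<Gamma> k) \<Longrightarrow>
      rel \<rho> \<sigma> (fus k l (\<psi> + \<psi>') \<phi> X) (fus k l \<psi> \<phi> X + fus k l \<psi>' \<phi> X)"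
    and fusion_vec_add_right: "\<phi>' \<in> \<H> (\<Gamma> l) \<Longrightarrow>
      rel \<rho> \<sigma> (fus k l \<psi> (\<phi> + \<phi>') X) (fus k l \<psi> \<phi> X + fus k l \<psi> \<phi>' X)"
    and fusion_scale_left: "rel \<rho> \<sigma> (fus k l \<psi> \<phi> (\<lambda>V. scl C c (X V))) (fus k l (hscl (\<Gamma> k) c \<psi>) \<phi> X)"
    and fusion_scale_right: "rel \<rho> \<sigma> (fus k l \<psi> \<phi> (\<lambda>V. scl C c (X V))) (fus k l \<psi> (hscl (\<Gamma> l) c \<phi>) X)"
proof -
  note [simp] = assms(1-6)
  let ?H = "\<lambda>m. Hom C (\<Gamma> m) (\<Gamma> k \<odot> \<Gamma> l)"
  let ?f = "\<lambda>m V. farr F (\<Gamma> k \<odot> \<Gamma> l) (\<Gamma> m) (adj C V)"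
  let ?v = "vten (\<Gamma> k) (\<Gamma> l)"
  have split: "(\<Sum>m\<in>{m \<in> Irr. 0 < mlt K k l m}. \<Sum>\<alpha>\<in>{1..mlt K k l m}.
      (\<lambda>m V. {#(m, X V, ?f m V x), (m, X V, ?f m V y)#}) m (vb K k l m \<alpha>)) =
      (\<Sum>m\<in>{m \<in> Irr. 0 < mlt K k l m}. \<Sum>\<alpha>\<in>{1..mlt K k l m}. {#(m, X (vb K k l m \<alpha>), ?f m (vb K k l m \<alpha>) x)#}) +
      (\<Sum>m\<in>{m \<in> Irr. 0 < mlt K k l m}. \<Sum>\<alpha>\<in>{1..mlt K k l m}. {#(m, X (vb K k l m \<alpha>), ?f m (vb K k l m \<alpha>) y)#})"
    for x y unfolding sum.distrib[symmetric] by (simp add: add_mset_commute)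
  show "rel \<rho> \<sigma> (fus k l (\<psi> + \<psi>') \<phi> X) (fus k l \<psi> \<phi> X + fus k l \<psi>' \<phi> X)" if [simp]: "\<psi>' \<in> \<H> (\<Gamma> k)"
  proof -
    have eq: "?f m V (?v (\<psi> + \<psi>') \<phi>) = ?f m V (?v \<psi> \<phi>) + ?f m V (?v \<psi>' \<phi>)" if "m \<in> Irr" "V \<in> ?H m" for m V
      using that by (simp add: U.vtns_add farr_add_vec adj_Hom)
    show ?thesis
      unfolding fusion_def[of C S U F K k l \<psi>] fusion_def[of C S U F K k l \<psi>'] split[symmetric]
      by (intro fusion_rel_termwise) (auto simp: eq X gen_iff fusion_vec_in intro!: cp_rel.add_right)
  qed
  show "rel \<rho> \<sigma> (fus k l \<psi> (\<phi> + \<phi>') X) (fus k l \<psi> \<phi> X + fus k l \<psi> \<phi>' X)" if [simp]: "\<phi>' \<in> \<H> (\<Gamma> l)"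
  proof -
    have eq: "?f m V (?v \<psi> (\<phi> + \<phi>')) = ?f m V (?v \<psi> \<phi>) + ?f m V (?v \<psi> \<phi>')" if "m \<in> Irr" "V \<in> ?H m" for m V
      using that by (simp add: U.vtns_add farr_add_vec adj_Hom)
    show ?thesis
      unfolding fusion_def[of C S U F K k l \<psi> \<phi>] fusion_def[of C S U F K k l \<psi> \<phi>'] split[symmetric]
      by (intro fusion_rel_termwise) (auto simp: eq X gen_iff fusion_vec_in intro!: cp_rel.add_right)
  qed
  have scale: "rel \<rho> \<sigma> (fus k l \<psi> \<phi> (\<lambda>V. scl C c (X V))) (fus k l \<psi>' \<phi>' X)"
    if "?v \<psi>' \<phi>' = hscl (\<Gamma> k \<odot> \<Gamma> l) c (?v \<psi> \<phi>)" for \<psi>' \<phi>'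
  proof -
    have eq: "?f m V (?v \<psi>' \<phi>') = hscl (\<Gamma> m) c (?f m V (?v \<psi> \<phi>))" if "m \<in> Irr" "V \<in> ?H m" for m V
      unfolding \<open>?v \<psi>' \<phi>' = _\<close> using that by (simp add: farr_scl_vec adj_Hom)
    show ?thesis
      unfolding fusion_def[of C S U F K k l \<psi>' \<phi>']
      by (rule fusion_rel_termwise[where h = "\<lambda>m V. {#(m, X V, ?f m V (?v \<psi>' \<phi>'))#}"])
        (auto simp: eq X gen_iff fusion_vec_in intro!: cp_rel.scale)
  qed
  show "rel \<rho> \<sigma> (fus k l \<psi> \<phi> (\<lambda>V. scl C c (X V))) (fus k l (hscl (\<Gamma> k) c \<psi>) \<phi> X)"
    by (rule scale) (simp add: U.vtns_scl F.fobj_tns)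
  show "rel \<rho> \<sigma> (fus k l \<psi> \<phi> (\<lambda>V. scl C c (X V))) (fus k l \<psi> (hscl (\<Gamma> l) c \<phi>) X)"
    by (rule scale) (simp add: U.vtns_scl F.fobj_tns)
qed

text \<open>In both operations of the crossed product the basis vector \<open>V\<close> enters through \<open>B \<cdot> (V \<parallel> id)\<close>, where
  \<open>B\<close> is an arrow that does not involve \<open>V\<close>.\<close>

lemma kernel:
  assumes B: "B \<in> Hom C (\<theta> \<odot> \<rho>) \<sigma>" and [simp]: "\<theta> \<in> Obj C" "\<rho> \<in> Obj C" "\<sigma> \<in> Obj C" "\<mu> \<in> Obj C"
  shows kernel_Hom: "V \<in> Hom C \<mu> \<theta> \<Longrightarrow> B \<cdot> (V \<parallel> idn C \<rho>) \<in> Hom C (\<mu> \<odot> \<rho>) \<sigma>"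
    and kernel_add: "\<lbrakk>V \<in> Hom C \<mu> \<theta>; W \<in> Hom C \<mu> \<theta>\<rbrakk> \<Longrightarrow>
      B \<cdot> ((V + W) \<parallel> idn C \<rho>) = B \<cdot> (V \<parallel> idn C \<rho>) + B \<cdot> (W \<parallel> idn C \<rho>)"
    and kernel_scl: "V \<in> Hom C \<mu> \<theta> \<Longrightarrow> B \<cdot> (scl C c V \<parallel> idn C \<rho>) = scl C c (B \<cdot> (V \<parallel> idn C \<rho>))"
proof -
  have p: "V \<parallel> idn C \<rho> \<in> Hom C (\<mu> \<odot> \<rho>) (\<theta> \<odot> \<rho>)" if "V \<in> Hom C \<mu> \<theta>" for V
    using that by (simp add: par_in)
  show "V \<in> Hom C \<mu> \<theta> \<Longrightarrow> B \<cdot> (V \<parallel> idn C \<rho>) \<in> Hom C (\<mu> \<odot> \<rho>) \<sigma>"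
    by (rule cmp_in[OF B p]) simp_all
  show "\<lbrakk>V \<in> Hom C \<mu> \<theta>; W \<in> Hom C \<mu> \<theta>\<rbrakk> \<Longrightarrow>
      B \<cdot> ((V + W) \<parallel> idn C \<rho>) = B \<cdot> (V \<parallel> idn C \<rho>) + B \<cdot> (W \<parallel> idn C \<rho>)"
    using p B by (simp add: par_add[of \<mu> \<theta> \<rho> \<rho>] cmp_add[of "\<mu> \<odot> \<rho>" "\<theta> \<odot> \<rho>" \<sigma>])
  show "V \<in> Hom C \<mu> \<theta> \<Longrightarrow> B \<cdot> (scl C c V \<parallel> idn C \<rho>) = scl C c (B \<cdot> (V \<parallel> idn C \<rho>))"
    using p B by (simp add: par_scl[of \<mu> \<theta> \<rho> \<rho>] cmp_scl[of "\<mu> \<odot> \<rho>" "\<theta> \<odot> \<rho>" \<sigma>])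
qed

text \<open>If \<open>\<Gamma> k \<odot> \<Gamma> l\<close> is itself the chosen irreducible \<open>\<Gamma> j\<close>, only \<open>m = j\<close> contributes, and the basis there may
  be replaced by the identity. This applies when \<open>k\<close> or \<open>l\<close> is the class of the unit object.\<close>

lemma fusion_irreducible:
  assumes kl [simp]: "k \<in> Irr" "l \<in> Irr" "j \<in> Irr" and j: "\<Gamma> k \<odot> \<Gamma> l = \<Gamma> j"
    and [simp]: "\<rho> \<in> Obj C" "\<sigma> \<in> Obj C" and B: "B \<in> Hom C (\<Gamma> j \<odot> \<rho>) \<sigma>"
    and [simp]: "\<psi> \<in> \<H> (\<Gamma> k)" "\<phi> \<in> \<H> (\<Gamma> l)"
  shows "rel \<rho> \<sigma> (fus k l \<psi> \<phi> (\<lambda>V. B \<cdot> (V \<parallel> idn C \<rho>))) {#(j, B, vten (\<Gamma> k) (\<Gamma> l) \<psi> \<phi>)#}"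
proof -
  have onb: "onb m (\<Gamma> j) (mlt K k l m) (vb K k l m)" if "m \<in> Irr" for m
    using vb_onb[of k l m] that j by simp
  have idb: "onb j (\<Gamma> j) 1 (\<lambda>_. idn C (\<Gamma> j))"
    unfolding onb_def by (auto simp: adj_idn idn_left[of "\<Gamma> j" "\<Gamma> j"])
  have "m = j" if m: "m \<in> Irr" "0 < mlt K k l m" for m
    using Irr_isometry_eq[of m j "vb K k l m 1"] onbD(1,2)[OF onb[OF m(1)], of 1] m by simp
  moreover have "0 < mlt K k l j"
    using onb_pos_iff[OF onb[of j]] onb_pos_iff[OF idb] by simp
  ultimately have idx: "{m \<in> Irr. 0 < mlt K k l m} = {j}" by auto
  have xi: "vten (\<Gamma> k) (\<Gamma> l) \<psi> \<phi> \<in> \<H> (\<Gamma> j)" using vten_in[of "\<Gamma> k" "\<Gamma> l" \<psi> \<phi>] j by simp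
  have "fus k l \<psi> \<phi> (\<lambda>V. B \<cdot> (V \<parallel> idn C \<rho>)) = (\<Sum>\<alpha>\<in>{1..mlt K k l j}. {#(j, B \<cdot> (vb K k l j \<alpha> \<parallel> idn C \<rho>),
      farr F (\<Gamma> j) (\<Gamma> j) (adj C (vb K k l j \<alpha>)) (vten (\<Gamma> k) (\<Gamma> l) \<psi> \<phi>))#})"
    unfolding fusion_def idx j by simp
  also have "rel \<rho> \<sigma> \<dots> (\<Sum>\<alpha>\<in>{1..1::nat}. {#(j, B \<cdot> (idn C (\<Gamma> j) \<parallel> idn C \<rho>),
      farr F (\<Gamma> j) (\<Gamma> j) (adj C (idn C (\<Gamma> j))) (vten (\<Gamma> k) (\<Gamma> l) \<psi> \<phi>))#})"
    using xi by (intro basis_change[OF idb onb])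
      (simp_all add: kernel_Hom[OF B] kernel_add[OF B, where \<mu> = "\<Gamma> j"] kernel_scl[OF B, where \<mu> = "\<Gamma> j"])
  also have "\<dots> = {#(j, B, vten (\<Gamma> k) (\<Gamma> l) \<psi> \<phi>)#}"
    using B xi by (simp add: par_idn adj_idn F.farr_idn idn_right[of "\<Gamma> j \<odot> \<rho>" \<sigma>])
  finally show ?thesis .
qed

lemma eps_adj_S: "\<lbrakk>\<rho> \<in> S; \<sigma> \<in> S\<rbrakk> \<Longrightarrow> adj C (\<epsilon> \<rho> \<sigma>) = \<epsilon> \<sigma> \<rho>"
proof -
  assume S: "\<rho> \<in> S" "\<sigma> \<in> S"
  note [simp] = S_Obj[OF S(1)] S_Obj[OF S(2)]
  have a: "adj C (\<epsilon> \<rho> \<sigma>) \<in> Hom C (\<sigma> \<odot> \<rho>) (\<rho> \<odot> \<sigma>)"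
    by (intro adj_Hom eps_Hom) simp_all
  have "adj C (\<epsilon> \<rho> \<sigma>) = (\<epsilon> \<sigma> \<rho> \<cdot> \<epsilon> \<rho> \<sigma>) \<cdot> adj C (\<epsilon> \<rho> \<sigma>)"
    using S.symmetric[OF S] a idn_left[of "\<sigma> \<odot> \<rho>" "\<rho> \<odot> \<sigma>"] by simp
  also have "\<dots> = \<epsilon> \<sigma> \<rho> \<cdot> (\<epsilon> \<rho> \<sigma> \<cdot> adj C (\<epsilon> \<rho> \<sigma>))"
    using a by (intro cmp_assoc[of "\<sigma> \<odot> \<rho>" "\<rho> \<odot> \<sigma>" "\<sigma> \<odot> \<rho>" "\<rho> \<odot> \<sigma>"]) (simp_all add: eps_Hom)
  also have "\<dots> = \<epsilon> \<sigma> \<rho>"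
    using eps_unitary(2)[of \<rho> \<sigma>] idn_right[of "\<sigma> \<odot> \<rho>" "\<rho> \<odot> \<sigma>"] eps_Hom by simp
  finally show ?thesis .
qed

text \<open>The unitary \<open>\<epsilon>(\<gamma>\<^sub>k, \<gamma>\<^sub>l)\<close> carries the chosen basis of \<open>Hom (\<gamma>\<^sub>m) (\<gamma>\<^sub>k \<odot> \<gamma>\<^sub>l)\<close> to an orthonormal basis of
  \<open>Hom (\<gamma>\<^sub>m) (\<gamma>\<^sub>l \<odot> \<gamma>\<^sub>k)\<close>, which may replace the chosen one; \<open>F\<close> turns \<open>\<epsilon>(\<gamma>\<^sub>k, \<gamma>\<^sub>l)\<close> into the flip. So the two
  vectors are exchanged at the price of a braiding in \<open>B\<close>.\<close>

lemma fusion_flip: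
  assumes kl [simp]: "k \<in> Irr" "l \<in> Irr" and [simp]: "\<rho> \<in> Obj C" "\<sigma> \<in> Obj C"
    and B: "B \<in> Hom C ((\<Gamma> l \<odot> \<Gamma> k) \<odot> \<rho>) \<sigma>"
    and [simp]: "\<psi> \<in> \<H> (\<Gamma> k)" "\<phi> \<in> \<H> (\<Gamma> l)"
  shows "rel \<rho> \<sigma> (fus l k \<phi> \<psi> (\<lambda>V. B \<cdot> (V \<parallel> idn C \<rho>)))
    (fus k l \<psi> \<phi> (\<lambda>V. (B \<cdot> (\<epsilon> (\<Gamma> k) (\<Gamma> l) \<parallel> idn C \<rho>)) \<cdot> (V \<parallel> idn C \<rho>)))"
proof -
  let ?kl = "\<Gamma> k \<odot> \<Gamma> l" and ?lk = "\<Gamma> l \<odot> \<Gamma> k" and ?e = "\<epsilon> (\<Gamma> k) (\<Gamma> l)" and ?e' = "\<epsilon> (\<Gamma> l) (\<Gamma> k)"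
  have e [simp]: "?e \<in> Hom C ?kl ?lk" "?e' \<in> Hom C ?lk ?kl" by (simp_all add: eps_Hom)
  have e_e' [simp]: "?e \<cdot> ?e' = idn C ?lk" "?e' \<cdot> ?e = idn C ?kl" using S.symmetric by simp_all
  have onb: "onb m ?lk (mlt K k l m) (\<lambda>\<alpha>. ?e \<cdot> vb K k l m \<alpha>)" if m [simp]: "m \<in> Irr" for m
    unfolding onb_def
  proof (intro conjI ballI)
    fix \<alpha> assume \<alpha> [simp]: "\<alpha> \<in> {1..mlt K k l m}"
    let ?b = "vb K k l m \<alpha>"
    have b [simp]: "?b \<in> Hom C (\<Gamma> m) ?kl" "adj C ?b \<in> Hom C ?kl (\<Gamma> m)" using \<alpha> by (simp_all add: adj_Hom)
    show eb: "?e \<cdot> ?b \<in> Hom C (\<Gamma> m) ?lk" by (rule cmp_in[OF e(1) b(1)]) simp_all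
    have "adj C (?e \<cdot> ?b) \<cdot> (?e \<cdot> ?b) = (adj C ?b \<cdot> ?e') \<cdot> (?e \<cdot> ?b)"
      by (subst adj_cmp[of "\<Gamma> m" ?kl ?lk]) (simp_all add: eps_adj_S)
    also have "\<dots> = adj C ?b \<cdot> (?e' \<cdot> (?e \<cdot> ?b))"
      using eb by (intro cmp_assoc[of "\<Gamma> m" ?lk ?kl "\<Gamma> m"]) simp_all
    also have "?e' \<cdot> (?e \<cdot> ?b) = (?e' \<cdot> ?e) \<cdot> ?b"
      by (rule cmp_assoc[of "\<Gamma> m" ?kl ?lk ?kl, symmetric]) simp_all
    also have "\<dots> = ?b" using idn_left[of "\<Gamma> m" ?kl ?b] by simp
    finally show "adj C (?e \<cdot> ?b) \<cdot> (?e \<cdot> ?b) = idn C (\<Gamma> m)"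
      using onbD(2)[OF vb_onb[OF kl m] \<alpha>] by simp
  next
    fix v assume v [simp]: "v \<in> Hom C (\<Gamma> m) ?lk"
    let ?b = "vb K k l m"
    have ev [simp]: "?e' \<cdot> v \<in> Hom C (\<Gamma> m) ?kl" by (rule cmp_in[OF e(2) v]) simp_all
    have "v = (?e \<cdot> ?e') \<cdot> v" using idn_left[of "\<Gamma> m" ?lk v] by simp
    also have "\<dots> = ?e \<cdot> (?e' \<cdot> v)" by (rule cmp_assoc[of "\<Gamma> m" ?lk ?kl ?lk]) simp_all
    also have "?e' \<cdot> v = (\<Sum>\<alpha>\<in>{1..mlt K k l m}. ?b \<alpha> \<cdot> (adj C (?b \<alpha>) \<cdot> (?e' \<cdot> v)))"
      by (rule onbD(3)[OF vb_onb]) simp_all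
    also have "?e \<cdot> \<dots> = (\<Sum>\<alpha>\<in>{1..mlt K k l m}. ?e \<cdot> (?b \<alpha> \<cdot> (adj C (?b \<alpha>) \<cdot> (?e' \<cdot> v))))"
    proof (rule cmp_sum_right[of "\<Gamma> m" ?kl ?lk])
      fix \<alpha> assume \<alpha>: "\<alpha> \<in> {1..mlt K k l m}"
      have x: "adj C (?b \<alpha>) \<cdot> (?e' \<cdot> v) \<in> Hom C (\<Gamma> m) (\<Gamma> m)"
        by (rule cmp_in[of _ ?kl]) (use \<alpha> in \<open>simp_all add: adj_Hom\<close>)
      show "?b \<alpha> \<cdot> (adj C (?b \<alpha>) \<cdot> (?e' \<cdot> v)) \<in> Hom C (\<Gamma> m) ?kl"
        by (rule cmp_in[OF vb_in x]) (use \<alpha> in simp_all)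
    qed simp_all
    also have "\<dots> = (\<Sum>\<alpha>\<in>{1..mlt K k l m}. (?e \<cdot> ?b \<alpha>) \<cdot> (adj C (?e \<cdot> ?b \<alpha>) \<cdot> v))"
    proof (intro sum.cong HOL.refl)
      fix \<alpha> assume \<alpha> [simp]: "\<alpha> \<in> {1..mlt K k l m}"
      have b [simp]: "?b \<alpha> \<in> Hom C (\<Gamma> m) ?kl" "adj C (?b \<alpha>) \<in> Hom C ?kl (\<Gamma> m)" using \<alpha> by (simp_all add: adj_Hom)
      have "adj C (?b \<alpha>) \<cdot> (?e' \<cdot> v) = (adj C (?b \<alpha>) \<cdot> ?e') \<cdot> v"
        by (rule cmp_assoc[of "\<Gamma> m" ?lk ?kl "\<Gamma> m", symmetric]) simp_all
      also have "\<dots> = adj C (?e \<cdot> ?b \<alpha>) \<cdot> v"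
        by (subst adj_cmp[of "\<Gamma> m" ?kl ?lk]) (simp_all add: eps_adj_S)
      finally have 1: "adj C (?b \<alpha>) \<cdot> (?e' \<cdot> v) = adj C (?e \<cdot> ?b \<alpha>) \<cdot> v" .
      have 2: "adj C (?b \<alpha>) \<cdot> (?e' \<cdot> v) \<in> Hom C (\<Gamma> m) (\<Gamma> m)"
        by (rule cmp_in[of _ ?kl]) simp_all
      show "?e \<cdot> (?b \<alpha> \<cdot> (adj C (?b \<alpha>) \<cdot> (?e' \<cdot> v))) = (?e \<cdot> ?b \<alpha>) \<cdot> (adj C (?e \<cdot> ?b \<alpha>) \<cdot> v)"
        unfolding 1[symmetric]
        by (rule cmp_assoc[of "\<Gamma> m" "\<Gamma> m" ?kl ?lk, symmetric]) (simp_all add: 2)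
    qed
    finally show "v = (\<Sum>\<alpha>\<in>{1..mlt K k l m}. (?e \<cdot> ?b \<alpha>) \<cdot> (adj C (?e \<cdot> ?b \<alpha>) \<cdot> v))" .
  qed
  have idx: "{m \<in> Irr. 0 < mlt K l k m} = {m \<in> Irr. 0 < mlt K k l m}"
    using onb_pos_iff[OF vb_onb[of l k]] onb_pos_iff[OF onb] by auto
  have inner: "rel \<rho> \<sigma>
      (\<Sum>\<alpha>\<in>{1..mlt K l k m}. {#(m, B \<cdot> (vb K l k m \<alpha> \<parallel> idn C \<rho>),
        farr F ?lk (\<Gamma> m) (adj C (vb K l k m \<alpha>)) (vten (\<Gamma> l) (\<Gamma> k) \<phi> \<psi>))#})
      (\<Sum>\<alpha>\<in>{1..mlt K k l m}. {#(m, (B \<cdot> (?e \<parallel> idn C \<rho>)) \<cdot> (vb K k l m \<alpha> \<parallel> idn C \<rho>),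
        farr F ?kl (\<Gamma> m) (adj C (vb K k l m \<alpha>)) (vten (\<Gamma> k) (\<Gamma> l) \<psi> \<phi>))#})"
    if m [simp]: "m \<in> Irr" for m
  proof -
    have "rel \<rho> \<sigma>
        (\<Sum>\<alpha>\<in>{1..mlt K l k m}. {#(m, B \<cdot> (vb K l k m \<alpha> \<parallel> idn C \<rho>),
          farr F ?lk (\<Gamma> m) (adj C (vb K l k m \<alpha>)) (vten (\<Gamma> l) (\<Gamma> k) \<phi> \<psi>))#})
        (\<Sum>\<alpha>\<in>{1..mlt K k l m}. {#(m, B \<cdot> ((?e \<cdot> vb K k l m \<alpha>) \<parallel> idn C \<rho>),
          farr F ?lk (\<Gamma> m) (adj C (?e \<cdot> vb K k l m \<alpha>)) (vten (\<Gamma> l) (\<Gamma> k) \<phi> \<psi>))#})"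
      by (intro basis_change[OF onb vb_onb])
        (simp_all add: kernel_Hom[OF B] kernel_add[OF B, where \<mu> = "\<Gamma> m"] kernel_scl[OF B, where \<mu> = "\<Gamma> m"])
    also have "\<dots> = (\<Sum>\<alpha>\<in>{1..mlt K k l m}. {#(m, (B \<cdot> (?e \<parallel> idn C \<rho>)) \<cdot> (vb K k l m \<alpha> \<parallel> idn C \<rho>),
        farr F ?kl (\<Gamma> m) (adj C (vb K k l m \<alpha>)) (vten (\<Gamma> k) (\<Gamma> l) \<psi> \<phi>))#})"
    proof (intro sum.cong HOL.refl)
      fix \<alpha> assume \<alpha>: "\<alpha> \<in> {1..mlt K k l m}"
      let ?b = "vb K k l m \<alpha>"
      have b [simp]: "?b \<in> Hom C (\<Gamma> m) ?kl" "adj C ?b \<in> Hom C ?kl (\<Gamma> m)" using \<alpha> by (simp_all add: adj_Hom)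
      have "(?e \<cdot> ?b) \<parallel> idn C \<rho> = (?e \<parallel> idn C \<rho>) \<cdot> (?b \<parallel> idn C \<rho>)"
        using interchange[of "\<Gamma> m" ?kl ?lk \<rho> \<rho> \<rho> ?e ?b "idn C \<rho>" "idn C \<rho>"] by (simp add: idn_left[of \<rho> \<rho>])
      moreover have "?e \<parallel> idn C \<rho> \<in> Hom C (?kl \<odot> \<rho>) (?lk \<odot> \<rho>)" "?b \<parallel> idn C \<rho> \<in> Hom C (\<Gamma> m \<odot> \<rho>) (?kl \<odot> \<rho>)"
        by (simp_all add: par_in)
      ultimately have 1: "B \<cdot> ((?e \<cdot> ?b) \<parallel> idn C \<rho>) = (B \<cdot> (?e \<parallel> idn C \<rho>)) \<cdot> (?b \<parallel> idn C \<rho>)"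
        using B cmp_assoc[of "\<Gamma> m \<odot> \<rho>" "?kl \<odot> \<rho>" "?lk \<odot> \<rho>" \<sigma>] by simp
      have "adj C (?e \<cdot> ?b) = adj C ?b \<cdot> ?e'"
        by (subst adj_cmp[of "\<Gamma> m" ?kl ?lk]) (simp_all add: eps_adj_S)
      then have "farr F ?lk (\<Gamma> m) (adj C (?e \<cdot> ?b)) (vten (\<Gamma> l) (\<Gamma> k) \<phi> \<psi>) =
          farr F ?kl (\<Gamma> m) (adj C ?b) (vten (\<Gamma> k) (\<Gamma> l) \<psi> \<phi>)"
        using F.farr_cmp[of ?lk ?kl "\<Gamma> m" "adj C ?b" ?e' "vten (\<Gamma> l) (\<Gamma> k) \<phi> \<psi>"] F.farr_flip[of "\<Gamma> l" "\<Gamma> k" \<phi> \<psi>]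
        by simp
      with 1 show "{#(m, B \<cdot> ((?e \<cdot> ?b) \<parallel> idn C \<rho>), farr F ?lk (\<Gamma> m) (adj C (?e \<cdot> ?b)) (vten (\<Gamma> l) (\<Gamma> k) \<phi> \<psi>))#} =
          {#(m, (B \<cdot> (?e \<parallel> idn C \<rho>)) \<cdot> (?b \<parallel> idn C \<rho>), farr F ?kl (\<Gamma> m) (adj C ?b) (vten (\<Gamma> k) (\<Gamma> l) \<psi> \<phi>))#}"
        by simp
    qed
    finally show ?thesis .
  qed
  show ?thesis
    unfolding fusion_def idx by (rule rel_sum) (simp_all only: inner mem_Collect_eq assms(3,4))
qed

end

section \<open>Well-definedness of the operations\<close>

lemma sum_mset_singletons: "(\<Sum>x\<in>#M. {#h x#}) = image_mset h M"
  by (induction M) auto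

lemma sum_mset_cong: "(\<And>x. x \<in># M \<Longrightarrow> f x = g x) \<Longrightarrow> (\<Sum>x\<in>#M. f x) = (\<Sum>x\<in>#M. g x)"
  by (induction M) auto

context crossed_product_setting
begin

lemma kernel_left:
  assumes V: "V \<in> Hom C \<mu> \<theta>" and [simp]: "\<theta> \<in> Obj C" "\<rho> \<in> Obj C" "\<sigma> \<in> Obj C" "\<mu> \<in> Obj C"
  shows kernel_add_left: "\<lbrakk>B \<in> Hom C (\<theta> \<odot> \<rho>) \<sigma>; B' \<in> Hom C (\<theta> \<odot> \<rho>) \<sigma>\<rbrakk> \<Longrightarrow>
      (B + B') \<cdot> (V \<parallel> idn C \<rho>) = B \<cdot> (V \<parallel> idn C \<rho>) + B' \<cdot> (V \<parallel> idn C \<rho>)"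
    and kernel_scl_left: "B \<in> Hom C (\<theta> \<odot> \<rho>) \<sigma> \<Longrightarrow>
      scl C c B \<cdot> (V \<parallel> idn C \<rho>) = scl C c (B \<cdot> (V \<parallel> idn C \<rho>))"
    and kernel_zero_left: "0 \<cdot> (V \<parallel> idn C \<rho>) = 0"
proof -
  have p: "V \<parallel> idn C \<rho> \<in> Hom C (\<mu> \<odot> \<rho>) (\<theta> \<odot> \<rho>)"
    using V by (simp add: par_in)
  show "\<lbrakk>B \<in> Hom C (\<theta> \<odot> \<rho>) \<sigma>; B' \<in> Hom C (\<theta> \<odot> \<rho>) \<sigma>\<rbrakk> \<Longrightarrow>
      (B + B') \<cdot> (V \<parallel> idn C \<rho>) = B \<cdot> (V \<parallel> idn C \<rho>) + B' \<cdot> (V \<parallel> idn C \<rho>)"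
    by (rule cmp_add(1)[OF _ _ _ _ _ p]) simp_all
  show "B \<in> Hom C (\<theta> \<odot> \<rho>) \<sigma> \<Longrightarrow> scl C c B \<cdot> (V \<parallel> idn C \<rho>) = scl C c (B \<cdot> (V \<parallel> idn C \<rho>))"
    by (rule cmp_scl(1)[OF _ _ _ _ p]) simp_all
  show "0 \<cdot> (V \<parallel> idn C \<rho>) = 0"
    by (rule cmp_zero(1)[where \<tau> = \<sigma>, OF _ _ _ p]) simp_all
qed

text \<open>Compatibility with the generating relations of \<open>rel\<close>: the condition for the additive extension of
  \<open>f\<close> from generators to formal sums to descend to classes.\<close>

definition gen_linear where
  "gen_linear \<rho> \<sigma> \<rho>' \<sigma>' f \<longleftrightarrow>
     (\<forall>x\<in>gen \<rho> \<sigma>. set_mset (f x) \<subseteq> gen \<rho>' \<sigma>') \<and>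
     (\<forall>k \<psi>. (k, 0, \<psi>) \<in> gen \<rho> \<sigma> \<longrightarrow> rel \<rho>' \<sigma>' (f (k, 0, \<psi>)) {#}) \<and>
     (\<forall>k T T' \<psi>. (k, T, \<psi>) \<in> gen \<rho> \<sigma> \<longrightarrow> (k, T', \<psi>) \<in> gen \<rho> \<sigma> \<longrightarrow>
        rel \<rho>' \<sigma>' (f (k, T + T', \<psi>)) (f (k, T, \<psi>) + f (k, T', \<psi>))) \<and>
     (\<forall>k T \<psi> \<psi>'. (k, T, \<psi>) \<in> gen \<rho> \<sigma> \<longrightarrow> (k, T, \<psi>') \<in> gen \<rho> \<sigma> \<longrightarrow>
        rel \<rho>' \<sigma>' (f (k, T, \<psi> + \<psi>')) (f (k, T, \<psi>) + f (k, T, \<psi>'))) \<and>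
     (\<forall>k T \<psi> c. (k, T, \<psi>) \<in> gen \<rho> \<sigma> \<longrightarrow>
        rel \<rho>' \<sigma>' (f (k, scl C c T, \<psi>)) (f (k, T, hscl (\<Gamma> k) c \<psi>)))"

lemma gen_linear_rel:
  assumes f: "gen_linear \<rho> \<sigma> \<rho>' \<sigma>' f" and "rel \<rho> \<sigma> M N" and obj: "\<rho>' \<in> Obj C" "\<sigma>' \<in> Obj C"
  shows "rel \<rho>' \<sigma>' (\<Sum>x\<in>#M. f x) (\<Sum>x\<in>#N. f x)"
  using assms(2)
proof induction
  case (refl M)
  then show ?case using f unfolding gen_linear_def by (intro rel_refl set_mset_sum_mset_subset) blast
next
  case (sym M N)
  then show ?case by (blast intro: rel_sym)
next
  case (trans M N P)
  then show ?case by (blast intro: rel_trans)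
next
  case (plus M N P)
  have "rel \<rho>' \<sigma>' (\<Sum>x\<in>#P. f x) (\<Sum>x\<in>#P. f x)"
    using f plus.hyps(2) unfolding gen_linear_def by (intro rel_refl set_mset_sum_mset_subset) blast
  with plus.IH show ?case by (simp add: rel_add obj)
qed (use f in \<open>simp_all add: gen_linear_def\<close>)

text \<open>\<open>A k l T T'\<close> is the arrow \<open>B\<close> above in the product of \<open>T \<otimes> \<psi>\<close> and \<open>T' \<otimes> \<phi>\<close>. Composition and tensor
  product of arrows differ in this kernel only.\<close>

definition bilinear_kernel where
  "bilinear_kernel \<rho>1 \<sigma>1 \<rho>2 \<sigma>2 \<rho> \<sigma> A \<longleftrightarrow> (\<forall>k\<in>Irr. \<forall>l\<in>Irr.
     \<forall>T\<in>Hom C (\<Gamma> k \<odot> \<rho>1) \<sigma>1. \<forall>T'\<in>Hom C (\<Gamma> l \<odot> \<rho>2) \<sigma>2.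
       A k l T T' \<in> Hom C ((\<Gamma> k \<odot> \<Gamma> l) \<odot> \<rho>) \<sigma> \<and>
       (\<forall>Q\<in>Hom C (\<Gamma> k \<odot> \<rho>1) \<sigma>1. A k l (T + Q) T' = A k l T T' + A k l Q T') \<and>
       (\<forall>Q\<in>Hom C (\<Gamma> l \<odot> \<rho>2) \<sigma>2. A k l T (T' + Q) = A k l T T' + A k l T Q) \<and>
       (\<forall>c. A k l (scl C c T) T' = scl C c (A k l T T') \<and> A k l T (scl C c T') = scl C c (A k l T T')))"

definition fprod where
  "fprod \<rho> A = (\<lambda>(k, T, \<psi>) (l, T', \<phi>). fus k l \<psi> \<phi> (\<lambda>V. A k l T T' \<cdot> (V \<parallel> idn C \<rho>)))"

lemma bilinear_kernelD:
  assumes "bilinear_kernel \<rho>1 \<sigma>1 \<rho>2 \<sigma>2 \<rho> \<sigma> A" "k \<in> Irr" "l \<in> Irr"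
    "T \<in> Hom C (\<Gamma> k \<odot> \<rho>1) \<sigma>1" "T' \<in> Hom C (\<Gamma> l \<odot> \<rho>2) \<sigma>2"
  shows "A k l T T' \<in> Hom C ((\<Gamma> k \<odot> \<Gamma> l) \<odot> \<rho>) \<sigma>"
    and "Q \<in> Hom C (\<Gamma> k \<odot> \<rho>1) \<sigma>1 \<Longrightarrow> A k l (T + Q) T' = A k l T T' + A k l Q T'"
    and "Q' \<in> Hom C (\<Gamma> l \<odot> \<rho>2) \<sigma>2 \<Longrightarrow> A k l T (T' + Q') = A k l T T' + A k l T Q'"
    and "A k l (scl C c T) T' = scl C c (A k l T T')"
    and "A k l T (scl C c T') = scl C c (A k l T T')"
  using assms unfolding bilinear_kernel_def by blast+

context
  fixes \<rho>1 \<sigma>1 \<rho>2 \<sigma>2 \<rho> \<sigma> A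
  assumes A: "bilinear_kernel \<rho>1 \<sigma>1 \<rho>2 \<sigma>2 \<rho> \<sigma> A"
    and obj: "\<rho>1 \<in> Obj C" "\<sigma>1 \<in> Obj C" "\<rho>2 \<in> Obj C" "\<sigma>2 \<in> Obj C" "\<rho> \<in> Obj C" "\<sigma> \<in> Obj C"
begin

lemma fprod_gen:
  assumes "x \<in> gen \<rho>1 \<sigma>1" "y \<in> gen \<rho>2 \<sigma>2"
  shows "set_mset (fprod \<rho> A x y) \<subseteq> gen \<rho> \<sigma>"
proof -
  obtain k T \<psi> l T' \<phi> where xy: "x = (k, T, \<psi>)" "y = (l, T', \<phi>)" by (cases x, cases y)
  have [simp]: "k \<in> Irr" "T \<in> Hom C (\<Gamma> k \<odot> \<rho>1) \<sigma>1" "\<psi> \<in> \<H> (\<Gamma> k)"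
    "l \<in> Irr" "T' \<in> Hom C (\<Gamma> l \<odot> \<rho>2) \<sigma>2" "\<phi> \<in> \<H> (\<Gamma> l)"
    using assms by (simp_all add: xy gen_iff)
  have B: "A k l T T' \<in> Hom C ((\<Gamma> k \<odot> \<Gamma> l) \<odot> \<rho>) \<sigma>"
    by (rule bilinear_kernelD(1)[OF A]) simp_all
  have "set_mset (fus k l \<psi> \<phi> (\<lambda>V. A k l T T' \<cdot> (V \<parallel> idn C \<rho>))) \<subseteq> gen \<rho> \<sigma>"
    by (rule fusion_gen) (simp_all add: kernel_Hom[OF B] obj)
  then show ?thesis by (simp add: fprod_def xy)
qed

lemma fprod_linear_left:
  assumes y: "y \<in> gen \<rho>2 \<sigma>2"
  shows "gen_linear \<rho>1 \<sigma>1 \<rho> \<sigma> (\<lambda>x. fprod \<rho> A x y)"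
proof -
  obtain l T' \<phi> where y_eq: "y = (l, T', \<phi>)" by (cases y)
  note [simp] = obj
  have [simp]: "l \<in> Irr" "T' \<in> Hom C (\<Gamma> l \<odot> \<rho>2) \<sigma>2" "\<phi> \<in> \<H> (\<Gamma> l)"
    using y by (simp_all add: y_eq gen_iff)
  have AH [simp]: "A k l T T' \<in> Hom C ((\<Gamma> k \<odot> \<Gamma> l) \<odot> \<rho>) \<sigma>" if "k \<in> Irr" "T \<in> Hom C (\<Gamma> k \<odot> \<rho>1) \<sigma>1" for k T
    using that bilinear_kernelD(1)[OF A] by simp
  have ker [simp]: "A k l T T' \<cdot> (V \<parallel> idn C \<rho>) \<in> Hom C (\<Gamma> m \<odot> \<rho>) \<sigma>"
    if "k \<in> Irr" "T \<in> Hom C (\<Gamma> k \<odot> \<rho>1) \<sigma>1" "m \<in> Irr" "V \<in> Hom C (\<Gamma> m) (\<Gamma> k \<odot> \<Gamma> l)" for k T m V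
    using that by (intro kernel_Hom[of _ "\<Gamma> k \<odot> \<Gamma> l"]) simp_all
  have V [simp]: "V \<parallel> idn C \<rho> \<in> Hom C (\<Gamma> m \<odot> \<rho>) ((\<Gamma> k \<odot> \<Gamma> l) \<odot> \<rho>)"
    if "k \<in> Irr" "m \<in> Irr" "V \<in> Hom C (\<Gamma> m) (\<Gamma> k \<odot> \<Gamma> l)" for k m V
    using that by (simp add: par_in)
  have add: "rel \<rho> \<sigma> (fprod \<rho> A (k, T + Q, \<psi>) y) (fprod \<rho> A (k, T, \<psi>) y + fprod \<rho> A (k, Q, \<psi>) y)"
    if "(k, T, \<psi>) \<in> gen \<rho>1 \<sigma>1" "(k, Q, \<psi>) \<in> gen \<rho>1 \<sigma>1" for k T Q \<psi>
  proof -
    have [simp]: "k \<in> Irr" "T \<in> Hom C (\<Gamma> k \<odot> \<rho>1) \<sigma>1" "Q \<in> Hom C (\<Gamma> k \<odot> \<rho>1) \<sigma>1" "\<psi> \<in> \<H> (\<Gamma> k)"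
      using that by (simp_all add: gen_iff)
    have eq: "fus k l \<psi> \<phi> (\<lambda>V. A k l (T + Q) T' \<cdot> (V \<parallel> idn C \<rho>)) =
        fus k l \<psi> \<phi> (\<lambda>V. A k l T T' \<cdot> (V \<parallel> idn C \<rho>) + A k l Q T' \<cdot> (V \<parallel> idn C \<rho>))"
    proof (rule fusion_cong)
      fix m V assume "m \<in> Irr" "V \<in> Hom C (\<Gamma> m) (\<Gamma> k \<odot> \<Gamma> l)"
      then show "A k l (T + Q) T' \<cdot> (V \<parallel> idn C \<rho>) = A k l T T' \<cdot> (V \<parallel> idn C \<rho>) + A k l Q T' \<cdot> (V \<parallel> idn C \<rho>)"
        by (simp add: bilinear_kernelD(2)[OF A] kernel_add_left[of V "\<Gamma> m" "\<Gamma> k \<odot> \<Gamma> l" \<rho> \<sigma>])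
    qed simp_all
    have r: "rel \<rho> \<sigma>
        (fus k l \<psi> \<phi> (\<lambda>V. A k l T T' \<cdot> (V \<parallel> idn C \<rho>) + A k l Q T' \<cdot> (V \<parallel> idn C \<rho>)))
        (fus k l \<psi> \<phi> (\<lambda>V. A k l T T' \<cdot> (V \<parallel> idn C \<rho>)) + fus k l \<psi> \<phi> (\<lambda>V. A k l Q T' \<cdot> (V \<parallel> idn C \<rho>)))"
      by (rule fusion_add) simp_all
    show ?thesis unfolding fprod_def y_eq prod.case eq by (rule r)
  qed
  have scl: "rel \<rho> \<sigma> (fprod \<rho> A (k, scl C c T, \<psi>) y) (fprod \<rho> A (k, T, hscl (\<Gamma> k) c \<psi>) y)"
    if "(k, T, \<psi>) \<in> gen \<rho>1 \<sigma>1" for k T \<psi> c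
  proof -
    have [simp]: "k \<in> Irr" "T \<in> Hom C (\<Gamma> k \<odot> \<rho>1) \<sigma>1" "\<psi> \<in> \<H> (\<Gamma> k)"
      using that by (simp_all add: gen_iff)
    have eq: "fus k l \<psi> \<phi> (\<lambda>V. A k l (scl C c T) T' \<cdot> (V \<parallel> idn C \<rho>)) =
        fus k l \<psi> \<phi> (\<lambda>V. scl C c (A k l T T' \<cdot> (V \<parallel> idn C \<rho>)))"
    proof (rule fusion_cong)
      fix m V assume "m \<in> Irr" "V \<in> Hom C (\<Gamma> m) (\<Gamma> k \<odot> \<Gamma> l)"
      then show "A k l (scl C c T) T' \<cdot> (V \<parallel> idn C \<rho>) = scl C c (A k l T T' \<cdot> (V \<parallel> idn C \<rho>))"
        by (simp add: bilinear_kernelD(4)[OF A] kernel_scl_left[of V "\<Gamma> m" "\<Gamma> k \<odot> \<Gamma> l" \<rho> \<sigma>])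
    qed simp_all
    have r: "rel \<rho> \<sigma> (fus k l \<psi> \<phi> (\<lambda>V. scl C c (A k l T T' \<cdot> (V \<parallel> idn C \<rho>))))
        (fus k l (hscl (\<Gamma> k) c \<psi>) \<phi> (\<lambda>V. A k l T T' \<cdot> (V \<parallel> idn C \<rho>)))"
      by (rule fusion_scale_left) simp_all
    show ?thesis unfolding fprod_def y_eq prod.case eq by (rule r)
  qed
  have vec: "rel \<rho> \<sigma> (fprod \<rho> A (k, T, \<psi> + \<psi>') y) (fprod \<rho> A (k, T, \<psi>) y + fprod \<rho> A (k, T, \<psi>') y)"
    if "(k, T, \<psi>) \<in> gen \<rho>1 \<sigma>1" "(k, T, \<psi>') \<in> gen \<rho>1 \<sigma>1" for k T \<psi> \<psi>'
    using that unfolding fprod_def y_eq by (auto simp: gen_iff intro!: fusion_vec_add_left)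
  have zero: "rel \<rho> \<sigma> (fprod \<rho> A (k, 0, \<psi>) y) {#}" if "(k, 0, \<psi>) \<in> gen \<rho>1 \<sigma>1" for k \<psi>
  proof -
    have [simp]: "k \<in> Irr" "\<psi> \<in> \<H> (\<Gamma> k)" using that by (simp_all add: gen_iff)
    have A0: "A k l 0 T' = 0"
      using bilinear_kernelD(4)[OF A, of k l 0 T' 0] by simp
    have "rel \<rho> \<sigma> (fus k l \<psi> \<phi> (\<lambda>V. A k l 0 T' \<cdot> (V \<parallel> idn C \<rho>))) {#}"
    proof (rule fusion_zero)
      fix m V assume "m \<in> Irr" "V \<in> Hom C (\<Gamma> m) (\<Gamma> k \<odot> \<Gamma> l)"
      then show "A k l 0 T' \<cdot> (V \<parallel> idn C \<rho>) = 0"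
        unfolding A0 by (intro kernel_zero_left[of V "\<Gamma> m" "\<Gamma> k \<odot> \<Gamma> l" \<rho> \<sigma>]) simp_all
    qed simp_all
    then show ?thesis by (simp add: fprod_def y_eq)
  qed
  show ?thesis
    unfolding gen_linear_def using add scl vec zero fprod_gen[OF _ y] by blast
qed

lemma fprod_linear_right:
  assumes x: "x \<in> gen \<rho>1 \<sigma>1"
  shows "gen_linear \<rho>2 \<sigma>2 \<rho> \<sigma> (\<lambda>y. fprod \<rho> A x y)"
proof -
  obtain k T \<psi> where x_eq: "x = (k, T, \<psi>)" by (cases x)
  note [simp] = obj
  have [simp]: "k \<in> Irr" "T \<in> Hom C (\<Gamma> k \<odot> \<rho>1) \<sigma>1" "\<psi> \<in> \<H> (\<Gamma> k)"
    using x by (simp_all add: x_eq gen_iff)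
  have AH [simp]: "A k l T T' \<in> Hom C ((\<Gamma> k \<odot> \<Gamma> l) \<odot> \<rho>) \<sigma>" if "l \<in> Irr" "T' \<in> Hom C (\<Gamma> l \<odot> \<rho>2) \<sigma>2" for l T'
    using that bilinear_kernelD(1)[OF A] by simp
  have ker [simp]: "A k l T T' \<cdot> (V \<parallel> idn C \<rho>) \<in> Hom C (\<Gamma> m \<odot> \<rho>) \<sigma>"
    if "l \<in> Irr" "T' \<in> Hom C (\<Gamma> l \<odot> \<rho>2) \<sigma>2" "m \<in> Irr" "V \<in> Hom C (\<Gamma> m) (\<Gamma> k \<odot> \<Gamma> l)" for l T' m V
    using that by (intro kernel_Hom[of _ "\<Gamma> k \<odot> \<Gamma> l"]) simp_all
  have V [simp]: "V \<parallel> idn C \<rho> \<in> Hom C (\<Gamma> m \<odot> \<rho>) ((\<Gamma> k \<odot> \<Gamma> l) \<odot> \<rho>)"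
    if "l \<in> Irr" "m \<in> Irr" "V \<in> Hom C (\<Gamma> m) (\<Gamma> k \<odot> \<Gamma> l)" for l m V
    using that by (simp add: par_in)
  have add: "rel \<rho> \<sigma> (fprod \<rho> A x (l, T' + Q, \<phi>)) (fprod \<rho> A x (l, T', \<phi>) + fprod \<rho> A x (l, Q, \<phi>))"
    if "(l, T', \<phi>) \<in> gen \<rho>2 \<sigma>2" "(l, Q, \<phi>) \<in> gen \<rho>2 \<sigma>2" for l T' Q \<phi>
  proof -
    have [simp]: "l \<in> Irr" "T' \<in> Hom C (\<Gamma> l \<odot> \<rho>2) \<sigma>2" "Q \<in> Hom C (\<Gamma> l \<odot> \<rho>2) \<sigma>2" "\<phi> \<in> \<H> (\<Gamma> l)"
      using that by (simp_all add: gen_iff)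
    have eq: "fus k l \<psi> \<phi> (\<lambda>V. A k l T (T' + Q) \<cdot> (V \<parallel> idn C \<rho>)) =
        fus k l \<psi> \<phi> (\<lambda>V. A k l T T' \<cdot> (V \<parallel> idn C \<rho>) + A k l T Q \<cdot> (V \<parallel> idn C \<rho>))"
    proof (rule fusion_cong)
      fix m V assume "m \<in> Irr" "V \<in> Hom C (\<Gamma> m) (\<Gamma> k \<odot> \<Gamma> l)"
      then show "A k l T (T' + Q) \<cdot> (V \<parallel> idn C \<rho>) = A k l T T' \<cdot> (V \<parallel> idn C \<rho>) + A k l T Q \<cdot> (V \<parallel> idn C \<rho>)"
        by (simp add: bilinear_kernelD(3)[OF A] kernel_add_left[of V "\<Gamma> m" "\<Gamma> k \<odot> \<Gamma> l" \<rho> \<sigma>])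
    qed simp_all
    have r: "rel \<rho> \<sigma>
        (fus k l \<psi> \<phi> (\<lambda>V. A k l T T' \<cdot> (V \<parallel> idn C \<rho>) + A k l T Q \<cdot> (V \<parallel> idn C \<rho>)))
        (fus k l \<psi> \<phi> (\<lambda>V. A k l T T' \<cdot> (V \<parallel> idn C \<rho>)) + fus k l \<psi> \<phi> (\<lambda>V. A k l T Q \<cdot> (V \<parallel> idn C \<rho>)))"
      by (rule fusion_add) simp_all
    show ?thesis unfolding fprod_def x_eq prod.case eq by (rule r)
  qed
  have scl: "rel \<rho> \<sigma> (fprod \<rho> A x (l, scl C c T', \<phi>)) (fprod \<rho> A x (l, T', hscl (\<Gamma> l) c \<phi>))"
    if "(l, T', \<phi>) \<in> gen \<rho>2 \<sigma>2" for l T' \<phi> c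
  proof -
    have [simp]: "l \<in> Irr" "T' \<in> Hom C (\<Gamma> l \<odot> \<rho>2) \<sigma>2" "\<phi> \<in> \<H> (\<Gamma> l)"
      using that by (simp_all add: gen_iff)
    have eq: "fus k l \<psi> \<phi> (\<lambda>V. A k l T (scl C c T') \<cdot> (V \<parallel> idn C \<rho>)) =
        fus k l \<psi> \<phi> (\<lambda>V. scl C c (A k l T T' \<cdot> (V \<parallel> idn C \<rho>)))"
    proof (rule fusion_cong)
      fix m V assume "m \<in> Irr" "V \<in> Hom C (\<Gamma> m) (\<Gamma> k \<odot> \<Gamma> l)"
      then show "A k l T (scl C c T') \<cdot> (V \<parallel> idn C \<rho>) = scl C c (A k l T T' \<cdot> (V \<parallel> idn C \<rho>))"
        by (simp add: bilinear_kernelD(5)[OF A] kernel_scl_left[of V "\<Gamma> m" "\<Gamma> k \<odot> \<Gamma> l" \<rho> \<sigma>])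
    qed simp_all
    have r: "rel \<rho> \<sigma> (fus k l \<psi> \<phi> (\<lambda>V. scl C c (A k l T T' \<cdot> (V \<parallel> idn C \<rho>))))
        (fus k l \<psi> (hscl (\<Gamma> l) c \<phi>) (\<lambda>V. A k l T T' \<cdot> (V \<parallel> idn C \<rho>)))"
      by (rule fusion_scale_right) simp_all
    show ?thesis unfolding fprod_def x_eq prod.case eq by (rule r)
  qed
  have vec: "rel \<rho> \<sigma> (fprod \<rho> A x (l, T', \<phi> + \<phi>')) (fprod \<rho> A x (l, T', \<phi>) + fprod \<rho> A x (l, T', \<phi>'))"
    if "(l, T', \<phi>) \<in> gen \<rho>2 \<sigma>2" "(l, T', \<phi>') \<in> gen \<rho>2 \<sigma>2" for l T' \<phi> \<phi>'
    using that unfolding fprod_def x_eq by (auto simp: gen_iff intro!: fusion_vec_add_right)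
  have zero: "rel \<rho> \<sigma> (fprod \<rho> A x (l, 0, \<phi>)) {#}" if "(l, 0, \<phi>) \<in> gen \<rho>2 \<sigma>2" for l \<phi>
  proof -
    have [simp]: "l \<in> Irr" "\<phi> \<in> \<H> (\<Gamma> l)" using that by (simp_all add: gen_iff)
    have A0: "A k l T 0 = 0"
      using bilinear_kernelD(5)[OF A, of k l T 0 0] by simp
    have "rel \<rho> \<sigma> (fus k l \<psi> \<phi> (\<lambda>V. A k l T 0 \<cdot> (V \<parallel> idn C \<rho>))) {#}"
    proof (rule fusion_zero)
      fix m V assume "m \<in> Irr" "V \<in> Hom C (\<Gamma> m) (\<Gamma> k \<odot> \<Gamma> l)"
      then show "A k l T 0 \<cdot> (V \<parallel> idn C \<rho>) = 0"
        unfolding A0 by (intro kernel_zero_left[of V "\<Gamma> m" "\<Gamma> k \<odot> \<Gamma> l" \<rho> \<sigma>]) simp_all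
    qed simp_all
    then show ?thesis by (simp add: fprod_def x_eq)
  qed
  show ?thesis
    unfolding gen_linear_def using add scl vec zero fprod_gen[OF x] by blast
qed

lemma fprod_sum_gen:
  assumes "set_mset M \<subseteq> gen \<rho>1 \<sigma>1" "set_mset N \<subseteq> gen \<rho>2 \<sigma>2"
  shows "set_mset (\<Sum>x\<in>#M. \<Sum>y\<in>#N. fprod \<rho> A x y) \<subseteq> gen \<rho> \<sigma>"
  using assms fprod_gen by (intro set_mset_sum_mset_subset) blast

lemma fprod_rel:
  assumes M: "rel \<rho>1 \<sigma>1 M M'" and N: "rel \<rho>2 \<sigma>2 N N'"
  shows "rel \<rho> \<sigma> (\<Sum>x\<in>#M. \<Sum>y\<in>#N. fprod \<rho> A x y) (\<Sum>x\<in>#M'. \<Sum>y\<in>#N'. fprod \<rho> A x y)"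
proof -
  have gM: "set_mset M' \<subseteq> gen \<rho>1 \<sigma>1" and gN: "set_mset N \<subseteq> gen \<rho>2 \<sigma>2"
    using rel_gen[OF M] rel_gen[OF N] obj by auto
  have "(\<Sum>x\<in>#M. \<Sum>y\<in>#N. fprod \<rho> A x y) = (\<Sum>y\<in>#N. \<Sum>x\<in>#M. fprod \<rho> A x y)"
    by (rule sum_mset.swap)
  also have "rel \<rho> \<sigma> \<dots> (\<Sum>y\<in>#N. \<Sum>x\<in>#M'. fprod \<rho> A x y)"
    using gN by (intro rel_sum_mset gen_linear_rel[OF fprod_linear_left M] obj) blast
  also have "(\<Sum>y\<in>#N. \<Sum>x\<in>#M'. fprod \<rho> A x y) = (\<Sum>x\<in>#M'. \<Sum>y\<in>#N. fprod \<rho> A x y)"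
    by (rule sum_mset.swap)
  also have "rel \<rho> \<sigma> \<dots> (\<Sum>x\<in>#M'. \<Sum>y\<in>#N'. fprod \<rho> A x y)"
    using gM by (intro rel_sum_mset gen_linear_rel[OF fprod_linear_right N] obj) blast
  finally show ?thesis .
qed

text \<open>The operations are defined as unions over all representatives; every pair of representatives gives
  the same class.\<close>

lemma fprod_classes:
  assumes M: "set_mset M \<subseteq> gen \<rho>1 \<sigma>1" and N: "set_mset N \<subseteq> gen \<rho>2 \<sigma>2"
  shows "(\<Union>M'\<in>{M'. rel \<rho>1 \<sigma>1 M M'}. \<Union>N'\<in>{N'. rel \<rho>2 \<sigma>2 N N'}.
      {P. rel \<rho> \<sigma> (\<Sum>x\<in>#M'. \<Sum>y\<in>#N'. fprod \<rho> A x y) P}) =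
    {P. rel \<rho> \<sigma> (\<Sum>x\<in>#M. \<Sum>y\<in>#N. fprod \<rho> A x y) P}"
proof (intro equalityI subsetI)
  fix P assume "P \<in> {P. rel \<rho> \<sigma> (\<Sum>x\<in>#M. \<Sum>y\<in>#N. fprod \<rho> A x y) P}"
  moreover have "rel \<rho>1 \<sigma>1 M M" "rel \<rho>2 \<sigma>2 N N" using M N rel_refl by blast+
  ultimately show "P \<in> (\<Union>M'\<in>{M'. rel \<rho>1 \<sigma>1 M M'}. \<Union>N'\<in>{N'. rel \<rho>2 \<sigma>2 N N'}.
      {P. rel \<rho> \<sigma> (\<Sum>x\<in>#M'. \<Sum>y\<in>#N'. fprod \<rho> A x y) P})" by blast
next
  fix P assume "P \<in> (\<Union>M'\<in>{M'. rel \<rho>1 \<sigma>1 M M'}. \<Union>N'\<in>{N'. rel \<rho>2 \<sigma>2 N N'}.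
      {P. rel \<rho> \<sigma> (\<Sum>x\<in>#M'. \<Sum>y\<in>#N'. fprod \<rho> A x y) P})"
  then obtain M' N' where r: "rel \<rho>1 \<sigma>1 M M'" "rel \<rho>2 \<sigma>2 N N'"
    "rel \<rho> \<sigma> (\<Sum>x\<in>#M'. \<Sum>y\<in>#N'. fprod \<rho> A x y) P" by blast
  then show "P \<in> {P. rel \<rho> \<sigma> (\<Sum>x\<in>#M. \<Sum>y\<in>#N. fprod \<rho> A x y) P}"
    using rel_trans[OF fprod_rel[OF r(1,2)] r(3)] by simp
qed

end

end

section \<open>Naturality of the lifted braiding\<close>

context crossed_product_setting
begin

abbreviation "cmp_kernel \<equiv> \<lambda>k l T T'. T \<cdot> (idn C (\<Gamma> k) \<parallel> T')"
abbreviation "par_kernel \<rho>1 \<rho>2 \<equiv> \<lambda>k l T T'. (T \<parallel> T') \<cdot> (idn C (\<Gamma> k) \<parallel> \<epsilon> (\<Gamma> l) \<rho>1 \<parallel> idn C \<rho>2)"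
abbreviation "ccmp \<equiv> cp_cmp C S U F K"
abbreviation "cpar \<equiv> cp_par C \<epsilon> S U F K"

lemma cmp_kernel_bilinear:
  assumes [simp]: "\<rho> \<in> Obj C" "\<sigma> \<in> Obj C" "\<tau> \<in> Obj C"
  shows "bilinear_kernel \<sigma> \<tau> \<rho> \<sigma> \<rho> \<tau> cmp_kernel"
  unfolding bilinear_kernel_def
proof (intro ballI conjI allI)
  fix k l T T' c
  assume [simp]: "k \<in> Irr" "l \<in> Irr" and T: "T \<in> Hom C (\<Gamma> k \<odot> \<sigma>) \<tau>" and T': "T' \<in> Hom C (\<Gamma> l \<odot> \<rho>) \<sigma>"
  have p: "idn C (\<Gamma> k) \<parallel> Q \<in> Hom C ((\<Gamma> k \<odot> \<Gamma> l) \<odot> \<rho>) (\<Gamma> k \<odot> \<sigma>)" if "Q \<in> Hom C (\<Gamma> l \<odot> \<rho>) \<sigma>" for Q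
    using par_in[OF idn_Hom[of "\<Gamma> k"] that] by (simp add: tns_assoc)
  note c = cmp_add[of "(\<Gamma> k \<odot> \<Gamma> l) \<odot> \<rho>" "\<Gamma> k \<odot> \<sigma>" \<tau>] cmp_scl[of "(\<Gamma> k \<odot> \<Gamma> l) \<odot> \<rho>" "\<Gamma> k \<odot> \<sigma>" \<tau>]
    par_add(2)[of "\<Gamma> k" "\<Gamma> k" "\<Gamma> l \<odot> \<rho>" \<sigma>] par_scl(2)[of "\<Gamma> k" "\<Gamma> k" "\<Gamma> l \<odot> \<rho>" \<sigma>]
  show "T \<cdot> (idn C (\<Gamma> k) \<parallel> T') \<in> Hom C ((\<Gamma> k \<odot> \<Gamma> l) \<odot> \<rho>) \<tau>"
    by (rule cmp_in[OF T p[OF T']]) simp_all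
  show "scl C c T \<cdot> (idn C (\<Gamma> k) \<parallel> T') = scl C c (T \<cdot> (idn C (\<Gamma> k) \<parallel> T'))"
    using T T' p by (simp add: c)
  show "T \<cdot> (idn C (\<Gamma> k) \<parallel> scl C c T') = scl C c (T \<cdot> (idn C (\<Gamma> k) \<parallel> T'))"
    using T T' p by (simp add: c)
  show "(T + Q) \<cdot> (idn C (\<Gamma> k) \<parallel> T') = T \<cdot> (idn C (\<Gamma> k) \<parallel> T') + Q \<cdot> (idn C (\<Gamma> k) \<parallel> T')"
    if "Q \<in> Hom C (\<Gamma> k \<odot> \<sigma>) \<tau>" for Q
    using T T' that p by (simp add: c)
  show "T \<cdot> (idn C (\<Gamma> k) \<parallel> (T' + Q)) = T \<cdot> (idn C (\<Gamma> k) \<parallel> T') + T \<cdot> (idn C (\<Gamma> k) \<parallel> Q)"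
    if "Q \<in> Hom C (\<Gamma> l \<odot> \<rho>) \<sigma>" for Q
    using T T' that p by (simp add: c)
qed

lemma par_kernel_bilinear:
  assumes [simp]: "\<rho>1 \<in> Obj C" "\<sigma>1 \<in> Obj C" "\<rho>2 \<in> Obj C" "\<sigma>2 \<in> Obj C"
  shows "bilinear_kernel \<rho>1 \<sigma>1 \<rho>2 \<sigma>2 (\<rho>1 \<odot> \<rho>2) (\<sigma>1 \<odot> \<sigma>2) (par_kernel \<rho>1 \<rho>2)"
  unfolding bilinear_kernel_def
proof (intro ballI conjI allI)
  fix k l T T' c
  assume [simp]: "k \<in> Irr" "l \<in> Irr" and T: "T \<in> Hom C (\<Gamma> k \<odot> \<rho>1) \<sigma>1" and T': "T' \<in> Hom C (\<Gamma> l \<odot> \<rho>2) \<sigma>2"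
  let ?m = "idn C (\<Gamma> k) \<parallel> \<epsilon> (\<Gamma> l) \<rho>1 \<parallel> idn C \<rho>2"
  let ?s = "(\<Gamma> k \<odot> \<Gamma> l) \<odot> (\<rho>1 \<odot> \<rho>2)" and ?t = "(\<Gamma> k \<odot> \<rho>1) \<odot> (\<Gamma> l \<odot> \<rho>2)"
  have m: "?m \<in> Hom C ?s ?t"
    using par_in[OF par_in[OF idn_Hom[of "\<Gamma> k"] eps_Hom[of "\<Gamma> l" \<rho>1]] idn_Hom[of \<rho>2]] by (simp add: tns_assoc)
  have p: "X \<parallel> Y \<in> Hom C ?t (\<sigma>1 \<odot> \<sigma>2)" if "X \<in> Hom C (\<Gamma> k \<odot> \<rho>1) \<sigma>1" "Y \<in> Hom C (\<Gamma> l \<odot> \<rho>2) \<sigma>2" for X Y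
    using par_in[OF that] by simp
  note c = cmp_add(1)[OF _ _ _ _ _ m, of "\<sigma>1 \<odot> \<sigma>2"] cmp_scl(1)[OF _ _ _ _ m, of "\<sigma>1 \<odot> \<sigma>2"]
    par_add[of "\<Gamma> k \<odot> \<rho>1" \<sigma>1 "\<Gamma> l \<odot> \<rho>2" \<sigma>2] par_scl[of "\<Gamma> k \<odot> \<rho>1" \<sigma>1 "\<Gamma> l \<odot> \<rho>2" \<sigma>2]
  show "(T \<parallel> T') \<cdot> ?m \<in> Hom C ?s (\<sigma>1 \<odot> \<sigma>2)"
    by (rule cmp_in[OF p[OF T T'] m]) simp_all
  show "(scl C c T \<parallel> T') \<cdot> ?m = scl C c ((T \<parallel> T') \<cdot> ?m)" "(T \<parallel> scl C c T') \<cdot> ?m = scl C c ((T \<parallel> T') \<cdot> ?m)"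
    using T T' p by (simp_all add: c)
  show "((T + Q) \<parallel> T') \<cdot> ?m = (T \<parallel> T') \<cdot> ?m + (Q \<parallel> T') \<cdot> ?m" if "Q \<in> Hom C (\<Gamma> k \<odot> \<rho>1) \<sigma>1" for Q
    using T T' p that by (simp add: c)
  show "(T \<parallel> (T' + Q)) \<cdot> ?m = (T \<parallel> T') \<cdot> ?m + (T \<parallel> Q) \<cdot> ?m" if "Q \<in> Hom C (\<Gamma> l \<odot> \<rho>2) \<sigma>2" for Q
    using T T' p that by (simp add: c)
qed

lemma cp_cmp_gen_eq: "cp_cmp_gen C S U F K \<rho> = fprod \<rho> cmp_kernel"
  unfolding cp_cmp_gen_def fprod_def ..

lemma cp_par_gen_eq: "cp_par_gen C \<epsilon> S U F K \<rho>1 \<rho>2 = fprod (\<rho>1 \<odot> \<rho>2) (par_kernel \<rho>1 \<rho>2)"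
  unfolding cp_par_gen_def fprod_def ..

lemma ccmp_cls:
  assumes "\<rho> \<in> Obj C" "\<sigma> \<in> Obj C" "\<tau> \<in> Obj C" "set_mset M \<subseteq> gen \<sigma> \<tau>" "set_mset N \<subseteq> gen \<rho> \<sigma>"
  shows "ccmp (cls \<sigma> \<tau> M) (cls \<rho> \<sigma> N) = cls \<rho> \<tau> (\<Sum>x\<in>#M. \<Sum>y\<in>#N. fprod \<rho> cmp_kernel x y)"
  unfolding cp_cmp_def cp_class_def cp_cmp_gen_eq prod.case
  by (simp only: fprod_classes[OF cmp_kernel_bilinear] assms)

lemma cpar_cls:
  assumes "\<rho>1 \<in> Obj C" "\<sigma>1 \<in> Obj C" "\<rho>2 \<in> Obj C" "\<sigma>2 \<in> Obj C"
    "set_mset M \<subseteq> gen \<rho>1 \<sigma>1" "set_mset N \<subseteq> gen \<rho>2 \<sigma>2"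
  shows "cpar (cls \<rho>1 \<sigma>1 M) (cls \<rho>2 \<sigma>2 N) =
    cls (\<rho>1 \<odot> \<rho>2) (\<sigma>1 \<odot> \<sigma>2) (\<Sum>x\<in>#M. \<Sum>y\<in>#N. fprod (\<rho>1 \<odot> \<rho>2) (par_kernel \<rho>1 \<rho>2) x y)"
  unfolding cp_par_def cp_class_def cp_par_gen_eq prod.case
  by (simp only: fprod_classes[OF par_kernel_bilinear] assms tns_Obj)

lemma emb_gen: "\<lbrakk>f \<in> Hom C \<rho> \<sigma>; \<rho> \<in> Obj C\<rbrakk> \<Longrightarrow> set_mset {#(\<o>, f, \<Omega>\<^bsub>U\<^esub>)#} \<subseteq> gen \<rho> \<sigma>"
  by (simp add: gen_iff tns_unt)

lemma vten_vac:
  "\<lbrakk>\<rho> \<in> S; x \<in> \<H> \<rho>\<rbrakk> \<Longrightarrow> vten (unt C) \<rho> \<Omega>\<^bsub>U\<^esub> x = x"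
  "\<lbrakk>\<rho> \<in> S; x \<in> \<H> \<rho>\<rbrakk> \<Longrightarrow> vten \<rho> (unt C) x \<Omega>\<^bsub>U\<^esub> = x"
  using U.vac_vtns[OF fobj_in] by (simp_all add: F.fobj_unt)

text \<open>If one factor is an arrow of the original category, fusion is with the unit object and a single
  generator remains. The next lemmas read off how such arrows act by composition and tensor product.\<close>

lemma fprod_vac_left:
  assumes A: "bilinear_kernel \<rho>1 \<sigma>1 \<rho>2 \<sigma>2 \<rho> \<sigma> A" and f: "f \<in> Hom C \<rho>1 \<sigma>1"
    and obj: "\<rho>1 \<in> Obj C" "\<rho> \<in> Obj C" "\<sigma> \<in> Obj C" and y: "(l, T, \<phi>) \<in> gen \<rho>2 \<sigma>2"
  shows "rel \<rho> \<sigma> (fprod \<rho> A (\<o>, f, \<Omega>\<^bsub>U\<^esub>) (l, T, \<phi>)) {#(l, A \<o> l f T, \<phi>)#}"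
proof -
  have l: "l \<in> Irr" "T \<in> Hom C (\<Gamma> l \<odot> \<rho>2) \<sigma>2" "\<phi> \<in> \<H> (\<Gamma> l)" using y by (simp_all add: gen_iff)
  have "A \<o> l f T \<in> Hom C ((\<Gamma> \<o> \<odot> \<Gamma> l) \<odot> \<rho>) \<sigma>"
    using l f obj by (intro bilinear_kernelD(1)[OF A]) (simp_all add: tns_unt)
  then have B: "A \<o> l f T \<in> Hom C (\<Gamma> l \<odot> \<rho>) \<sigma>" using l obj by (simp add: tns_unt)
  have "rel \<rho> \<sigma> (fus \<o> l \<Omega>\<^bsub>U\<^esub> \<phi> (\<lambda>V. A \<o> l f T \<cdot> (V \<parallel> idn C \<rho>))) {#(l, A \<o> l f T, vten (\<Gamma> \<o>) (\<Gamma> l) \<Omega>\<^bsub>U\<^esub> \<phi>)#}"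
    using l obj by (intro fusion_irreducible B) (simp_all add: tns_unt)
  then show ?thesis using l by (simp add: fprod_def vten_vac)
qed

lemma fprod_vac_right:
  assumes A: "bilinear_kernel \<rho>1 \<sigma>1 \<rho>2 \<sigma>2 \<rho> \<sigma> A" and f: "f \<in> Hom C \<rho>2 \<sigma>2"
    and obj: "\<rho>2 \<in> Obj C" "\<rho> \<in> Obj C" "\<sigma> \<in> Obj C" and x: "(k, T, \<psi>) \<in> gen \<rho>1 \<sigma>1"
  shows "rel \<rho> \<sigma> (fprod \<rho> A (k, T, \<psi>) (\<o>, f, \<Omega>\<^bsub>U\<^esub>)) {#(k, A k \<o> T f, \<psi>)#}"
proof -
  have k: "k \<in> Irr" "T \<in> Hom C (\<Gamma> k \<odot> \<rho>1) \<sigma>1" "\<psi> \<in> \<H> (\<Gamma> k)" using x by (simp_all add: gen_iff)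
  have "A k \<o> T f \<in> Hom C ((\<Gamma> k \<odot> \<Gamma> \<o>) \<odot> \<rho>) \<sigma>"
    using k f obj by (intro bilinear_kernelD(1)[OF A]) (simp_all add: tns_unt)
  then have B: "A k \<o> T f \<in> Hom C (\<Gamma> k \<odot> \<rho>) \<sigma>" using k obj by (simp add: tns_unt)
  have "rel \<rho> \<sigma> (fus k \<o> \<psi> \<Omega>\<^bsub>U\<^esub> (\<lambda>V. A k \<o> T f \<cdot> (V \<parallel> idn C \<rho>))) {#(k, A k \<o> T f, vten (\<Gamma> k) (\<Gamma> \<o>) \<psi> \<Omega>\<^bsub>U\<^esub>)#}"
    using k obj by (intro fusion_irreducible B) (simp_all add: tns_unt)
  then show ?thesis using k by (simp add: fprod_def vten_vac)
qed

lemma emb_ccmp: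
  assumes f: "f \<in> Hom C \<sigma> \<tau>" and M: "set_mset M \<subseteq> gen \<rho> \<sigma>"
    and obj: "\<rho> \<in> Obj C" "\<sigma> \<in> Obj C" "\<tau> \<in> Obj C"
  shows "ccmp (emb \<sigma> \<tau> f) (cls \<rho> \<sigma> M) = cls \<rho> \<tau> (image_mset (\<lambda>(m, T, \<psi>). (m, f \<cdot> T, \<psi>)) M)"
proof -
  have "ccmp (emb \<sigma> \<tau> f) (cls \<rho> \<sigma> M) = cls \<rho> \<tau> (\<Sum>y\<in>#M. fprod \<rho> cmp_kernel (\<o>, f, \<Omega>\<^bsub>U\<^esub>) y)"
    unfolding cp_emb_def ccmp_cls[OF obj emb_gen[OF f obj(2)] M] by simp
  also have "\<dots> = cls \<rho> \<tau> (\<Sum>y\<in>#M. {#(\<lambda>(m, T, \<psi>). (m, f \<cdot> T, \<psi>)) y#})"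
  proof (intro cls_cong rel_sum_mset obj)
    fix y assume "y \<in># M"
    with M obtain l T \<phi> where y: "y = (l, T, \<phi>)" "(l, T, \<phi>) \<in> gen \<rho> \<sigma>" by (cases y) auto
    then have "cmp_kernel \<o> l f T = f \<cdot> T"
      using obj par_unt(1)[of "\<Gamma> l \<odot> \<rho>" \<sigma> T] by (simp add: gen_iff)
    then show "rel \<rho> \<tau> (fprod \<rho> cmp_kernel (\<o>, f, \<Omega>\<^bsub>U\<^esub>) y) {#(\<lambda>(m, T, \<psi>). (m, f \<cdot> T, \<psi>)) y#}"
      using fprod_vac_left[OF cmp_kernel_bilinear[OF obj] f obj(2,1,3) y(2)] by (simp add: y(1))
  qed
  finally show ?thesis by (simp add: sum_mset_singletons)
qed

lemma ccmp_emb: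
  assumes f: "f \<in> Hom C \<rho> \<sigma>" and M: "set_mset M \<subseteq> gen \<sigma> \<tau>"
    and obj: "\<rho> \<in> Obj C" "\<sigma> \<in> Obj C" "\<tau> \<in> Obj C"
  shows "ccmp (cls \<sigma> \<tau> M) (emb \<rho> \<sigma> f) =
    cls \<rho> \<tau> (image_mset (\<lambda>(m, T, \<psi>). (m, T \<cdot> (idn C (\<Gamma> m) \<parallel> f), \<psi>)) M)"
proof -
  have "ccmp (cls \<sigma> \<tau> M) (emb \<rho> \<sigma> f) = cls \<rho> \<tau> (\<Sum>x\<in>#M. fprod \<rho> cmp_kernel x (\<o>, f, \<Omega>\<^bsub>U\<^esub>))"
    unfolding cp_emb_def ccmp_cls[OF obj M emb_gen[OF f obj(1)]] by simp
  also have "\<dots> = cls \<rho> \<tau> (\<Sum>x\<in>#M. {#(\<lambda>(m, T, \<psi>). (m, T \<cdot> (idn C (\<Gamma> m) \<parallel> f), \<psi>)) x#})"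
  proof (intro cls_cong rel_sum_mset obj)
    fix x assume "x \<in># M"
    with M obtain k T \<psi> where x: "x = (k, T, \<psi>)" "(k, T, \<psi>) \<in> gen \<sigma> \<tau>" by (cases x) auto
    show "rel \<rho> \<tau> (fprod \<rho> cmp_kernel x (\<o>, f, \<Omega>\<^bsub>U\<^esub>)) {#(\<lambda>(m, T, \<psi>). (m, T \<cdot> (idn C (\<Gamma> m) \<parallel> f), \<psi>)) x#}"
      using fprod_vac_right[OF cmp_kernel_bilinear[OF obj] f obj(1,1,3) x(2)] by (simp add: x(1))
  qed
  finally show ?thesis by (simp add: sum_mset_singletons)
qed

lemma cpar_emb_left:
  assumes f: "f \<in> Hom C \<rho>1 \<sigma>1" and N: "set_mset N \<subseteq> gen \<rho>2 \<sigma>2"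
    and obj: "\<rho>1 \<in> Obj C" "\<sigma>1 \<in> Obj C" "\<rho>2 \<in> Obj C" "\<sigma>2 \<in> Obj C"
  shows "cpar (emb \<rho>1 \<sigma>1 f) (cls \<rho>2 \<sigma>2 N) = cls (\<rho>1 \<odot> \<rho>2) (\<sigma>1 \<odot> \<sigma>2)
    (image_mset (\<lambda>(l, T, \<phi>). (l, (f \<parallel> T) \<cdot> (\<epsilon> (\<Gamma> l) \<rho>1 \<parallel> idn C \<rho>2), \<phi>)) N)"
proof -
  let ?h = "\<lambda>(l, T, \<phi>). (l, (f \<parallel> T) \<cdot> (\<epsilon> (\<Gamma> l) \<rho>1 \<parallel> idn C \<rho>2), \<phi>)"
  have "cpar (emb \<rho>1 \<sigma>1 f) (cls \<rho>2 \<sigma>2 N) =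
      cls (\<rho>1 \<odot> \<rho>2) (\<sigma>1 \<odot> \<sigma>2) (\<Sum>y\<in>#N. fprod (\<rho>1 \<odot> \<rho>2) (par_kernel \<rho>1 \<rho>2) (\<o>, f, \<Omega>\<^bsub>U\<^esub>) y)"
    unfolding cp_emb_def cpar_cls[OF obj emb_gen[OF f obj(1)] N] by simp
  also have "\<dots> = cls (\<rho>1 \<odot> \<rho>2) (\<sigma>1 \<odot> \<sigma>2) (\<Sum>y\<in>#N. {#?h y#})"
  proof (intro cls_cong rel_sum_mset tns_Obj obj)
    fix y assume "y \<in># N"
    with N obtain l T \<phi> where y: "y = (l, T, \<phi>)" "(l, T, \<phi>) \<in> gen \<rho>2 \<sigma>2" by (cases y) auto
    then have "par_kernel \<rho>1 \<rho>2 \<o> l f T = (f \<parallel> T) \<cdot> (\<epsilon> (\<Gamma> l) \<rho>1 \<parallel> idn C \<rho>2)"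
      using obj par_unt(1)[OF _ _ eps_Hom[of "\<Gamma> l" \<rho>1]] by (simp add: gen_iff)
    then show "rel (\<rho>1 \<odot> \<rho>2) (\<sigma>1 \<odot> \<sigma>2) (fprod (\<rho>1 \<odot> \<rho>2) (par_kernel \<rho>1 \<rho>2) (\<o>, f, \<Omega>\<^bsub>U\<^esub>) y) {#?h y#}"
      using fprod_vac_left[OF par_kernel_bilinear[OF obj] f obj(1) tns_Obj[OF obj(1,3)] tns_Obj[OF obj(2,4)] y(2)]
      by (simp add: y(1))
  qed
  finally show ?thesis by (simp add: sum_mset_singletons)
qed

lemma cpar_emb_right:
  assumes f: "f \<in> Hom C \<rho>2 \<sigma>2" and M: "set_mset M \<subseteq> gen \<rho>1 \<sigma>1"
    and obj: "\<rho>1 \<in> Obj C" "\<sigma>1 \<in> Obj C" "\<rho>2 \<in> Obj C" "\<sigma>2 \<in> Obj C"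
  shows "cpar (cls \<rho>1 \<sigma>1 M) (emb \<rho>2 \<sigma>2 f) = cls (\<rho>1 \<odot> \<rho>2) (\<sigma>1 \<odot> \<sigma>2)
    (image_mset (\<lambda>(k, T, \<psi>). (k, T \<parallel> f, \<psi>)) M)"
proof -
  let ?h = "\<lambda>(k, T, \<psi>). (k, T \<parallel> f, \<psi>)"
  have "cpar (cls \<rho>1 \<sigma>1 M) (emb \<rho>2 \<sigma>2 f) =
      cls (\<rho>1 \<odot> \<rho>2) (\<sigma>1 \<odot> \<sigma>2) (\<Sum>x\<in>#M. fprod (\<rho>1 \<odot> \<rho>2) (par_kernel \<rho>1 \<rho>2) x (\<o>, f, \<Omega>\<^bsub>U\<^esub>))"
    unfolding cp_emb_def cpar_cls[OF obj M emb_gen[OF f obj(3)]] by simp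
  also have "\<dots> = cls (\<rho>1 \<odot> \<rho>2) (\<sigma>1 \<odot> \<sigma>2) (\<Sum>x\<in>#M. {#?h x#})"
  proof (intro cls_cong rel_sum_mset tns_Obj obj)
    fix x assume "x \<in># M"
    with M obtain k T \<psi> where x: "x = (k, T, \<psi>)" "(k, T, \<psi>) \<in> gen \<rho>1 \<sigma>1" by (cases x) auto
    then have k: "k \<in> Irr" "T \<in> Hom C (\<Gamma> k \<odot> \<rho>1) \<sigma>1" by (simp_all add: gen_iff)
    have "T \<parallel> f \<in> Hom C ((\<Gamma> k \<odot> \<rho>1) \<odot> \<rho>2) (\<sigma>1 \<odot> \<sigma>2)"
      using k obj by (intro par_in[OF k(2) f]) simp_all
    then have "par_kernel \<rho>1 \<rho>2 k \<o> T f = T \<parallel> f"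
      using k obj idn_right[of "(\<Gamma> k \<odot> \<rho>1) \<odot> \<rho>2" "\<sigma>1 \<odot> \<sigma>2" "T \<parallel> f"] by (simp add: eps_unt par_idn)
    then show "rel (\<rho>1 \<odot> \<rho>2) (\<sigma>1 \<odot> \<sigma>2) (fprod (\<rho>1 \<odot> \<rho>2) (par_kernel \<rho>1 \<rho>2) x (\<o>, f, \<Omega>\<^bsub>U\<^esub>)) {#?h x#}"
      using fprod_vac_right[OF par_kernel_bilinear[OF obj] f obj(3) tns_Obj[OF obj(1,3)] tns_Obj[OF obj(2,4)] x(2)]
      by (simp add: x(1))
  qed
  finally show ?thesis by (simp add: sum_mset_singletons)
qed

lemma emb_cmp_emb:
  assumes "f \<in> Hom C \<sigma> \<tau>" "g \<in> Hom C \<rho> \<sigma>" "\<rho> \<in> Obj C" "\<sigma> \<in> Obj C" "\<tau> \<in> Obj C"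
  shows "ccmp (emb \<sigma> \<tau> f) (emb \<rho> \<sigma> g) = emb \<rho> \<tau> (f \<cdot> g)"
  unfolding cp_emb_def[of C S U F K \<rho>] emb_ccmp[OF assms(1) emb_gen[OF assms(2,3)] assms(3-5)] by simp

lemma emb_par_emb:
  assumes "f \<in> Hom C \<rho>1 \<sigma>1" "g \<in> Hom C \<rho>2 \<sigma>2"
    and obj: "\<rho>1 \<in> Obj C" "\<sigma>1 \<in> Obj C" "\<rho>2 \<in> Obj C" "\<sigma>2 \<in> Obj C"
  shows "cpar (emb \<rho>1 \<sigma>1 f) (emb \<rho>2 \<sigma>2 g) = emb (\<rho>1 \<odot> \<rho>2) (\<sigma>1 \<odot> \<sigma>2) (f \<parallel> g)"
  unfolding cp_emb_def[of C S U F K \<rho>1] cpar_emb_right[OF assms(2) emb_gen[OF assms(1) obj(1)] obj]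
  by (simp add: cp_emb_def)

lemma emb_in: "\<lbrakk>f \<in> Hom C \<rho> \<sigma>; \<rho> \<in> Obj C\<rbrakk> \<Longrightarrow> emb \<rho> \<sigma> f \<in> cp_Hom C S U F K \<rho> \<sigma>"
  unfolding cp_Hom_def cp_emb_def using emb_gen by blast

text \<open>Composition with an arrow of the original category on either side only changes the kernel.\<close>

lemma fprod_post:
  assumes A: "bilinear_kernel \<rho>1 \<sigma>1 \<rho>2 \<sigma>2 \<rho> \<sigma> A" and f: "f \<in> Hom C \<sigma> \<tau>"
    and [simp]: "\<rho> \<in> Obj C" "\<sigma> \<in> Obj C" "\<tau> \<in> Obj C"
    and x: "x \<in> gen \<rho>1 \<sigma>1" and y: "y \<in> gen \<rho>2 \<sigma>2"
  shows "image_mset (\<lambda>(m, T, \<psi>). (m, f \<cdot> T, \<psi>)) (fprod \<rho> A x y) = fprod \<rho> (\<lambda>k l T T'. f \<cdot> A k l T T') x y"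
proof -
  obtain k T \<psi> l T' \<phi> where xy: "x = (k, T, \<psi>)" "y = (l, T', \<phi>)" by (cases x, cases y)
  have [simp]: "k \<in> Irr" "l \<in> Irr" using x y by (simp_all add: xy gen_iff)
  have B: "A k l T T' \<in> Hom C ((\<Gamma> k \<odot> \<Gamma> l) \<odot> \<rho>) \<sigma>"
    using x y by (intro bilinear_kernelD(1)[OF A]) (simp_all add: xy gen_iff)
  show ?thesis
    unfolding fprod_def xy prod.case
  proof (rule fusion_image)
    fix m V assume V: "m \<in> Irr" "V \<in> Hom C (\<Gamma> m) (\<Gamma> k \<odot> \<Gamma> l)"
    then have p: "V \<parallel> idn C \<rho> \<in> Hom C (\<Gamma> m \<odot> \<rho>) ((\<Gamma> k \<odot> \<Gamma> l) \<odot> \<rho>)"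
      by (simp add: par_in)
    show "f \<cdot> (A k l T T' \<cdot> (V \<parallel> idn C \<rho>)) = f \<cdot> A k l T T' \<cdot> (V \<parallel> idn C \<rho>)"
      by (rule cmp_assoc[OF _ _ _ _ f B p, symmetric]) (simp_all add: V)
  qed simp_all
qed

lemma fprod_pre:
  assumes A: "bilinear_kernel \<rho>1 \<sigma>1 \<rho>2 \<sigma>2 \<rho> \<sigma> A" and f: "f \<in> Hom C \<rho>' \<rho>"
    and [simp]: "\<rho> \<in> Obj C" "\<sigma> \<in> Obj C" "\<rho>' \<in> Obj C"
    and x: "x \<in> gen \<rho>1 \<sigma>1" and y: "y \<in> gen \<rho>2 \<sigma>2"
  shows "image_mset (\<lambda>(m, T, \<psi>). (m, T \<cdot> (idn C (\<Gamma> m) \<parallel> f), \<psi>)) (fprod \<rho> A x y) =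
    fprod \<rho>' (\<lambda>k l T T'. A k l T T' \<cdot> (idn C (\<Gamma> k \<odot> \<Gamma> l) \<parallel> f)) x y"
proof -
  obtain k T \<psi> l T' \<phi> where xy: "x = (k, T, \<psi>)" "y = (l, T', \<phi>)" by (cases x, cases y)
  have [simp]: "k \<in> Irr" "l \<in> Irr" using x y by (simp_all add: xy gen_iff)
  let ?\<theta> = "\<Gamma> k \<odot> \<Gamma> l"
  have B: "A k l T T' \<in> Hom C (?\<theta> \<odot> \<rho>) \<sigma>"
    using x y by (intro bilinear_kernelD(1)[OF A]) (simp_all add: xy gen_iff)
  show ?thesis
    unfolding fprod_def xy prod.case
  proof (rule fusion_image)
    fix m V assume V [simp]: "m \<in> Irr" "V \<in> Hom C (\<Gamma> m) ?\<theta>"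
    have p: "V \<parallel> idn C \<rho> \<in> Hom C (\<Gamma> m \<odot> \<rho>) (?\<theta> \<odot> \<rho>)" "V \<parallel> idn C \<rho>' \<in> Hom C (\<Gamma> m \<odot> \<rho>') (?\<theta> \<odot> \<rho>')"
      "idn C (\<Gamma> m) \<parallel> f \<in> Hom C (\<Gamma> m \<odot> \<rho>') (\<Gamma> m \<odot> \<rho>)" "idn C ?\<theta> \<parallel> f \<in> Hom C (?\<theta> \<odot> \<rho>') (?\<theta> \<odot> \<rho>)"
      using f by (simp_all add: par_in)
    have "A k l T T' \<cdot> (V \<parallel> idn C \<rho>) \<cdot> (idn C (\<Gamma> m) \<parallel> f) = A k l T T' \<cdot> ((V \<parallel> idn C \<rho>) \<cdot> (idn C (\<Gamma> m) \<parallel> f))"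
      by (rule cmp_assoc[OF _ _ _ _ B p(1,3)]) simp_all
    also have "(V \<parallel> idn C \<rho>) \<cdot> (idn C (\<Gamma> m) \<parallel> f) = (idn C ?\<theta> \<parallel> f) \<cdot> (V \<parallel> idn C \<rho>')"
      using f interchange[of "\<Gamma> m" "\<Gamma> m" ?\<theta> \<rho>' \<rho> \<rho> V "idn C (\<Gamma> m)" "idn C \<rho>" f]
        interchange[of "\<Gamma> m" ?\<theta> ?\<theta> \<rho>' \<rho>' \<rho> "idn C ?\<theta>" V f "idn C \<rho>'"]
      by (simp add: idn_left[of \<rho>' \<rho>] idn_right[of \<rho>' \<rho>] idn_left[of "\<Gamma> m" ?\<theta>] idn_right[of "\<Gamma> m" ?\<theta>])
    also have "A k l T T' \<cdot> \<dots> = A k l T T' \<cdot> (idn C ?\<theta> \<parallel> f) \<cdot> (V \<parallel> idn C \<rho>')"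
      by (rule cmp_assoc[OF _ _ _ _ B p(4,2), symmetric]) simp_all
    finally show "A k l T T' \<cdot> (V \<parallel> idn C \<rho>) \<cdot> (idn C (\<Gamma> m) \<parallel> f) = A k l T T' \<cdot> (idn C ?\<theta> \<parallel> f) \<cdot> (V \<parallel> idn C \<rho>')" .
  qed simp_all
qed

text \<open>Both sides are turned into double sums of products of generators with the vectors in opposite order.
  They agree term by term because of \<open>fusion_flip\<close> and \<open>braid_through_degenerate\<close>.\<close>

lemma naturality:
  assumes deg: "S \<subseteq> degenerate_objects C \<epsilon>"
    and obj [simp]: "\<rho> \<in> Obj C" "\<sigma> \<in> Obj C" "\<rho>' \<in> Obj C" "\<sigma>' \<in> Obj C"
    and M: "set_mset M \<subseteq> gen \<rho> \<rho>'" and N: "set_mset N \<subseteq> gen \<sigma> \<sigma>'"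
  shows "ccmp (emb (\<rho>' \<odot> \<sigma>') (\<sigma>' \<odot> \<rho>') (\<epsilon> \<rho>' \<sigma>')) (cpar (cls \<rho> \<rho>' M) (cls \<sigma> \<sigma>' N)) =
    ccmp (cpar (cls \<sigma> \<sigma>' N) (cls \<rho> \<rho>' M)) (emb (\<rho> \<odot> \<sigma>) (\<sigma> \<odot> \<rho>) (\<epsilon> \<rho> \<sigma>))"
proof -
  note A1 = par_kernel_bilinear[OF obj(1,3,2,4)] and A2 = par_kernel_bilinear[OF obj(2,4,1,3)]
  let ?P = "\<lambda>x y. fprod (\<rho> \<odot> \<sigma>) (par_kernel \<rho> \<sigma>) x y" and ?Q = "\<lambda>y x. fprod (\<sigma> \<odot> \<rho>) (par_kernel \<sigma> \<rho>) y x"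
  let ?l = "\<lambda>k l T T'. \<epsilon> \<rho>' \<sigma>' \<cdot> par_kernel \<rho> \<sigma> k l T T'"
  let ?r = "\<lambda>l k T' T. par_kernel \<sigma> \<rho> l k T' T \<cdot> (idn C (\<Gamma> l \<odot> \<Gamma> k) \<parallel> \<epsilon> \<rho> \<sigma>)"
  have "ccmp (emb (\<rho>' \<odot> \<sigma>') (\<sigma>' \<odot> \<rho>') (\<epsilon> \<rho>' \<sigma>')) (cpar (cls \<rho> \<rho>' M) (cls \<sigma> \<sigma>' N)) =
    cls (\<rho> \<odot> \<sigma>) (\<sigma>' \<odot> \<rho>')
      (image_mset (\<lambda>(m, T, \<psi>). (m, \<epsilon> \<rho>' \<sigma>' \<cdot> T, \<psi>)) (\<Sum>x\<in>#M. \<Sum>y\<in>#N. ?P x y))"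
    unfolding cpar_cls[OF obj(1,3,2,4) M N]
    using fprod_sum_gen[OF A1 _ _ _ _ _ _ M N] by (intro emb_ccmp eps_Hom) simp_all
  also have "image_mset (\<lambda>(m, T, \<psi>). (m, \<epsilon> \<rho>' \<sigma>' \<cdot> T, \<psi>)) (\<Sum>x\<in>#M. \<Sum>y\<in>#N. ?P x y) =
      (\<Sum>x\<in>#M. \<Sum>y\<in>#N. fprod (\<rho> \<odot> \<sigma>) ?l x y)"
    unfolding image_mset_sum_mset
    using M N by (intro sum_mset_cong fprod_post[OF A1 eps_Hom[OF obj(3,4)]]) auto
  also have "cls (\<rho> \<odot> \<sigma>) (\<sigma>' \<odot> \<rho>') (\<Sum>x\<in>#M. \<Sum>y\<in>#N. fprod (\<rho> \<odot> \<sigma>) ?l x y) =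
      cls (\<rho> \<odot> \<sigma>) (\<sigma>' \<odot> \<rho>') (\<Sum>x\<in>#M. \<Sum>y\<in>#N. fprod (\<rho> \<odot> \<sigma>) ?r y x)"
  proof (intro cls_cong rel_sum_mset)
    fix x y assume "x \<in># M" "y \<in># N"
    then have xy: "x \<in> gen \<rho> \<rho>'" "y \<in> gen \<sigma> \<sigma>'" using M N by auto
    obtain k T \<psi> l T' \<phi> where xy_eq: "x = (k, T, \<psi>)" "y = (l, T', \<phi>)" by (cases x, cases y)
    have k: "k \<in> Irr" "T \<in> Hom C (\<Gamma> k \<odot> \<rho>) \<rho>'" "\<psi> \<in> \<H> (\<Gamma> k)"
      and l: "l \<in> Irr" "T' \<in> Hom C (\<Gamma> l \<odot> \<sigma>) \<sigma>'" "\<phi> \<in> \<H> (\<Gamma> l)"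
      using xy by (simp_all add: xy_eq gen_iff)
    have B: "?r l k T' T \<in> Hom C ((\<Gamma> l \<odot> \<Gamma> k) \<odot> (\<rho> \<odot> \<sigma>)) (\<sigma>' \<odot> \<rho>')"
      by (rule cmp_in[OF bilinear_kernelD(1)[OF A2 l(1) k(1) l(2) k(2)] par_in[OF idn_Hom eps_Hom]])
        (simp_all add: k(1) l(1))
    have "\<Gamma> l \<in> degenerate_objects C \<epsilon>" using deg l(1) by auto
    then have "monodromy (\<Gamma> l) \<rho> = idn C (\<Gamma> l \<odot> \<rho>)" by (simp add: degenerate_objects_def)
    then have eq: "?l k l T T' = ?r l k T' T \<cdot> (\<epsilon> (\<Gamma> k) (\<Gamma> l) \<parallel> idn C (\<rho> \<odot> \<sigma>))"
      using k(1) l(1) by (intro braid_through_degenerate k(2) l(2)) simp_all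
    show "rel (\<rho> \<odot> \<sigma>) (\<sigma>' \<odot> \<rho>') (fprod (\<rho> \<odot> \<sigma>) ?l x y) (fprod (\<rho> \<odot> \<sigma>) ?r y x)"
      unfolding fprod_def xy_eq prod.case eq
      by (rule rel_sym, rule fusion_flip[OF k(1) l(1) _ _ B k(3) l(3)]) simp_all
  qed simp_all
  also have "(\<Sum>x\<in>#M. \<Sum>y\<in>#N. fprod (\<rho> \<odot> \<sigma>) ?r y x) = (\<Sum>y\<in>#N. \<Sum>x\<in>#M. fprod (\<rho> \<odot> \<sigma>) ?r y x)"
    by (rule sum_mset.swap)
  also have "\<dots> = image_mset (\<lambda>(m, T, \<psi>). (m, T \<cdot> (idn C (\<Gamma> m) \<parallel> \<epsilon> \<rho> \<sigma>), \<psi>)) (\<Sum>y\<in>#N. \<Sum>x\<in>#M. ?Q y x)"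
    unfolding image_mset_sum_mset
    using M N by (intro sum_mset_cong fprod_pre[OF A2 eps_Hom[OF obj(1,2)], symmetric]) auto
  also have "cls (\<rho> \<odot> \<sigma>) (\<sigma>' \<odot> \<rho>') \<dots> =
      ccmp (cpar (cls \<sigma> \<sigma>' N) (cls \<rho> \<rho>' M)) (emb (\<rho> \<odot> \<sigma>) (\<sigma> \<odot> \<rho>) (\<epsilon> \<rho> \<sigma>))"
    unfolding cpar_cls[OF obj(2,4,1,3) N M]
    using fprod_sum_gen[OF A2 _ _ _ _ _ _ N M] by (intro ccmp_emb[symmetric] eps_Hom) simp_all
  finally show ?thesis .
qed

abbreviation "CP \<equiv> crossed_product C \<epsilon> S U F K"
abbreviation "lift \<equiv> lifted_braiding C \<epsilon> S U F K"

lemma CP_simps: "Obj CP = Obj C" "Hom CP = cp_Hom C S U F K" "idn CP = (\<lambda>\<rho>. emb \<rho> \<rho> (idn C \<rho>))"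
  "cmp CP = ccmp" "unt CP = unt C" "tns CP = tns C" "par CP = cpar"
  by (simp_all add: crossed_product_def)

text \<open>Invertibility and the hexagon equations are those of \<open>\<epsilon>\<close>, since the embedding of the original category
  preserves both products; only naturality involves \<open>S\<close>.\<close>

theorem braiding_if_degenerate:
  assumes deg: "S \<subseteq> degenerate_objects C \<epsilon>"
  shows "braiding CP lift"
  unfolding braiding_def CP_simps lifted_braiding_def
proof (intro conjI ballI)
  fix \<rho> \<sigma> assume [simp]: "\<rho> \<in> Obj C" "\<sigma> \<in> Obj C"
  show "emb (\<rho> \<odot> \<sigma>) (\<sigma> \<odot> \<rho>) (\<epsilon> \<rho> \<sigma>) \<in> cp_Hom C S U F K (\<rho> \<odot> \<sigma>) (\<sigma> \<odot> \<rho>)"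
    by (intro emb_in eps_Hom) simp_all
  have adj: "adj C (\<epsilon> \<rho> \<sigma>) \<in> Hom C (\<sigma> \<odot> \<rho>) (\<rho> \<odot> \<sigma>)" by (simp add: adj_Hom eps_Hom)
  show "\<exists>g\<in>cp_Hom C S U F K (\<sigma> \<odot> \<rho>) (\<rho> \<odot> \<sigma>).
      ccmp g (emb (\<rho> \<odot> \<sigma>) (\<sigma> \<odot> \<rho>) (\<epsilon> \<rho> \<sigma>)) = emb (\<rho> \<odot> \<sigma>) (\<rho> \<odot> \<sigma>) (idn C (\<rho> \<odot> \<sigma>)) \<and>
      ccmp (emb (\<rho> \<odot> \<sigma>) (\<sigma> \<odot> \<rho>) (\<epsilon> \<rho> \<sigma>)) g = emb (\<sigma> \<odot> \<rho>) (\<sigma> \<odot> \<rho>) (idn C (\<sigma> \<odot> \<rho>))"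
  proof (rule bexI[where x = "emb (\<sigma> \<odot> \<rho>) (\<rho> \<odot> \<sigma>) (adj C (\<epsilon> \<rho> \<sigma>))"])
    show "emb (\<sigma> \<odot> \<rho>) (\<rho> \<odot> \<sigma>) (adj C (\<epsilon> \<rho> \<sigma>)) \<in> cp_Hom C S U F K (\<sigma> \<odot> \<rho>) (\<rho> \<odot> \<sigma>)"
      by (intro emb_in adj) simp
  qed (simp add: emb_cmp_emb adj eps_Hom eps_unitary)
next
  fix \<rho> \<sigma> \<rho>' \<sigma>' f g
  assume obj: "\<rho> \<in> Obj C" "\<sigma> \<in> Obj C" "\<rho>' \<in> Obj C" "\<sigma>' \<in> Obj C"
    and "f \<in> cp_Hom C S U F K \<rho> \<rho>'" "g \<in> cp_Hom C S U F K \<sigma> \<sigma>'"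
  then show "ccmp (emb (\<rho>' \<odot> \<sigma>') (\<sigma>' \<odot> \<rho>') (\<epsilon> \<rho>' \<sigma>')) (cpar f g) =
      ccmp (cpar g f) (emb (\<rho> \<odot> \<sigma>) (\<sigma> \<odot> \<rho>) (\<epsilon> \<rho> \<sigma>))"
    unfolding cp_Hom_def using naturality[OF deg obj] by blast
next
  fix \<rho> \<sigma> \<tau> assume obj [simp]: "\<rho> \<in> Obj C" "\<sigma> \<in> Obj C" "\<tau> \<in> Obj C"
  note e = eps_Hom[OF obj(1,3)] eps_Hom[OF obj(1,2)] eps_Hom[OF obj(2,3)]
  note p = par_in[OF idn_Hom[OF obj(2)] e(1)] par_in[OF e(2) idn_Hom[OF obj(3)]]
    par_in[OF e(1) idn_Hom[OF obj(2)]] par_in[OF idn_Hom[OF obj(1)] e(3)]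
  have [simp]: "idn C \<sigma> \<parallel> \<epsilon> \<rho> \<tau> \<in> Hom C (\<sigma> \<odot> (\<rho> \<odot> \<tau>)) (\<sigma> \<odot> (\<tau> \<odot> \<rho>))"
    "\<epsilon> \<rho> \<sigma> \<parallel> idn C \<tau> \<in> Hom C (\<rho> \<odot> (\<sigma> \<odot> \<tau>)) (\<sigma> \<odot> (\<rho> \<odot> \<tau>))"
    "\<epsilon> \<rho> \<tau> \<parallel> idn C \<sigma> \<in> Hom C (\<rho> \<odot> (\<tau> \<odot> \<sigma>)) (\<tau> \<odot> (\<rho> \<odot> \<sigma>))"
    "idn C \<rho> \<parallel> \<epsilon> \<sigma> \<tau> \<in> Hom C (\<rho> \<odot> (\<sigma> \<odot> \<tau>)) (\<rho> \<odot> (\<tau> \<odot> \<sigma>))"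
    using p by (simp_all add: tns_assoc)
  show "emb (\<rho> \<odot> (\<sigma> \<odot> \<tau>)) (\<sigma> \<odot> \<tau> \<odot> \<rho>) (\<epsilon> \<rho> (\<sigma> \<odot> \<tau>)) =
      ccmp (cpar (emb \<sigma> \<sigma> (idn C \<sigma>)) (emb (\<rho> \<odot> \<tau>) (\<tau> \<odot> \<rho>) (\<epsilon> \<rho> \<tau>)))
        (cpar (emb (\<rho> \<odot> \<sigma>) (\<sigma> \<odot> \<rho>) (\<epsilon> \<rho> \<sigma>)) (emb \<tau> \<tau> (idn C \<tau>)))"
    using e by (simp add: emb_par_emb emb_cmp_emb eps_tns tns_assoc)
  show "emb (\<rho> \<odot> \<sigma> \<odot> \<tau>) (\<tau> \<odot> (\<rho> \<odot> \<sigma>)) (\<epsilon> (\<rho> \<odot> \<sigma>) \<tau>) =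
      ccmp (cpar (emb (\<rho> \<odot> \<tau>) (\<tau> \<odot> \<rho>) (\<epsilon> \<rho> \<tau>)) (emb \<sigma> \<sigma> (idn C \<sigma>)))
        (cpar (emb \<rho> \<rho> (idn C \<rho>)) (emb (\<sigma> \<odot> \<tau>) (\<tau> \<odot> \<sigma>) (\<epsilon> \<sigma> \<tau>)))"
    using e by (simp add: emb_par_emb emb_cmp_emb eps_tns tns_assoc)
qed

text \<open>Naturality is applied to the identity of \<open>\<eta>\<close> and the arrow \<open>id \<otimes> \<psi>\<close> from the unit object to \<open>\<gamma>\<^sub>k\<close>. On
  the left the strand \<open>\<gamma>\<^sub>k\<close> crosses \<open>\<eta>\<close> in the tensor product and again in the braiding; on the right
  there is no crossing. The order of the factors matters: for \<open>id \<otimes> \<psi>\<close> and the identity of \<open>\<eta>\<close> in the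
  opposite order naturality holds without any condition.\<close>

theorem degenerate_if_braiding:
  assumes br: "braiding CP lift"
  shows "S \<subseteq> degenerate_objects C \<epsilon>"
proof (rule degenerate_if_irreducibles_degenerate)
  show "even_symmetric_subcategory C \<epsilon> S" by (rule S.even_symmetric_subcategory_axioms)
next
  have gam: "monodromy (\<Gamma> k) \<eta> = idn C (\<Gamma> k \<odot> \<eta>)" if k [simp]: "k \<in> Irr" and \<eta> [simp]: "\<eta> \<in> Obj C" for k \<eta>
  proof -
    let ?g = "\<Gamma> k"
    obtain \<psi> where \<psi>: "\<psi> \<in> \<H> ?g" "\<psi> \<noteq> 0" using \<H>_nontrivial[of ?g] Irr_idn_nz by auto
    let ?M = "{#(k, idn C ?g, \<psi>)#}"
    have M: "set_mset ?M \<subseteq> gen (unt C) ?g" using \<psi> by (simp add: gen_iff tns_unt)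
    have e: "\<epsilon> ?g \<eta> \<in> Hom C (?g \<odot> \<eta>) (\<eta> \<odot> ?g)" "\<epsilon> \<eta> ?g \<in> Hom C (\<eta> \<odot> ?g) (?g \<odot> \<eta>)"
      by (simp_all add: eps_Hom)
    have nat: "ccmp (emb (\<eta> \<odot> ?g) (?g \<odot> \<eta>) (\<epsilon> \<eta> ?g)) (cpar (emb \<eta> \<eta> (idn C \<eta>)) (cls (unt C) ?g ?M)) =
        ccmp (cpar (cls (unt C) ?g ?M) (emb \<eta> \<eta> (idn C \<eta>))) (emb (\<eta> \<odot> unt C) (unt C \<odot> \<eta>) (\<epsilon> \<eta> (unt C)))"
    proof -
      have "emb \<eta> \<eta> (idn C \<eta>) \<in> cp_Hom C S U F K \<eta> \<eta>" by (simp add: emb_in)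
      moreover have "cls (unt C) ?g ?M \<in> cp_Hom C S U F K (unt C) ?g" using M unfolding cp_Hom_def by blast
      ultimately show ?thesis
        using br unfolding braiding_def CP_simps lifted_braiding_def by simp
    qed
    have "cpar (emb \<eta> \<eta> (idn C \<eta>)) (cls (unt C) ?g ?M) = cls \<eta> (\<eta> \<odot> ?g) {#(k, \<epsilon> ?g \<eta>, \<psi>)#}"
      using cpar_emb_left[OF idn_Hom[OF \<eta>] M] e par_unt(2)[OF _ _ e(1)] idn_left[OF _ _ e(1)]
      by (simp add: tns_unt par_idn)
    then have "ccmp (emb (\<eta> \<odot> ?g) (?g \<odot> \<eta>) (\<epsilon> \<eta> ?g)) (cpar (emb \<eta> \<eta> (idn C \<eta>)) (cls (unt C) ?g ?M)) =
        cls \<eta> (?g \<odot> \<eta>) {#(k, monodromy ?g \<eta>, \<psi>)#}"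
      using e \<psi> by (simp add: emb_ccmp gen_iff)
    moreover have "cpar (cls (unt C) ?g ?M) (emb \<eta> \<eta> (idn C \<eta>)) = cls \<eta> (?g \<odot> \<eta>) {#(k, idn C (?g \<odot> \<eta>), \<psi>)#}"
      using cpar_emb_right[OF idn_Hom[OF \<eta>] M] by (simp add: tns_unt par_idn)
    then have "ccmp (cpar (cls (unt C) ?g ?M) (emb \<eta> \<eta> (idn C \<eta>))) (emb (\<eta> \<odot> unt C) (unt C \<odot> \<eta>) (\<epsilon> \<eta> (unt C))) =
        cls \<eta> (?g \<odot> \<eta>) {#(k, idn C (?g \<odot> \<eta>), \<psi>)#}"
      using \<psi> idn_left[of "?g \<odot> \<eta>" "?g \<odot> \<eta>" "idn C (?g \<odot> \<eta>)"]
      by (simp add: ccmp_emb gen_iff tns_unt eps_unt par_idn)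
    ultimately have "cls \<eta> (?g \<odot> \<eta>) {#(k, monodromy ?g \<eta>, \<psi>)#} = cls \<eta> (?g \<odot> \<eta>) {#(k, idn C (?g \<odot> \<eta>), \<psi>)#}"
      using nat by simp
    then have "rel \<eta> (?g \<odot> \<eta>) {#(k, monodromy ?g \<eta>, \<psi>)#} {#(k, idn C (?g \<odot> \<eta>), \<psi>)#}"
      by (rule cls_eqD) (use \<psi> in \<open>simp add: gen_iff\<close>)
    then show ?thesis
      by (rule rel_separates[OF _ \<psi>(2)]) (use \<psi> in \<open>simp add: gen_iff monodromy_Hom\<close>)
  qed
  fix \<rho> assume \<rho>: "\<rho> \<in> S" "irreducible_obj C \<rho>"
  let ?k = "iso_class C \<rho>"
  have k [simp]: "?k \<in> Irr" using \<rho> unfolding Ghat_def by blast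
  have [simp]: "\<rho> \<in> Obj C" using \<rho> by simp
  have "iso_obj C \<rho> (\<Gamma> ?k)" using K.gam_in[OF k] unfolding iso_class_def by blast
  then obtain f g where fg: "f \<in> Hom C \<rho> (\<Gamma> ?k)" "g \<in> Hom C (\<Gamma> ?k) \<rho>" "g \<cdot> f = idn C \<rho>"
    unfolding iso_obj_def by blast
  have "monodromy \<rho> \<eta> = idn C (\<rho> \<odot> \<eta>)" if [simp]: "\<eta> \<in> Obj C" for \<eta>
    using monodromy_factor[OF fg(2,1) _ _ _ gam[OF k]] fg(3) idn_right[of "\<rho> \<odot> \<eta>" "\<rho> \<odot> \<eta>" "monodromy \<rho> \<eta>"]
    by (simp add: par_idn monodromy_Hom)
  then show "\<rho> \<in> degenerate_objects C \<epsilon>" by (simp add: degenerate_objects_def)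
qed

end

theorem lemma3p10:
  fixes C :: "('o, 'a::ab_group_add, 'z) lin_star_tensor_scheme"
    and \<epsilon> :: "'o \<Rightarrow> 'o \<Rightarrow> 'a"
    and S :: "'o set"
    and G :: "('g, 'y) monoid_scheme"
    and TG :: "'g topology"
    and U :: "('g, 'u, 'v::ab_group_add) rep_cat"
    and F :: "('o, 'a, 'u, 'v) rep_functor"
    and K :: "('o, 'a) cp_choice"
  assumes "BTC_star C \<epsilon>"
    and "even_symmetric_subcategory C \<epsilon> S"
    and "compact_group G TG"
    and "rep_category G TG U"
    and "rep_isomorphism C \<epsilon> S G U F"
    and "crossed_product_choice C S K"
  shows "braiding (crossed_product C \<epsilon> S U F K) (lifted_braiding C \<epsilon> S U F K)
    \<longleftrightarrow> S \<subseteq> degenerate_objects C \<epsilon>"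
proof -
  interpret crossed_product_setting C \<epsilon> S G TG U F K
    using assms by (intro crossed_product_setting.intro)
  show ?thesis using braiding_if_degenerate degenerate_if_braiding by blast
qed

end
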